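(* Let $r,p,n$ be positive integers with $p$ dividing $r$. Assume $n>1$ and write $e$ for the greatest divisor of $r/p$ with $\gcd(e,n)=1$. Then $$|\mathrm{Aut}(G(r,p,n))|=\frac{c_{r,p,n}}{c'_{r,p,n}}\cdot\phi(r)\cdot\frac{\phi(e)}{e}\cdot n!\cdot\frac{r^n}{p},$$ $$|\mathrm{Out}(G(r,p,n))|=c_{r,p,n}\cdot\phi(r)\cdot\frac{\phi(e)}{e}\cdot\frac{r}{p}\cdot\gcd(p,n),$$ $$|Z(G(r,p,n))|=c'_{r,p,n}\cdot\frac{r}{p}\cdot\gcd(p,n),$$ where $c_{1,1,2}=1$, $c_{2,2,2}=3$, $c_{2,1,2}=1$, $c_{4,2,2}=3/2$, $c_{3,3,3}=4$, $c_{2,2,4}=6$, $c_{1,1,6}=2$, $c'_{1,1,2}=2$, $c'_{2,2,2}=2$, and in all other cases $$c_{r,p,n}=\begin{cases}1/2,&\text{if }n=2,\\ 1,&\text{if }r\text{ is odd and }n>2,\\ 1,&\text{if }p\text{ is even but }r/p\text{ and }n>2\text{ are odd},\\ 2,&\text{otherwise},\end{cases}\qquad\text{and}\qquad c'_{r,p,n}=1.$$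
   Context: For positive integers $r,p,n$ with $p$ dividing $r$, $G(r,p,n)$ is the group of $n\times n$ generalized permutation matrices whose nonzero entries are complex $r$th roots of unity and such that the product of the nonzero entries is an $(r/p)$th root of unity. $\phi$ is Euler's totient function, $Z(G)$ is the center of $G$, and $\mathrm{Out}(G)=\mathrm{Aut}(G)/\mathrm{Inn}(G)$. "All other cases" is read separately for $c$ and $c'$: the displayed formulas apply to each triple $(r,p,n)$ for which no specific value of $c_{r,p,n}$ (respectively $c'_{r,p,n}$) is listed. *)

theory Defs
  imports
    Complex_Main
    "HOL-Algebra.Algebra"
    "HOL-Number_Theory.Totient"
    "Jordan_Normal_Form.Matrix"
begin

definition gen_perm_mat :: "nat \<Rightarrow> complex mat \<Rightarrow> bool" where
  "gen_perm_mat n A \<longleftrightarrow> A \<in> carrier_mat n n \<and>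
     (\<forall>i<n. \<exists>!j. j < n \<and> A $$ (i, j) \<noteq> 0) \<and>
     (\<forall>j<n. \<exists>!i. i < n \<and> A $$ (i, j) \<noteq> 0)"

definition nz_positions :: "nat \<Rightarrow> complex mat \<Rightarrow> (nat \<times> nat) set" where
  "nz_positions n A = {(i, j). i < n \<and> j < n \<and> A $$ (i, j) \<noteq> 0}"

text \<open>A \<open>k\<close>th root of unity is any solution of \<open>z ^ k = 1\<close>, not necessarily a
  primitive one. The division \<open>r div p\<close> is exact whenever \<open>p dvd r\<close>.\<close>

definition Grpn :: "nat \<Rightarrow> nat \<Rightarrow> nat \<Rightarrow> complex mat monoid" where
  "Grpn r p n =
     \<lparr>carrier = {A. gen_perm_mat n A \<and>
        (\<forall>ij \<in> nz_positions n A. (A $$ ij) ^ r = 1) \<and>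
        (\<Prod>ij \<in> nz_positions n A. A $$ ij) ^ (r div p) = 1},
      monoid.mult = (*),
      one = 1\<^sub>m n\<rparr>"

definition center :: "('a, 'b) monoid_scheme \<Rightarrow> 'a set" where
  "center G = {z \<in> carrier G. \<forall>g \<in> carrier G. z \<otimes>\<^bsub>G\<^esub> g = g \<otimes>\<^bsub>G\<^esub> z}"

text \<open>Restriction to the carrier is needed because \<open>AutoGroup\<close> represents automorphisms
  as extensional functions.\<close>

definition Inn :: "('a, 'b) monoid_scheme \<Rightarrow> ('a \<Rightarrow> 'a) set" where
  "Inn G = (\<lambda>g. \<lambda>x \<in> carrier G. g \<otimes>\<^bsub>G\<^esub> x \<otimes>\<^bsub>G\<^esub> inv\<^bsub>G\<^esub> g) ` carrier G"

definition Out :: "('a, 'b) monoid_scheme \<Rightarrow> ('a \<Rightarrow> 'a) set monoid" where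
  "Out G = AutoGroup G Mod Inn G"

definition c_aut :: "nat \<Rightarrow> nat \<Rightarrow> nat \<Rightarrow> real" where
  "c_aut r p n =
     (if (r, p, n) = (1, 1, 2) then 1
      else if (r, p, n) = (2, 2, 2) then 3
      else if (r, p, n) = (2, 1, 2) then 1
      else if (r, p, n) = (4, 2, 2) then 3 / 2
      else if (r, p, n) = (3, 3, 3) then 4
      else if (r, p, n) = (2, 2, 4) then 6
      else if (r, p, n) = (1, 1, 6) then 2
      else if n = 2 then 1 / 2
      else if odd r \<and> n > 2 then 1
      else if even p \<and> odd (r div p) \<and> n > 2 \<and> odd n then 1
      else 2)"

definition c_center :: "nat \<Rightarrow> nat \<Rightarrow> nat \<Rightarrow> real" where
  "c_center r p n =
     (if (r, p, n) = (1, 1, 2) then 2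
      else if (r, p, n) = (2, 2, 2) then 2
      else 1)"

end

(* G(r,p,n) is the semidirect product of its diagonal subgroup N and S_n.  If an automorphism
   maps N to itself, it induces an automorphism of S_n, which is inner because it preserves
   the property that two transpositions have a product of order at most 3; after composing
   with an inner automorphism it is the identity on S_n, and is then given by an equivariant
   automorphism x |-> x^k (prod x)^v of N and a cocycle S_n -> N, that is, conjugation by a
   diagonal matrix twisted by a sign character.  These are counted explicitly.  An image
   L of N other than N projects onto an abelian normal, hence regular, subgroup of S_n, so n <= 4,
   and L Int N consists of scalars, so r^(n-1) <= n gcd(p,n).  This leaves a few triples (r,p,n),
   for which the images of N are counted directly (orbit-stabiliser).  Only (1,1,6) involves
   the outer automorphism of S_6.  Finally |Out| = |Aut| |Z| / |G|. *)

theory Submission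
  imports Defs
begin

section \<open>Automorphism groups of finite groups\<close>

text \<open>With m = r/p, the formula reflects the parameter count: phi(r) exponents k; for each k,
  m * phi(e)/e exponents v with k + n v prime to m, since the product of the entries is raised to
  the power k + n v; and r^(n-1) diagonal matrices up to scalars. The quotient c/c' collects the
  rest: the number of images of N (2, 3, 3, 4, 3 for (2,1,2), (2,2,2), (4,2,2), (3,3,3), (2,2,4),
  otherwise 1), times 2 if n > 2 and the sign twist by the scalar -1 exists (r and n m even), times
  1/2 if n = 2, where conjugation by S_2 does nothing to S_2 although the formula contains n! = 2,
  and times 2 for the outer automorphism of S_6. Two obstacles shape the proof. The induced
  automorphism of S_6 might be outer; for r > 1 this is excluded by comparing how many commutators a
  transposition and a fixed-point-free involution have with N. And N need not be characteristic;
  except for (2,2,2), it is moved by conjugation with the character table of C_2, C_3 or C_2 x C_2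
  (Hadamard and Fourier matrices), which turns diagonal matrices into permutation matrices.\<close>

lemma (in group) card_eq_card_image_mult:
  assumes S: "subgroup S G" and "finite S" and "H \<subseteq> S"
    and f: "\<And>a b. a \<in> S \<Longrightarrow> b \<in> S \<Longrightarrow> f a = f b \<longleftrightarrow> inv a \<otimes> b \<in> H"
  shows "card S = card (f ` S) * card H"
proof -
  have SG: "S \<subseteq> carrier G"
    using S by (rule subgroup.subset)
  \<comment> \<open>The fibre of \<open>f\<close> through \<open>a\<close> is the left coset of
    \<open>H\<close> through \<open>a\<close>, so all fibres have the same size. Orbit-stabiliser,
    the order of the inner automorphism group, and the fibration of an image of the diagonal
    subgroup over its permutations are all instances.\<close>
  have fib: "card {b \<in> S. f b = y} = card H" if "y \<in> f ` S" for y
  proof -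
    from that obtain a where a: "a \<in> S" "y = f a"
      by (elim imageE)
    have aG: "a \<in> carrier G"
      using a SG by blast
    have HG: "H \<subseteq> carrier G"
      using \<open>H \<subseteq> S\<close> SG by blast
    have "inj_on (\<lambda>h. a \<otimes> h) H"
      using aG HG by (intro inj_onI) (metis l_cancel subsetD)
    moreover have "(\<lambda>h. a \<otimes> h) ` H = {b \<in> S. f b = y}"
    proof (intro equalityI subsetI)
      fix b assume "b \<in> (\<lambda>h. a \<otimes> h) ` H"
      then obtain h where h: "h \<in> H" "b = a \<otimes> h" by blast
      then have "b \<in> S"
        using a S \<open>H \<subseteq> S\<close> by (auto intro: subgroup.m_closed)
      moreover have "inv a \<otimes> b = h"
        using h aG HG by (simp add: m_assoc[symmetric] subset_iff)
      ultimately show "b \<in> {b \<in> S. f b = y}"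
        using f[of a b] a h by auto
    next
      fix b assume "b \<in> {b \<in> S. f b = y}"
      then have b: "b \<in> S" "inv a \<otimes> b \<in> H"
        using f[of a b] a by auto
      then have "b = a \<otimes> (inv a \<otimes> b)"
        using aG SG by (simp add: m_assoc[symmetric] subset_iff)
      then show "b \<in> (\<lambda>h. a \<otimes> h) ` H"
        using b by blast
    qed
    ultimately show ?thesis
      using card_image by fastforce
  qed
  have "card S = (\<Sum>y \<in> f ` S. card {b \<in> S. f b = y})"
    using sum.image_gen[OF \<open>finite S\<close>, of "\<lambda>_. 1::nat" f] by simp
  then show ?thesis
    using fib by simp
qed

lemma carrier_AutoGroup [simp]: "carrier (AutoGroup G) = auto G"
  by (simp add: AutoGroup_def)

lemma mult_AutoGroup:
  "a \<in> auto G \<Longrightarrow> b \<in> auto G \<Longrightarrow> a \<otimes>\<^bsub>AutoGroup G\<^esub> b = compose (carrier G) a b"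
  by (simp add: AutoGroup_def BijGroup_def auto_def)

lemma one_AutoGroup: "\<one>\<^bsub>AutoGroup G\<^esub> = (\<lambda>x \<in> carrier G. x)"
  by (simp add: AutoGroup_def BijGroup_def)

lemma auto_iff:
  "a \<in> auto G \<longleftrightarrow> a \<in> extensional (carrier G) \<and> bij_betw a (carrier G) (carrier G) \<and>
     (\<forall>x\<in>carrier G. \<forall>y\<in>carrier G. a (x \<otimes>\<^bsub>G\<^esub> y) = a x \<otimes>\<^bsub>G\<^esub> a y)"
  by (auto simp: auto_def Bij_def hom_def bij_betw_def)

lemma auto_closed: "a \<in> auto G \<Longrightarrow> x \<in> carrier G \<Longrightarrow> a x \<in> carrier G"
  by (auto simp: auto_iff bij_betw_def)

lemma auto_mult:
  "a \<in> auto G \<Longrightarrow> x \<in> carrier G \<Longrightarrow> y \<in> carrier G \<Longrightarrow> a (x \<otimes>\<^bsub>G\<^esub> y) = a x \<otimes>\<^bsub>G\<^esub> a y"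
  by (auto simp: auto_iff)

lemma auto_inj: "a \<in> auto G \<Longrightarrow> inj_on a (carrier G)"
  by (auto simp: auto_iff bij_betw_def)

lemma auto_image: "a \<in> auto G \<Longrightarrow> a ` carrier G = carrier G"
  by (auto simp: auto_iff bij_betw_def)

lemma auto_ext:
  "a \<in> auto G \<Longrightarrow> b \<in> auto G \<Longrightarrow> (\<And>x. x \<in> carrier G \<Longrightarrow> a x = b x) \<Longrightarrow> a = b"
  unfolding auto_iff by (blast intro: extensionalityI)

lemma finite_auto:
  assumes "finite (carrier G)" shows "finite (auto G)"
proof (rule finite_subset)
  show "auto G \<subseteq> carrier G \<rightarrow>\<^sub>E carrier G"
  proof
    fix a assume a: "a \<in> auto G"
    then have "a \<in> extensional (carrier G)" by (simp add: auto_iff)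
    then show "a \<in> carrier G \<rightarrow>\<^sub>E carrier G"
      using auto_closed[OF a] by (simp add: PiE_def)
  qed
  show "finite (carrier G \<rightarrow>\<^sub>E carrier G)"
    using assms by (intro finite_PiE)
qed

text \<open>Automorphisms are extensional here, so a map given by a formula has to be restricted to
  the carrier; on a finite carrier injectivity already gives bijectivity.\<close>

lemma restrict_autoI:
  assumes "finite (carrier G)" "\<And>x. x \<in> carrier G \<Longrightarrow> a x \<in> carrier G" "inj_on a (carrier G)"
    and "\<And>x y. x \<in> carrier G \<Longrightarrow> y \<in> carrier G \<Longrightarrow> a (x \<otimes>\<^bsub>G\<^esub> y) = a x \<otimes>\<^bsub>G\<^esub> a y"
    and "\<And>x y. x \<in> carrier G \<Longrightarrow> y \<in> carrier G \<Longrightarrow> x \<otimes>\<^bsub>G\<^esub> y \<in> carrier G"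
  shows "restrict a (carrier G) \<in> auto G"
proof -
  have "a ` carrier G = carrier G"
    using assms by (intro endo_inj_surj) auto
  then have "bij_betw a (carrier G) (carrier G)"
    using assms by (simp add: bij_betw_def)
  then show ?thesis
    using assms by (auto simp: auto_iff)
qed

lemma auto_inv_into:
  assumes "group G" "a \<in> auto G" "x \<in> carrier G"
  shows "(inv\<^bsub>AutoGroup G\<^esub> a) (a x) = x"
proof -
  interpret A: group "AutoGroup G" by (rule group.AutoGroup[OF assms(1)])
  have "inv\<^bsub>AutoGroup G\<^esub> a \<in> auto G"
    using A.inv_closed[of a] assms by simp
  then have "compose (carrier G) (inv\<^bsub>AutoGroup G\<^esub> a) a = inv\<^bsub>AutoGroup G\<^esub> a \<otimes>\<^bsub>AutoGroup G\<^esub> a"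
    using assms by (simp add: mult_AutoGroup)
  also have "\<dots> = (\<lambda>x \<in> carrier G. x)"
    using assms A.l_inv[of a] by (simp add: one_AutoGroup)
  finally have "compose (carrier G) (inv\<^bsub>AutoGroup G\<^esub> a) a = (\<lambda>x \<in> carrier G. x)" .
  from fun_cong[OF this, of x] show ?thesis
    using assms(3) by (simp add: compose_def)
qed

lemma auto_inv_into':
  assumes "group G" "a \<in> auto G" "x \<in> carrier G"
  shows "a ((inv\<^bsub>AutoGroup G\<^esub> a) x) = x"
proof -
  interpret A: group "AutoGroup G" by (rule group.AutoGroup[OF assms(1)])
  have "inv\<^bsub>AutoGroup G\<^esub> a \<in> auto G"
    using A.inv_closed[of a] assms by simp
  from auto_inv_into[OF assms(1) this assms(3)] show ?thesis
    using assms by simp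
qed

lemma auto_one:
  assumes "group G" "a \<in> auto G" shows "a \<one>\<^bsub>G\<^esub> = \<one>\<^bsub>G\<^esub>"
  using assms by (intro hom_one) (auto simp: auto_def)

text \<open>Orbit-stabiliser for the action of the automorphism group on subsets. It is applied with
  \<open>Y\<close> the diagonal subgroup and, for S_6, with \<open>Y\<close> the set of
  transpositions.\<close>

lemma card_auto_eq_card_orbit_mult:
  assumes "group G" "finite (carrier G)" "Y \<subseteq> carrier G"
  shows "card (auto G) = card ((\<lambda>a. a ` Y) ` auto G) * card {a \<in> auto G. a ` Y = Y}"
proof -
  interpret A: group "AutoGroup G" by (rule group.AutoGroup[OF assms(1)])
  have key: "a ` Y = b ` Y \<longleftrightarrow>
      inv\<^bsub>AutoGroup G\<^esub> a \<otimes>\<^bsub>AutoGroup G\<^esub> b \<in> {a \<in> auto G. a ` Y = Y}"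
    if ab: "a \<in> auto G" "b \<in> auto G" for a b
  proof -
    let ?c = "inv\<^bsub>AutoGroup G\<^esub> a"
    have c: "?c \<in> auto G" using A.inv_closed[of a] ab by simp
    have cb: "?c \<otimes>\<^bsub>AutoGroup G\<^esub> b \<in> auto G" using A.m_closed[of ?c b] c ab by simp
    have img: "(?c \<otimes>\<^bsub>AutoGroup G\<^esub> b) ` Y = ?c ` b ` Y"
      unfolding mult_AutoGroup[OF c ab(2)] image_image
      using assms(3) by (intro image_cong) (auto simp: compose_def)
    have bX: "b ` Y \<subseteq> carrier G"
      using assms(3) auto_closed[OF ab(2)] by blast
    have ca: "?c ` a ` Y = Y"
    proof -
      have "?c ` a ` Y = (\<lambda>x. x) ` Y"
        unfolding image_image using assms(3) auto_inv_into[OF assms(1) ab(1)]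
        by (intro image_cong) auto
      then show ?thesis by simp
    qed
    have ac: "a ` ?c ` b ` Y = b ` Y"
    proof -
      have "a ` ?c ` b ` Y = (\<lambda>x. x) ` b ` Y"
        unfolding image_image[of a] using bX auto_inv_into'[OF assms(1) ab(1)]
        by (intro image_cong) auto
      then show ?thesis by simp
    qed
    have "a ` Y = b ` Y \<longleftrightarrow> ?c ` b ` Y = Y"
      using ca ac by metis
    with cb img show ?thesis
      by (simp only: mem_Collect_eq simp_thms)
  qed
  have sub: "subgroup (auto G) (AutoGroup G)"
    using A.subgroup_self by simp
  show ?thesis
    by (rule A.card_eq_card_image_mult[OF sub finite_auto[OF assms(2)] _ key]) auto
qed

lemma auto_inv:
  assumes "group G" "a \<in> auto G" "x \<in> carrier G" shows "a (inv\<^bsub>G\<^esub> x) = inv\<^bsub>G\<^esub> (a x)"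
proof -
  have "group_hom G G a"
    using assms by (intro group_hom.intro group_hom_axioms.intro) (auto simp: auto_def)
  from group_hom.hom_inv[OF this assms(3)] show ?thesis .
qed

text \<open>Conjugation by \<open>f\<close> embeds the automorphisms of \<open>G\<close> into those
  of \<open>H\<close>. The inequality suffices because the inverse isomorphism yields the opposite
  one.\<close>

lemma card_auto_le_of_iso:
  assumes "group G" "group H" "finite (carrier H)" "f \<in> iso G H"
  shows "card (auto G) \<le> card (auto H)"
proof -
  interpret G: group G by fact
  define g where "g = inv_into (carrier G) f"
  have bij: "bij_betw f (carrier G) (carrier H)" and hom: "f \<in> hom G H"
    using assms(4) by (auto simp: iso_def)
  have gf: "g (f x) = x" if "x \<in> carrier G" for x
    using that bij by (simp add: g_def bij_betw_inv_into_left)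
  have fg: "f (g y) = y" if "y \<in> carrier H" for y
    using that bij by (simp add: g_def bij_betw_inv_into_right)
  have fc: "f x \<in> carrier H" if "x \<in> carrier G" for x
    using that bij by (auto simp: bij_betw_def)
  have gc: "g y \<in> carrier G" if "y \<in> carrier H" for y
    using that bij by (auto simp: bij_betw_def g_def inv_into_into)
  have gm: "g (x \<otimes>\<^bsub>H\<^esub> y) = g x \<otimes>\<^bsub>G\<^esub> g y" if "x \<in> carrier H" "y \<in> carrier H" for x y
    using that gf[of "g x \<otimes>\<^bsub>G\<^esub> g y"] hom by (simp add: hom_mult gc fg)
  show ?thesis
  proof (rule card_inj_on_le)
    show "inj_on (\<lambda>a. restrict (\<lambda>y. f (a (g y))) (carrier H)) (auto G)"
    proof (rule inj_onI)
      fix a b assume a: "a \<in> auto G" and b: "b \<in> auto G"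
        and eq: "restrict (\<lambda>y. f (a (g y))) (carrier H) = restrict (\<lambda>y. f (b (g y))) (carrier H)"
      show "a = b"
      proof (rule auto_ext[OF a b])
        fix x assume x: "x \<in> carrier G"
        have "f (a x) = f (b x)"
          using fun_cong[OF eq, of "f x"] x by (simp add: fc gf)
        then show "a x = b x"
          using gf auto_closed[OF a x] auto_closed[OF b x] by metis
      qed
    qed
    show "(\<lambda>a. restrict (\<lambda>y. f (a (g y))) (carrier H)) ` auto G \<subseteq> auto H"
    proof (rule image_subsetI)
      fix a assume a: "a \<in> auto G"
      show "restrict (\<lambda>y. f (a (g y))) (carrier H) \<in> auto H"
      proof (rule restrict_autoI)
        show "inj_on (\<lambda>y. f (a (g y))) (carrier H)"
        proof (rule inj_onI)
          fix x y assume "x \<in> carrier H" "y \<in> carrier H" "f (a (g x)) = f (a (g y))"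
          then have "a (g x) = a (g y)"
            using gf a by (metis auto_closed gc)
          then have "g x = g y"
            using inj_onD[OF auto_inj[OF a]] gc \<open>x \<in> carrier H\<close> \<open>y \<in> carrier H\<close> by blast
          then show "x = y"
            using fg \<open>x \<in> carrier H\<close> \<open>y \<in> carrier H\<close> by metis
        qed
      qed (use assms(2,3) a hom in \<open>auto simp: fc gc auto_closed gm auto_mult hom_mult
            group.is_monoid monoid.m_closed\<close>)
    qed
    show "finite (auto H)"
      using assms(3) by (rule finite_auto)
  qed
qed

lemma card_auto_iso:
  assumes "group G" "group H" "finite (carrier H)" "f \<in> iso G H"
  shows "card (auto G) = card (auto H)"
proof (rule antisym)
  show "card (auto G) \<le> card (auto H)"
    using assms by (rule card_auto_le_of_iso)
  have "inv_into (carrier G) f \<in> iso H G"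
    using assms group.iso_set_sym by blast
  moreover have "finite (carrier G)"
    using assms bij_betw_finite unfolding iso_def by blast
  ultimately show "card (auto H) \<le> card (auto G)"
    using assms card_auto_le_of_iso by blast
qed

lemma card_center_iso:
  assumes "group G" "f \<in> iso G H"
  shows "card (center G) = card (center H)"
proof -
  interpret G: group G by fact
  have bij: "bij_betw f (carrier G) (carrier H)" and hom: "f \<in> hom G H"
    using assms(2) by (auto simp: iso_def)
  have inj: "inj_on f (carrier G)" and surj: "f ` carrier G = carrier H"
    using bij by (auto simp: bij_betw_def)
  have "f ` center G = center H"
  proof (intro equalityI subsetI)
    fix y assume "y \<in> f ` center G"
    then obtain x where x: "x \<in> center G" "y = f x" by (elim imageE)
    have "y \<otimes>\<^bsub>H\<^esub> h = h \<otimes>\<^bsub>H\<^esub> y" if "h \<in> carrier H" for h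
    proof -
      have "h \<in> f ` carrier G"
        using that surj by simp
      then obtain g where g: "g \<in> carrier G" "h = f g"
        by (elim imageE)
      have x': "x \<in> carrier G" "x \<otimes>\<^bsub>G\<^esub> g = g \<otimes>\<^bsub>G\<^esub> x"
        using x(1) g(1) by (simp_all add: center_def)
      have "f x \<otimes>\<^bsub>H\<^esub> f g = f (x \<otimes>\<^bsub>G\<^esub> g)"
        using hom_mult[OF hom x'(1) g(1)] by simp
      also have "\<dots> = f g \<otimes>\<^bsub>H\<^esub> f x"
        using hom_mult[OF hom g(1) x'(1)] x'(2) by simp
      finally show ?thesis
        using x(2) g(2) by simp
    qed
    moreover have "y \<in> carrier H"
      using x surj by (auto simp: center_def)
    ultimately show "y \<in> center H"
      by (simp add: center_def)
  next
    fix y assume y: "y \<in> center H"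
    then obtain x where x: "x \<in> carrier G" "y = f x"
      using surj by (auto simp: center_def)
    have "x \<otimes>\<^bsub>G\<^esub> g = g \<otimes>\<^bsub>G\<^esub> x" if "g \<in> carrier G" for g
    proof (rule inj_onD[OF inj])
      show "f (x \<otimes>\<^bsub>G\<^esub> g) = f (g \<otimes>\<^bsub>G\<^esub> x)"
      proof -
        have "f g \<in> carrier H" using that surj by blast
        then have "y \<otimes>\<^bsub>H\<^esub> f g = f g \<otimes>\<^bsub>H\<^esub> y"
          using y by (simp add: center_def)
        then show ?thesis
          using x that hom_mult[OF hom] by simp
      qed
    qed (use x that in auto)
    then show "y \<in> f ` center G"
      using x by (auto simp: center_def)
  qed
  moreover have "inj_on f (center G)"
    using inj by (rule inj_on_subset) (auto simp: center_def)
  ultimately show ?thesis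
    using card_image by metis
qed

section \<open>Inner automorphisms, centre and outer automorphism group\<close>

context group
begin

lemma inner_auto:
  assumes "g \<in> carrier G"
  shows "(\<lambda>x\<in>carrier G. g \<otimes> x \<otimes> inv g) \<in> auto G"
proof -
  have "bij_betw (\<lambda>x. g \<otimes> x \<otimes> inv g) (carrier G) (carrier G)"
    by (rule bij_betw_byWitness[where f' = "\<lambda>x. inv g \<otimes> x \<otimes> g"])
       (use assms in \<open>auto simp: m_assoc, auto simp: m_assoc[symmetric]\<close>)
  moreover have "g \<otimes> (x \<otimes> y) \<otimes> inv g = (g \<otimes> x \<otimes> inv g) \<otimes> (g \<otimes> y \<otimes> inv g)"
    if "x \<in> carrier G" "y \<in> carrier G" for x y
  proof -
    have "inv g \<otimes> (g \<otimes> (y \<otimes> inv g)) = y \<otimes> inv g"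
      using assms that by (simp add: m_assoc[symmetric])
    then show ?thesis
      using assms that by (simp add: m_assoc)
  qed
  ultimately show ?thesis
    using assms by (auto simp: auto_iff)
qed

lemma inner_eq_iff:
  assumes "a \<in> carrier G" "b \<in> carrier G"
  shows "(\<lambda>x\<in>carrier G. a \<otimes> x \<otimes> inv a) = (\<lambda>x\<in>carrier G. b \<otimes> x \<otimes> inv b)
    \<longleftrightarrow> inv a \<otimes> b \<in> center G"
proof -
  let ?z = "inv a \<otimes> b"
  have z: "?z \<in> carrier G" and b: "b = a \<otimes> ?z"
    using assms by (simp_all add: m_assoc[symmetric])
  have eq: "a \<otimes> x \<otimes> inv a = b \<otimes> x \<otimes> inv b \<longleftrightarrow> ?z \<otimes> x = x \<otimes> ?z" if x: "x \<in> carrier G" for x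
  proof -
    have "a \<otimes> x \<otimes> inv a = b \<otimes> x \<otimes> inv b \<longleftrightarrow> a \<otimes> x \<otimes> inv a \<otimes> b = b \<otimes> x \<otimes> inv b \<otimes> b"
      using assms x by simp
    also have "\<dots> \<longleftrightarrow> a \<otimes> (x \<otimes> ?z) = b \<otimes> x"
      using assms x by (simp add: m_assoc)
    also have "\<dots> \<longleftrightarrow> inv a \<otimes> (a \<otimes> (x \<otimes> ?z)) = inv a \<otimes> (b \<otimes> x)"
      using assms x z by simp
    also have "\<dots> \<longleftrightarrow> x \<otimes> ?z = ?z \<otimes> x"
      using assms x z by (simp add: m_assoc[symmetric])
    finally show ?thesis by auto
  qed
  have "(\<lambda>x\<in>carrier G. a \<otimes> x \<otimes> inv a) = (\<lambda>x\<in>carrier G. b \<otimes> x \<otimes> inv b)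
    \<longleftrightarrow> (\<forall>x\<in>carrier G. a \<otimes> x \<otimes> inv a = b \<otimes> x \<otimes> inv b)"
    by (metis (mono_tags, lifting) restrict_apply' restrict_ext)
  then show ?thesis
    using eq z by (simp add: center_def)
qed

lemma subgroup_Inn: "subgroup (Inn G) (AutoGroup G)"
proof -
  interpret A: group "AutoGroup G" by (rule AutoGroup)
  let ?f = "\<lambda>g. \<lambda>x\<in>carrier G. g \<otimes> x \<otimes> inv g"
  have "?f (g \<otimes> h) = ?f g \<otimes>\<^bsub>AutoGroup G\<^esub> ?f h" if "g \<in> carrier G" "h \<in> carrier G" for g h
    using that by (auto simp: mult_AutoGroup inner_auto compose_def inv_mult_group m_assoc
        intro!: restrict_ext)
  then interpret group_hom G "AutoGroup G" ?f
    by unfold_locales (auto simp: hom_def inner_auto)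
  show ?thesis
    unfolding Inn_def by (rule img_is_subgroup)
qed

lemma order_eq_card_Inn_mult:
  assumes "finite (carrier G)"
  shows "card (carrier G) = card (Inn G) * card (center G)"
  unfolding Inn_def
  by (rule card_eq_card_image_mult)
     (use assms subgroup_self inner_eq_iff in \<open>auto simp: center_def\<close>)

lemma card_Out:
  assumes "finite (carrier G)"
  shows "card (carrier (Out G)) * card (Inn G) = card (auto G)"
proof -
  interpret A: group "AutoGroup G" by (rule AutoGroup)
  show ?thesis
    using A.lagrange[OF subgroup_Inn] by (simp add: Out_def FactGroup_def order_def)
qed

end

section \<open>Divisor counts and roots of unity\<close>

text \<open>If a prime q divides \<open>m div e\<close> but not \<open>n\<close>, then q * e is a
  larger divisor of \<open>m\<close> prime to \<open>n\<close>. The last conclusion is the form in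
  which maximality enters the count.\<close>

lemma greatest_coprime_divisor:
  fixes m n e :: nat
  assumes "m > 0" and e: "e = (GREATEST d. d dvd m \<and> coprime d n)"
  shows "e dvd m" "coprime e n" "\<And>q. Factorial_Ring.prime q \<Longrightarrow> q dvd m div e \<Longrightarrow> q dvd n"
proof -
  have bound: "\<And>d. d dvd m \<and> coprime d n \<Longrightarrow> d \<le> m"
    using assms(1) by (auto dest: dvd_imp_le)
  have "e dvd m \<and> coprime e n"
    unfolding e by (rule GreatestI_nat[where k = 1 and b = m]) (use bound in auto)
  then show dvd: "e dvd m" and cop: "coprime e n"
    by auto
  fix q :: nat assume q: "Factorial_Ring.prime q" "q dvd m div e"
  show "q dvd n"
  proof (rule ccontr)
    assume "\<not> q dvd n"
    then have "coprime (q * e) n"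
      using cop q(1) prime_imp_coprime by auto
    moreover have "q * e dvd m"
      using q(2) dvd by (metis dvd_div_mult_self dvd_refl mult_dvd_mono)
    ultimately have "q * e \<le> e"
      unfolding e by (intro Greatest_le_nat[where b = m]) (use bound in \<open>auto simp: e\<close>)
    moreover have "e > 0"
      using dvd assms(1) by (auto intro: Nat.gr0I)
    ultimately show False
      using prime_gt_1_nat[OF q(1)] by auto
  qed
qed

lemma card_periodic:
  fixes e f :: nat
  assumes "\<And>v. P (v + e) \<longleftrightarrow> P v"
  shows "card {v. v < e * f \<and> P v} = f * card {v. v < e \<and> P v}"
proof (induction f)
  case (Suc f)
  have P: "P (v + e * f) \<longleftrightarrow> P v" for v
  proof (induction f)
    case (Suc f)
    have "v + e * Suc f = (v + e * f) + e" by simp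
    then show ?case using Suc assms by metis
  qed simp
  have "{v. v < e * Suc f \<and> P v} = {v. v < e * f \<and> P v} \<union> (\<lambda>v. v + e * f) ` {v. v < e \<and> P v}"
    (is "?L = ?A \<union> ?B")
  proof (intro equalityI subsetI)
    fix v assume v: "v \<in> ?L"
    show "v \<in> ?A \<union> ?B"
    proof (cases "v < e * f")
      case False
      then have "v = (v - e * f) + e * f" "v - e * f < e"
        using v by auto
      then show ?thesis using v P[of "v - e * f"] by (intro UnI2 image_eqI) auto
    qed (use v in auto)
  qed (use P in auto)
  moreover have "?A \<inter> ?B = {}" by auto
  moreover have "card ?B = card {v. v < e \<and> P v}"
    by (rule card_image) (auto intro: inj_onI)
  ultimately show ?case
    using Suc by (simp add: card_Un_disjoint)
qed simp

lemma card_coprime_lessThan: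
  fixes e :: nat
  assumes "e > 0"
  shows "card {u. u < e \<and> coprime u e} = totient e"
\<comment> \<open>For \<open>e = 1\<close> the residue is represented by 0 on the left but by 1 in
  \<open>totatives\<close>.\<close>
proof (cases "e = 1")
  case False
  then have "{u. u < e \<and> coprime u e} = totatives e"
    using assms by (auto simp: totatives_def intro!: Nat.gr0I le_neq_implies_less)
  then show ?thesis by (simp add: totient_def)
qed (simp add: Collect_conv_if cong: conj_cong)

text \<open>Counts the exponents v that are admissible for a given k. A prime factor of m/e divides
  \<open>n\<close>, so it cannot divide k + n v without dividing \<open>k\<close>, which is prime to
  \<open>m\<close>. Hence only coprimality to \<open>e\<close> matters; it depends on v modulo
  \<open>e\<close>, and each period contains phi(e) solutions. The factor \<open>e\<close> on the
  left avoids a division.\<close>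

lemma card_coprime_shift:
  fixes k m n e :: nat
  assumes "m > 0" "coprime k m" and e: "e = (GREATEST d. d dvd m \<and> coprime d n)"
  shows "e * card {v. v < m \<and> coprime (k + n * v) m} = m * totient e"
proof -
  note ge = greatest_coprime_divisor[OF assms(1) e]
  define f where "f = m div e"
  have m: "m = e * f"
    using ge(1) by (simp add: f_def)
  have e0: "e > 0" using m assms(1) by (auto intro: Nat.gr0I)
  have cop: "coprime (k + n * v) m \<longleftrightarrow> coprime (k + n * v) e" for v
  proof
    assume c: "coprime (k + n * v) e"
    show "coprime (k + n * v) m"
    proof (rule ccontr)
      assume "\<not> coprime (k + n * v) m"
      then have "gcd (k + n * v) m \<noteq> 1"
        by (simp add: coprime_iff_gcd_eq_1)
      then obtain q where q: "Factorial_Ring.prime q" "q dvd gcd (k + n * v) m"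
        using prime_factor_nat by blast
      then have q: "Factorial_Ring.prime q" "q dvd k + n * v" "q dvd m"
        by simp_all
      then have "q dvd e \<or> q dvd f"
        using m prime_dvd_mult_iff by blast
      then show False
      proof
        assume "q dvd e"
        then show False
          using c q coprime_common_divisor[of "k + n * v" e q] not_prime_unit[of q] by simp
      next
        assume "q dvd f"
        then have "q dvd n" using ge(3) q(1) f_def by blast
        then have "q dvd k" using q(2) by (simp add: dvd_add_left_iff)
        then show False
          using assms(2) q coprime_common_divisor[of k m q] not_prime_unit[of q] by simp
      qed
    qed
  next
    assume "coprime (k + n * v) m"
    then show "coprime (k + n * v) e" by (simp add: m)
  qed
  have "card {v. v < m \<and> coprime (k + n * v) m} = card {v. v < e * f \<and> coprime (k + n * v) e}"
    using m cop by simp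
  also have "\<dots> = f * card {v. v < e \<and> coprime (k + n * v) e}"
  proof (rule card_periodic)
    fix v
    have "k + n * (v + e) = (k + n * v) + n * e" by (simp add: algebra_simps)
    then have "(k + n * (v + e)) mod e = (k + n * v) mod e" by (metis mod_mult_self1)
    then show "coprime (k + n * (v + e)) e \<longleftrightarrow> coprime (k + n * v) e"
      using e0 coprime_mod_left_iff[of e] by (metis neq0_conv)
  qed
  also have "card {v. v < e \<and> coprime (k + n * v) e} = card {u. u < e \<and> coprime u e}"
  proof (rule bij_betw_same_card)
    \<comment> \<open>Since \<open>n\<close> is invertible modulo \<open>e\<close>, this affine map
      permutes the residues.\<close>
    let ?h = "\<lambda>v. (k + n * v) mod e"
    have inj: "inj_on ?h {..<e}"
    proof (rule inj_onI)
      fix v w assume vw: "v \<in> {..<e}" "w \<in> {..<e}" "?h v = ?h w"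
      then have "[k + n * v = k + n * w] (mod e)" by (simp add: cong_def)
      then have "[n * v = n * w] (mod e)" by (simp add: cong_add_lcancel_nat)
      then have "[v = w] (mod e)"
        using ge(2) by (simp add: cong_mult_lcancel_nat coprime_commute)
      then show "v = w" using vw by (simp add: cong_def)
    qed
    have "?h ` {..<e} = {..<e}"
      using inj e0 by (intro endo_inj_surj) auto
    then have img: "\<And>u. u < e \<Longrightarrow> \<exists>v<e. u = ?h v"
      by (metis (no_types, lifting) image_iff lessThan_iff)
    have cm: "coprime (x mod e) e \<longleftrightarrow> coprime x e" for x
      using e0 by (simp add: coprime_mod_left_iff)
    show "bij_betw ?h {v. v < e \<and> coprime (k + n * v) e} {u. u < e \<and> coprime u e}"
      unfolding bij_betw_def
    proof
      show "inj_on ?h {v. v < e \<and> coprime (k + n * v) e}"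
        using inj by (rule inj_on_subset) auto
      show "?h ` {v. v < e \<and> coprime (k + n * v) e} = {u. u < e \<and> coprime u e}"
      proof (intro equalityI subsetI)
        fix u assume u: "u \<in> {u. u < e \<and> coprime u e}"
        then obtain v where v: "v < e" "u = ?h v"
          using img by blast
        then have "coprime (k + n * v) e"
          using u cm[of "k + n * v"] by simp
        then show "u \<in> ?h ` {v. v < e \<and> coprime (k + n * v) e}"
          using v by blast
      qed (use e0 cm in auto)
    qed
  qed
  also have "\<dots> = totient e" using e0 by (rule card_coprime_lessThan)
  finally show ?thesis by (simp add: m)
qed

section \<open>Roots of unity and generation by star transpositions\<close>

definition zeta :: "nat \<Rightarrow> complex" where
  "zeta r = cis (2 * pi / real r)"

lemma zeta_power: "zeta r ^ k = cis (2 * pi * real k / real r)"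
  by (simp add: zeta_def DeMoivre algebra_simps)

lemma zeta_nz [simp]: "zeta r \<noteq> 0"
  by (simp add: zeta_def)

lemma zeta_pow_eq_one_iff:
  assumes "r > 0" shows "zeta r ^ k = 1 \<longleftrightarrow> r dvd k"
proof -
  have one: "zeta r ^ r = 1"
    using assms by (simp add: zeta_power)
  have "zeta r ^ k = (zeta r ^ r) ^ (k div r) * zeta r ^ (k mod r)"
    by (metis mult_div_mod_eq power_add power_mult)
  then have k: "zeta r ^ k = zeta r ^ (k mod r)"
    using one by simp
  have inj: "inj_on (\<lambda>k. cis (2 * pi * real k / real r)) {..<r}"
    using bij_betw_roots_unity[OF assms] by (simp add: bij_betw_def)
  have "zeta r ^ (k mod r) = 1 \<longleftrightarrow> k mod r = 0"
    using inj_onD[OF inj, of "k mod r" 0] assms by (auto simp: zeta_power)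
  then show ?thesis
    using k by (simp add: dvd_eq_mod_eq_0)
qed

lemma root_unity_eq_zeta_pow:
  assumes "r > 0" "z ^ r = 1" obtains k where "k < r" "z = zeta r ^ k"
  using bij_betw_roots_unity[OF assms(1)] assms(2) unfolding bij_betw_def zeta_power
  by (metis (mono_tags, lifting) image_iff lessThan_iff mem_Collect_eq)

lemma pow_gcd_eq_one:
  fixes z :: "'a :: field"
  assumes "z ^ a = 1" "z ^ b = 1" shows "z ^ gcd a b = 1"
proof (cases "a = 0")
  case False
  obtain x y where "a * x = b * y + gcd a b"
    using bezout_nat[OF False] by blast
  then have "(z ^ a) ^ x = (z ^ b) ^ y * z ^ gcd a b"
    by (metis power_add power_mult)
  then show ?thesis using assms by simp
qed (use assms in simp)

lemma card_common_roots:
  assumes "a > 0"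
  shows "card {z :: complex. z ^ a = 1 \<and> z ^ b = 1} = gcd a b"
proof -
  have "{z :: complex. z ^ a = 1 \<and> z ^ b = 1} = {z. z ^ gcd a b = 1}"
  proof (intro equalityI subsetI CollectI conjI)
    fix z :: complex assume "z \<in> {z. z ^ gcd a b = 1}"
    then show "z ^ a = 1" "z ^ b = 1"
      by (metis (mono_tags) dvdE gcd_dvd1 gcd_dvd2 mem_Collect_eq power_mult power_one)+
  qed (use pow_gcd_eq_one in auto)
  then show ?thesis
    using assms card_roots_unity_eq[of "gcd a b"] by simp
qed

text \<open>The transpositions (0 j) generate, because (a b) = (0 a)(0 b)(0 a). Later arguments
  profit from having only n - 1 generators, any two of which share the point 0.\<close>

lemma permutes_star_induct:
  assumes "w permutes {..<n::nat}" "id \<in> E"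
    and comp: "\<And>u v. u \<in> E \<Longrightarrow> v \<in> E \<Longrightarrow> u \<circ> v \<in> E"
    and star: "\<And>j. 0 < j \<Longrightarrow> j < n \<Longrightarrow> transpose 0 j \<in> E"
  shows "w \<in> E"
proof -
  have tr: "transpose a b \<in> E" if "a < n" "b < n" for a b
  proof (cases "a = b \<or> a = 0 \<or> b = 0")
    case True
    then show ?thesis
      using that star assms(2) by (metis gr0I transpose_commute transpose_same)
  next
    case False
    have "transpose a b = transpose 0 a \<circ> (transpose 0 b \<circ> transpose 0 a)"
      using False by (auto simp: fun_eq_iff transpose_def)
    then show ?thesis using that False comp star by simp
  qed
  show ?thesis
    using assms(1) finite_lessThan
  proof (induction rule: permutes_induct)
    case id
    show ?case by fact
  next
    case (swap a b p)
    then show ?case by (intro comp tr) auto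
  qed
qed

section \<open>Injective endomorphisms of the symmetric group\<close>

lemma permutes_two_points:
  fixes a b i j :: nat
  assumes "a < n" "b < n" "i < n" "j < n" "a \<noteq> b" "i \<noteq> j"
  obtains u where "u permutes {..<n}" "u a = i" "u b = j"
proof
  let ?t = "transpose a i"
  have "?t b < n" using assms by (auto simp: transpose_def)
  then show "transpose (?t b) j \<circ> ?t permutes {..<n}"
    using assms by (intro permutes_compose permutes_swap_id) auto
  show "(transpose (?t b) j \<circ> ?t) a = i" "(transpose (?t b) j \<circ> ?t) b = j"
    using assms by (auto simp: transpose_def)
qed

lemma conj_transpose:
  assumes "u permutes S"
  shows "u \<circ> transpose a b \<circ> inv_into UNIV u = transpose (u a) (u b)"
proof
  fix x
  have "bij u" using assms by (rule permutes_bij)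
  then show "(u \<circ> transpose a b \<circ> inv_into UNIV u) x = transpose (u a) (u b) x"
    using permutes_inverses[OF assms] by (auto simp: transpose_def permutes_inv_eq[OF assms])
qed

text \<open>Equal or disjoint transpositions multiply to the identity or an involution, overlapping
  distinct ones to a 3-cycle. The case split lists the possible overlaps.\<close>

lemma transpose_prod_order:
  fixes a b c d :: 'a
  defines "q \<equiv> transpose a b \<circ> transpose c d"
  shows "q \<circ> q = id \<or> q \<circ> q \<circ> q = id"
proof -
  consider "a = b" | "c = d" | "a \<noteq> b" "c \<noteq> d" "{a, b} \<inter> {c, d} = {}"
    | "a \<noteq> b" "c \<noteq> d" "a = c" | "a \<noteq> b" "c \<noteq> d" "a = d"
    | "a \<noteq> b" "c \<noteq> d" "b = c" | "a \<noteq> b" "c \<noteq> d" "b = d"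
    by auto
  then show ?thesis
    unfolding q_def
    by cases (auto simp: fun_eq_iff transpose_def)
qed

lemma transpose_disjoint_commute:
  assumes "{a, b} \<inter> {c, d} = {}"
  shows "transpose a b \<circ> transpose c d = transpose c d \<circ> transpose a b"
  using assms by (auto simp: fun_eq_iff transpose_def)

lemma transpose_doubleton_cong: "{a, b} = {c, d} \<Longrightarrow> transpose a b = transpose c d"
  by (auto simp: doubleton_eq_iff transpose_commute)

text \<open>The situation on bare permutations: the self-map of S_n induced by an automorphism that
  stabilises the diagonal subgroup. It is shared by the general case and by G(1,1,6).\<close>

locale sym_endo =
  fixes n :: nat and h :: "(nat \<Rightarrow> nat) \<Rightarrow> (nat \<Rightarrow> nat)"
  assumes n_ge: "n \<ge> 3"
    and perm: "w permutes {..<n} \<Longrightarrow> h w permutes {..<n}"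
    and comp: "v permutes {..<n} \<Longrightarrow> w permutes {..<n} \<Longrightarrow> h (v \<circ> w) = h v \<circ> h w"
    and inj: "inj_on h {w. w permutes {..<n}}"
begin

lemma surj:
  assumes "v permutes {..<n}"
  obtains w where "w permutes {..<n}" "h w = v"
proof -
  have "h ` {w. w permutes {..<n}} = {w. w permutes {..<n}}"
    using inj perm by (intro endo_inj_surj) (auto simp: finite_permutations)
  with assms have "v \<in> h ` {w. w permutes {..<n}}" by simp
  with that show thesis by blast
qed

lemma h_id: "h id = id"
proof -
  have "h id \<circ> h id = h id \<circ> id"
    using comp[of id id] permutes_id by simp
  then show ?thesis
    by (metis fun.map_comp inv_o_cancel perm permutes_id permutes_inj comp_id id_comp o_assoc)
qed

lemma h_inv:
  assumes "w permutes {..<n}" shows "h (inv_into UNIV w) = inv_into UNIV (h w)"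
proof -
  have "h w \<circ> h (inv_into UNIV w) = id"
    using comp[OF assms permutes_inv[OF assms]] h_id permutes_inv_o(1)[OF assms] by simp
  then show ?thesis
    using perm[OF assms] by (metis comp_assoc id_comp comp_id permutes_inv_o(2))
qed

text \<open>By surjectivity every \<open>u\<close> has the form \<open>h v\<close>, so each
  conjugate of the image of (a b) is again the image of a transposition. The order bound thus holds
  against all conjugates in S_n, which leaves \<open>u\<close> free to be chosen
  adversarially.\<close>

lemma prod_conj_order:
  assumes "a < n" "b < n" "u permutes {..<n}"
  defines "q \<equiv> h (transpose a b) \<circ> (u \<circ> h (transpose a b) \<circ> inv_into UNIV u)"
  shows "q \<circ> q = id \<or> q \<circ> q \<circ> q = id"
proof -
  obtain v where v: "v permutes {..<n}" "h v = u"
    using surj[OF assms(3)] .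
  have vn: "v a < n" "v b < n"
    using permutes_in_image[OF v(1)] assms(1,2) by auto
  have tr: "transpose a b permutes {..<n}" "transpose (v a) (v b) permutes {..<n}"
    using vn assms(1,2) by (auto intro: permutes_swap_id)
  have "u \<circ> h (transpose a b) \<circ> inv_into UNIV u = h (v \<circ> transpose a b \<circ> inv_into UNIV v)"
    using v tr h_inv[OF v(1)] by (simp add: comp permutes_inv permutes_compose)
  also have "\<dots> = h (transpose (v a) (v b))"
    by (simp add: conj_transpose[OF v(1)])
  finally have q: "q = h (transpose a b \<circ> transpose (v a) (v b))"
    unfolding q_def using tr by (simp add: comp)
  let ?q = "transpose a b \<circ> transpose (v a) (v b)"
  have P: "?q permutes {..<n}" using tr by (intro permutes_compose)
  have q2: "q \<circ> q = h (?q \<circ> ?q)" and q3: "q \<circ> q \<circ> q = h (?q \<circ> ?q \<circ> ?q)"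
    unfolding q using P by (simp_all add: comp permutes_compose)
  from transpose_prod_order[of a b "v a" "v b"] show ?thesis
  proof
    assume "?q \<circ> ?q = id"
    then show ?thesis using q2 h_id by simp
  next
    assume "?q \<circ> ?q \<circ> ?q = id"
    then have "q \<circ> q \<circ> q = id" using q3 h_id by simp
    then show ?thesis ..
  qed
qed

lemma conj_apply:
  assumes "u permutes {..<n}" shows "(u \<circ> t \<circ> inv_into UNIV u) (u x) = u (t x)"
  using permutes_inverses(2)[OF assms] by simp

text \<open>The image \<open>t\<close> is a nontrivial involution. If it is not a transposition, it
  has two 2-cycles (p q) and (c d). With a further fixed point, or with three 2-cycles and a seventh
  point, some conjugate of \<open>t\<close> has a product with \<open>t\<close> whose square and
  cube are both nontrivial. Only the fixed-point-free involutions of S_4 and S_6 have too few points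
  for this.\<close>

lemma image_transpose:
  assumes ab: "a < n" "b < n" "a \<noteq> b"
  shows "(\<exists>c d. c < n \<and> d < n \<and> c \<noteq> d \<and> h (transpose a b) = transpose c d) \<or>
    (n \<in> {4, 6} \<and> (\<forall>i<n. h (transpose a b) i \<noteq> i))"
proof (rule ccontr)
  assume neg: "\<not> ?thesis"
  define t where "t = h (transpose a b)"
  have trP: "transpose a b permutes {..<n}"
    using ab by (intro permutes_swap_id) auto
  have tP: "t permutes {..<n}"
    unfolding t_def using trP by (rule perm)
  have "t \<circ> t = id"
    unfolding t_def using comp[OF trP trP] h_id by simp
  then have tt: "t (t x) = x" for x
    by (metis comp_apply id_apply)
  have tn: "t x < n" if "x < n" for x
    using permutes_in_image[OF tP, of x] that by simp
  have teq: "x = y" if "t x = t y" for x y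
    using that tt by metis
  have "t \<noteq> id"
  proof
    assume "t = id"
    then have "transpose a b = id"
      unfolding t_def using inj_onD[OF inj, of "transpose a b" id] trP h_id by simp
    then show False using ab(3) by (metis id_apply transpose_apply_first)
  qed
  then obtain p where p: "t p \<noteq> p" by (metis eq_id_iff)
  have pn: "p < n"
    using p permutes_not_in[OF tP, of p] by auto
  define q where "q = t p"
  have tp: "t p = q" "t q = p" and pq: "p \<noteq> q" and qn: "q < n"
    using p tt tn[OF pn] by (auto simp: q_def)
  have "t \<noteq> transpose p q"
    using neg pn qn pq unfolding t_def by blast
  then obtain c where c: "t c \<noteq> transpose p q c" by blast
  then have cpq: "c \<noteq> p" "c \<noteq> q" and "t c \<noteq> c"
    using tp by (auto simp: transpose_def split: if_splits)
  define d where "d = t c"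
  have tc: "t c = d" "t d = c" and cd: "c \<noteq> d" and dpq: "d \<noteq> p" "d \<noteq> q"
    using \<open>t c \<noteq> c\<close> tt cpq tp by (auto simp: d_def) (metis tt)+
  have cn: "c < n"
    using \<open>t c \<noteq> c\<close> permutes_not_in[OF tP, of c] by auto
  have dn: "d < n" using tn[OF cn] by (simp add: d_def)
  have key: "(\<forall>x. (t \<circ> (u \<circ> t \<circ> inv_into UNIV u)) ((t \<circ> (u \<circ> t \<circ> inv_into UNIV u)) x) = x) \<or>
     (\<forall>x. (t \<circ> (u \<circ> t \<circ> inv_into UNIV u)) ((t \<circ> (u \<circ> t \<circ> inv_into UNIV u)) ((t \<circ> (u \<circ> t \<circ> inv_into UNIV u)) x)) = x)"
    if "u permutes {..<n}" for u
    using prod_conj_order[OF ab(1,2) that] unfolding t_def[symmetric] fun_eq_iff comp_apply id_apply .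
  show False
  proof (cases "\<exists>f<n. t f = f")
    case True
    then obtain f where f: "f < n" "t f = f" by blast
    have fne: "f \<noteq> p" "f \<noteq> q" "f \<noteq> c" "f \<noteq> d"
      using f tp tc pq cd by auto
    \<comment> \<open>The conjugate of \<open>t\<close> by \<open>u\<close> swaps p with c and q
      with f and fixes d. So \<open>?s\<close> runs p -> d -> c -> q, and neither its square nor its
      cube fixes p.\<close>
    define u where "u = transpose q c \<circ> transpose d f"
    have uP: "u permutes {..<n}"
      unfolding u_def using qn cn dn f by (intro permutes_compose permutes_swap_id) auto
    have u: "u p = p" "u q = c" "u c = q" "u d = f" "u f = d"
      using fne pq cd cpq dpq unfolding u_def by (auto simp: transpose_def)
    let ?s = "t \<circ> (u \<circ> t \<circ> inv_into UNIV u)"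
    have "?s p = d" "?s d = c" "?s c = q"
      using conj_apply[OF uP, of t p] conj_apply[OF uP, of t f] conj_apply[OF uP, of t q] u tp tc f
      by simp_all
    then show False
      using key[OF uP] cpq pq by metis
  next
    case False
    then have ff: "t x \<noteq> x" if "x < n" for x using that by blast
    have n46: "n \<noteq> 4" "n \<noteq> 6"
      using neg ff unfolding t_def by auto
    have "{p, q, c, d} \<subseteq> {..<n}" using pn qn cn dn by auto
    then have "4 \<le> n"
      using card_mono[of "{..<n}" "{p, q, c, d}"] pq cpq dpq cd by simp
    then have "\<not> {..<n} \<subseteq> {p, q, c, d}"
      using card_mono[of "{p, q, c, d}" "{..<n}"] n46 pq cpq dpq cd by auto
    then obtain e where e: "e < n" "e \<notin> {p, q, c, d}" by auto
    define f where "f = t e"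
    have te: "t e = f" "t f = e" and fn: "f < n" using tt tn e by (auto simp: f_def)
    have fne: "f \<notin> {p, q, c, d, e}"
      using e te tp tc ff[OF e(1)] by auto
    have "{p, q, c, d, e, f} \<subseteq> {..<n}" using pn qn cn dn e fn by auto
    moreover have c6: "card {p, q, c, d, e, f} = 6"
      using pq cpq dpq cd e fne by (auto simp: card_insert_if)
    ultimately have "6 \<le> n"
      using card_mono[of "{..<n}" "{p, q, c, d, e, f}"] by simp
    then have "\<not> {..<n} \<subseteq> {p, q, c, d, e, f}"
      using card_mono[of "{p, q, c, d, e, f}" "{..<n}"] n46 c6 by auto
    then obtain g where g: "g < n" "g \<notin> {p, q, c, d, e, f}" by auto
    have tg: "t g \<noteq> q" using g tp teq[of g p] by auto
    \<comment> \<open>Shifting along the seven points makes the conjugate of \<open>t\<close> swap q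
      with c, d with e, and f with g. So \<open>?s\<close> runs q -> d -> f -> t g, where t g
      differs from q because g differs from p.\<close>
    define u where "u = transpose p q \<circ> transpose q c \<circ> transpose c d \<circ> transpose d e \<circ>
      transpose e f \<circ> transpose f g"
    have uP: "u permutes {..<n}"
      unfolding u_def using pn qn cn dn e fn g by (intro permutes_compose permutes_swap_id) auto
    have u: "u p = q" "u q = c" "u c = d" "u d = e" "u e = f" "u f = g"
      using pq cpq dpq cd e fne g unfolding u_def by (auto simp: transpose_def)
    let ?s = "t \<circ> (u \<circ> t \<circ> inv_into UNIV u)"
    have "?s q = d" "?s d = f" "?s f = t g"
      using conj_apply[OF uP, of t p] conj_apply[OF uP, of t c] conj_apply[OF uP, of t e] u tp tc te
      by simp_all
    then show False
      using key[OF uP] fne tg by (metis insertCI)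
  qed
qed

text \<open>Fixed-point-free involutions of four points commute, as they lie in the Klein
  four-group, whereas (a b) and (b c) do not commute; injectivity of \<open>h\<close>
  decides.\<close>

lemma not_ffree_four:
  assumes "n = 4" "a < n" "b < n" "a \<noteq> b"
  shows "\<exists>i<n. h (transpose a b) i = i"
proof (rule ccontr)
  assume "\<not> ?thesis"
  then have ff: "h (transpose a b) i \<noteq> i" if "i < n" for i using that by blast
  have "\<not> {..<n} \<subseteq> {a, b}" using card_mono[of "{a, b}" "{..<n}"] assms by auto
  then obtain c where c: "c < n" "c \<noteq> a" "c \<noteq> b" by auto
  define t s where "t = h (transpose a b)" and "s = h (transpose b c)"
  have P1: "transpose a b permutes {..<n}" and P2: "transpose b c permutes {..<n}"
    and P3: "transpose a c permutes {..<n}"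
    using assms c by (auto intro: permutes_swap_id)
  have tP: "t permutes {..<n}" and sP: "s permutes {..<n}"
    unfolding t_def s_def using P1 P2 perm by auto
  \<comment> \<open>Being conjugate to (a b), the transposition (b c) also has a fixed-point-free
    image.\<close>
  have "transpose b c = transpose a c \<circ> transpose a b \<circ> transpose a c"
    using c assms by (auto simp: fun_eq_iff transpose_def)
  then have s: "s = h (transpose a c) \<circ> t \<circ> h (transpose a c)"
    unfolding s_def t_def by (simp only: comp P1 P3 permutes_compose)
  have "h (transpose a c) \<circ> h (transpose a c) = id"
    using comp[OF P3 P3] h_id by simp
  then have inv: "h (transpose a c) (h (transpose a c) x) = x" for x
    by (metis comp_apply id_apply)
  have ffs: "s i \<noteq> i" if "i < n" for i
  proof
    assume "s i = i"
    then have "t (h (transpose a c) i) = h (transpose a c) i"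
      unfolding s by simp (metis inv)
    moreover have "h (transpose a c) i < n"
      using permutes_in_image[OF perm[OF P3], of i] that by simp
    ultimately show False using ff unfolding t_def by blast
  qed
  have "t \<circ> t = id" "s \<circ> s = id"
    unfolding t_def s_def using comp[OF P1 P1] comp[OF P2 P2] h_id by simp_all
  then have tt: "t (t x) = x" and ss: "s (s x) = x" for x
    by (metis comp_apply id_apply)+
  have tn: "t x < n" "s x < n" if "x < n" for x
    using permutes_in_image[OF tP, of x] permutes_in_image[OF sP, of x] that by simp_all
  have comm: "t (s x) = s (t x)" if "x < n" for x
  proof (cases "t x = s x")
    case True
    then show ?thesis using tt ss by metis
  next
    case False
    define y z where "y = t x" and "z = s x"
    have ne: "y \<noteq> x" "z \<noteq> x" "y \<noteq> z" and yz: "y < n" "z < n"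
      using False ff ffs tn that unfolding y_def z_def t_def by auto
    \<comment> \<open>With four points in all, \<open>t z\<close> and \<open>s y\<close> are both
      forced to be the single point outside {x, y, z}.\<close>
    have "t z \<notin> {x, y, z}"
      using ne ff[OF yz(2)] tt y_def unfolding t_def[symmetric] by (auto, metis)
    moreover have "s y \<notin> {x, y, z}"
      using ne ffs[OF yz(1)] ss z_def by (auto, metis)
    moreover have "card ({..<n} - {x, y, z}) = 1"
      using assms(1) that yz ne by (subst card_Diff_subset) auto
    then obtain r where "{..<n} - {x, y, z} = {r}"
      by (rule card_1_singletonE)
    moreover have "t z < n" "s y < n" using tn yz by auto
    ultimately have "t z = r" "s y = r" by blast+
    then show ?thesis by (simp add: y_def z_def)
  qed
  have "t \<circ> s = s \<circ> t"
  proof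
    fix x show "(t \<circ> s) x = (s \<circ> t) x"
      using comm[of x] permutes_not_in[OF tP, of x] permutes_not_in[OF sP, of x]
      by (cases "x < n") auto
  qed
  then have "h (transpose a b \<circ> transpose b c) = h (transpose b c \<circ> transpose a b)"
    using comp P1 P2 unfolding t_def s_def by simp
  then have "transpose a b \<circ> transpose b c = transpose b c \<circ> transpose a b"
    using inj_onD[OF inj] P1 P2 permutes_compose by blast
  then have "(transpose a b \<circ> transpose b c) a = (transpose b c \<circ> transpose a b) a" by simp
  then show False using c assms by (auto simp: transpose_def split: if_splits)
qed

lemma noncommuting_stars:
  assumes "0 < i" "i < n" "0 < j" "j < n" "i \<noteq> j"
  shows "h (transpose 0 i) \<circ> h (transpose 0 j) \<noteq> h (transpose 0 j) \<circ> h (transpose 0 i)"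
proof
  have P: "transpose 0 i permutes {..<n}" "transpose 0 j permutes {..<n}"
    using assms by (auto intro: permutes_swap_id)
  assume "h (transpose 0 i) \<circ> h (transpose 0 j) = h (transpose 0 j) \<circ> h (transpose 0 i)"
  then have "h (transpose 0 i \<circ> transpose 0 j) = h (transpose 0 j \<circ> transpose 0 i)"
    using P by (simp add: comp)
  then have "transpose 0 i \<circ> transpose 0 j = transpose 0 j \<circ> transpose 0 i"
    using inj_onD[OF inj] P permutes_compose by blast
  then have "(transpose 0 i \<circ> transpose 0 j) i = (transpose 0 j \<circ> transpose 0 i) i"
    by (rule fun_cong)
  then show False using assms by (auto simp: transpose_def split: if_splits)
qed

text \<open>The images of (0 1) and (0 2) are transpositions (a b) and (a c) sharing exactly one
  point. The image of any other (0 j) meets both supports without being (b c), so it contains a. The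
  other points of these images define the conjugating \<open>u\<close>.\<close>

lemma inner:
  assumes tr: "\<And>a b. a < n \<Longrightarrow> b < n \<Longrightarrow> a \<noteq> b \<Longrightarrow>
    \<exists>c d. c < n \<and> d < n \<and> c \<noteq> d \<and> h (transpose a b) = transpose c d"
  obtains u where "u permutes {..<n}"
    "\<And>w. w permutes {..<n} \<Longrightarrow> h w = u \<circ> w \<circ> inv_into UNIV u"
proof -
  let ?s = "\<lambda>j. h (transpose 0 j)"
  have sP: "transpose 0 j permutes {..<n}" if "j < n" for j
    using that by (intro permutes_swap_id) auto
  obtain p q where pq: "p < n" "q < n" "p \<noteq> q" "?s 1 = transpose p q"
    using tr[of 0 1] n_ge by auto
  obtain p' q' where pq': "p' < n" "q' < n" "p' \<noteq> q'" "?s 2 = transpose p' q'"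
    using tr[of 0 2] n_ge by auto
  have "\<exists>a b c. a < n \<and> b < n \<and> c < n \<and> a \<noteq> b \<and> a \<noteq> c \<and> b \<noteq> c \<and>
     ?s 1 = transpose a b \<and> ?s 2 = transpose a c"
  proof -
    \<comment> \<open>Equal or disjoint supports would make the two images commute.\<close>
    have "{p, q} \<noteq> {p', q'} \<and> {p, q} \<inter> {p', q'} \<noteq> {}"
      using noncommuting_stars[of 1 2] n_ge pq(4) pq'(4)
        transpose_disjoint_commute[of p q p' q'] transpose_doubleton_cong[of p q p' q'] by auto
    then consider "p = p'" "q \<noteq> q'" | "p = q'" "q \<noteq> p'" | "q = p'" "p \<noteq> q'" | "q = q'" "p \<noteq> p'"
      by auto
    then show ?thesis
      using pq pq' by cases (metis transpose_commute)+
  qed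
  then obtain a b c where abc: "a < n" "b < n" "c < n" "a \<noteq> b" "a \<noteq> c" "b \<noteq> c"
    and s1: "?s 1 = transpose a b" and s2: "?s 2 = transpose a c" by blast
  have "\<exists>z. z < n \<and> z \<noteq> a \<and> ?s j = transpose a z" if j: "0 < j" "j < n" for j
  proof -
    consider "j = 1" | "j = 2" | "3 \<le> j" using j by linarith
    then show ?thesis
    proof cases
      case 3
      obtain x y where xy: "x < n" "y < n" "x \<noteq> y" "?s j = transpose x y"
        using tr[of 0 j] n_ge j by auto
      have 1: "{x, y} \<inter> {a, b} \<noteq> {}"
        using noncommuting_stars[of 1 j] n_ge 3 j xy(4) s1
          transpose_disjoint_commute[of x y a b] by auto
      have 2: "{x, y} \<inter> {a, c} \<noteq> {}"
        using noncommuting_stars[of 2 j] n_ge 3 j xy(4) s2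
          transpose_disjoint_commute[of x y a c] by auto
      \<comment> \<open>The transposition (b c) is (a b)(a c)(a b), hence already the image of (1
        2).\<close>
      have 4: "{x, y} \<noteq> {b, c}"
      proof
        assume "{x, y} = {b, c}"
        then have "?s j = transpose b c"
          using xy by (auto simp: doubleton_eq_iff transpose_commute)
        also have "\<dots> = transpose a b \<circ> transpose a c \<circ> transpose a b"
          using abc by (auto simp: fun_eq_iff transpose_def)
        also have "\<dots> = h (transpose 0 1 \<circ> transpose 0 2 \<circ> transpose 0 1)"
          using sP[of 1] sP[of 2] n_ge s1 s2 by (simp add: comp permutes_compose)
        finally have "transpose 0 j = transpose 0 1 \<circ> transpose 0 2 \<circ> transpose 0 (1::nat)"
          using inj_onD[OF inj, of "transpose 0 j" "transpose 0 1 \<circ> transpose 0 2 \<circ> transpose 0 1"]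
            sP[of 1] sP[of 2] sP[of j] n_ge j by (simp add: permutes_compose)
        then have "transpose 0 j j = (transpose 0 1 \<circ> transpose 0 2 \<circ> transpose 0 (1::nat)) j"
          by simp
        then show False using 3 by (simp add: transpose_def)
      qed
      have "x = a \<or> y = a"
        using 1 2 4 abc xy(3) by auto
      then show ?thesis
        using xy by (metis transpose_commute)
    qed (use abc s1 s2 in auto)
  qed
  then obtain f where f: "\<And>j. 0 < j \<Longrightarrow> j < n \<Longrightarrow> f j < n \<and> f j \<noteq> a \<and> ?s j = transpose a (f j)"
    by metis
  define u where "u = (\<lambda>j. if j = 0 then a else if j < n then f j else j)"
  have "inj_on u {..<n}"
  proof (rule inj_onI)
    fix i j assume ij: "i \<in> {..<n}" "j \<in> {..<n}" "u i = u j"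
    show "i = j"
    proof (cases "i = 0 \<or> j = 0")
      case True
      then show ?thesis using ij f by (auto simp: u_def split: if_splits)
    next
      case False
      then have "?s i = ?s j"
        using ij f[of i] f[of j] by (simp add: u_def)
      then have "transpose 0 i = transpose 0 j"
        using inj_onD[OF inj] sP ij by blast
      then show ?thesis by (metis transpose_apply_first)
    qed
  qed
  moreover have "u ` {..<n} \<subseteq> {..<n}"
    using f abc by (auto simp: u_def)
  ultimately have "bij_betw u {..<n} {..<n}"
    by (simp add: bij_betw_def endo_inj_surj)
  then have uP: "u permutes {..<n}"
    by (rule bij_imp_permutes) (use n_ge in \<open>auto simp: u_def\<close>)
  have star: "?s j = u \<circ> transpose 0 j \<circ> inv_into UNIV u" if "0 < j" "j < n" for j
    unfolding conj_transpose[OF uP] using f[OF that] that by (simp add: u_def)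
  have "h w = u \<circ> w \<circ> inv_into UNIV u" if "w permutes {..<n}" for w
  proof -
    have "w \<in> {w. w permutes {..<n} \<and> h w = u \<circ> w \<circ> inv_into UNIV u}"
      using that
    proof (rule permutes_star_induct)
      show "id \<in> {w. w permutes {..<n} \<and> h w = u \<circ> w \<circ> inv_into UNIV u}"
        using h_id permutes_inv_o(1)[OF uP] permutes_id by simp
      fix v w assume "v \<in> {w. w permutes {..<n} \<and> h w = u \<circ> w \<circ> inv_into UNIV u}"
        "w \<in> {w. w permutes {..<n} \<and> h w = u \<circ> w \<circ> inv_into UNIV u}"
      then show "v \<circ> w \<in> {w. w permutes {..<n} \<and> h w = u \<circ> w \<circ> inv_into UNIV u}"
        using permutes_inverses(2)[OF uP]
        by (auto simp: comp permutes_compose fun_eq_iff)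
    qed (use star sP in auto)
    then show ?thesis by simp
  qed
  with uP that show thesis by blast
qed

end

section \<open>A coordinate model of \<open>G(r,p,n)\<close>\<close>

text \<open>The value 1 beyond \<open>n\<close> makes a tuple determined by its first
  \<open>n\<close> entries. With \<open>p = 1\<close> the product condition follows from the others,
  so \<open>torus r (Suc 0) n\<close> is the full diagonal group of G(r,1,n).\<close>

definition torus :: "nat \<Rightarrow> nat \<Rightarrow> nat \<Rightarrow> (nat \<Rightarrow> complex) set" where
  "torus r p n = {x. (\<forall>i<n. x i ^ r = 1) \<and> (\<forall>i\<ge>n. x i = 1) \<and> (\<Prod>i<n. x i) ^ (r div p) = 1}"

text \<open>The pair \<open>(x, w)\<close> stands for the monomial matrix with entry \<open>x i\<close> in position \<open>(i, w i)\<close>;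
  with this convention the permutations compose in reverse order and no inverses occur.\<close>

definition wreath :: "nat \<Rightarrow> nat \<Rightarrow> nat \<Rightarrow> ((nat \<Rightarrow> complex) \<times> (nat \<Rightarrow> nat)) monoid" where
  "wreath r p n =
     \<lparr>carrier = torus r p n \<times> {w. w permutes {..<n}},
      monoid.mult = (\<lambda>(x, w) (y, v). (\<lambda>i. x i * y (w i), v \<circ> w)),
      one = (\<lambda>_. 1, id)\<rparr>"

definition const_tuple :: "nat \<Rightarrow> complex \<Rightarrow> nat \<Rightarrow> complex" where
  "const_tuple n c = (\<lambda>i. if i < n then c else 1)"

text \<open>For distinct positions the product is 1, so these tuples lie in G(r,p,n) for every
  \<open>p\<close>.\<close>

definition root_tuple :: "nat \<Rightarrow> nat \<Rightarrow> nat \<Rightarrow> nat \<Rightarrow> complex" where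
  "root_tuple r a b = (\<lambda>i. if i = a then zeta r else if i = b then inverse (zeta r) else 1)"

lemma wreath_mult: "(x, w) \<otimes>\<^bsub>wreath r p n\<^esub> (y, v) = (\<lambda>i. x i * y (w i), v \<circ> w)"
  by (simp add: wreath_def)

lemma wreath_one: "\<one>\<^bsub>wreath r p n\<^esub> = (\<lambda>_. 1, id)"
  by (simp add: wreath_def)

lemma wreath_carrier: "(x, w) \<in> carrier (wreath r p n) \<longleftrightarrow> x \<in> torus r p n \<and> w permutes {..<n}"
  by (simp add: wreath_def)

lemma snd_wreath_mult: "snd (g \<otimes>\<^bsub>wreath r p n\<^esub> h) = snd h \<circ> snd g"
  by (cases g; cases h) (simp add: wreath_mult)

lemma permutes_two_cases: "w permutes {..<2::nat} \<longleftrightarrow> w = id \<or> w = transpose 0 1"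
proof -
  have "{..<2::nat} = {0, 1}" by auto
  then show ?thesis using permutes_doubleton_iff[of w 0 1] by simp
qed

locale rpn =
  fixes r p n :: nat
  assumes r_pos: "r > 0" and p_pos: "p > 0" and p_dvd: "p dvd r" and n_gt: "n > 1"
begin

abbreviation "m \<equiv> r div p"
abbreviation "WG \<equiv> wreath r p n"
abbreviation "N \<equiv> torus r p n"

lemma r_eq: "r = p * m"
  using p_dvd by simp

lemma m_pos: "m > 0"
  using r_eq r_pos by (metis gr0I mult_0_right)

lemma torus_pow: "x \<in> N \<Longrightarrow> x i ^ r = 1"
  by (cases "i < n") (auto simp: torus_def)

lemma torus_nz: "x \<in> N \<Longrightarrow> x i \<noteq> 0"
  using torus_pow[of x i] r_pos by (auto simp: power_0_left)

lemma torus_out: "x \<in> N \<Longrightarrow> n \<le> i \<Longrightarrow> x i = 1"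
  by (auto simp: torus_def)

lemma torus_prod: "x \<in> N \<Longrightarrow> (\<Prod>i<n. x i) ^ m = 1"
  by (auto simp: torus_def)

lemma torusI:
  "(\<And>i. i < n \<Longrightarrow> x i ^ r = 1) \<Longrightarrow> (\<And>i. n \<le> i \<Longrightarrow> x i = 1) \<Longrightarrow> (\<Prod>i<n. x i) ^ m = 1 \<Longrightarrow> x \<in> N"
  by (auto simp: torus_def)

lemma torus_one: "(\<lambda>_. 1) \<in> N"
  by (auto simp: torus_def)

lemma torus_mult: "x \<in> N \<Longrightarrow> y \<in> N \<Longrightarrow> (\<lambda>i. x i * y i) \<in> N"
  by (auto simp: torus_def power_mult_distrib prod.distrib)

lemma torus_inverse: "x \<in> N \<Longrightarrow> (\<lambda>i. inverse (x i)) \<in> N"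
  using prod_inversef[of x "{..<n}"] by (auto simp: torus_def power_inverse comp_def)

lemma prod_permute:
  assumes "w permutes {..<n}" shows "(\<Prod>i<n. x (w i)) = (\<Prod>i<n. x i :: complex)"
  using prod.permute[OF assms, of x] by (simp add: comp_def)

lemma torus_permute: "x \<in> N \<Longrightarrow> w permutes {..<n} \<Longrightarrow> (\<lambda>i. x (w i)) \<in> N"
  using permutes_in_image[of w "{..<n}"] permutes_not_in[of w "{..<n}"]
  by (auto simp: torus_def prod_permute)

lemma inv_perm: "w permutes {..<n} \<Longrightarrow> inv_into UNIV w permutes {..<n}"
  by (rule permutes_inv)

lemma group_wreath: "group WG"
proof (rule groupI)
  fix g h assume "g \<in> carrier WG" "h \<in> carrier WG"
  then show "g \<otimes>\<^bsub>WG\<^esub> h \<in> carrier WG"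
    by (cases g; cases h) (simp add: wreath_carrier wreath_mult torus_mult torus_permute permutes_compose)
next
  show "\<one>\<^bsub>WG\<^esub> \<in> carrier WG"
    using torus_one permutes_id by (simp add: wreath_carrier wreath_one)
next
  fix g h k assume "g \<in> carrier WG" "h \<in> carrier WG" "k \<in> carrier WG"
  show "g \<otimes>\<^bsub>WG\<^esub> h \<otimes>\<^bsub>WG\<^esub> k = g \<otimes>\<^bsub>WG\<^esub> (h \<otimes>\<^bsub>WG\<^esub> k)"
    by (cases g; cases h; cases k) (simp add: wreath_mult fun_eq_iff mult.assoc)
next
  fix g assume "g \<in> carrier WG"
  then show "\<one>\<^bsub>WG\<^esub> \<otimes>\<^bsub>WG\<^esub> g = g"
    by (cases g) (simp add: wreath_mult wreath_one)
next
  fix g assume g: "g \<in> carrier WG"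
  obtain x w where xw: "g = (x, w)" by (cases g)
  with g have x: "x \<in> N" and w: "w permutes {..<n}" by (auto simp: wreath_carrier)
  let ?h = "(\<lambda>i. inverse (x (inv_into UNIV w i)), inv_into UNIV w)"
  have "?h \<in> carrier WG"
    using torus_permute[OF torus_inverse[OF x] inv_perm[OF w]] inv_perm[OF w]
    by (simp add: wreath_carrier)
  moreover have "?h \<otimes>\<^bsub>WG\<^esub> g = \<one>\<^bsub>WG\<^esub>"
    using torus_nz[OF x] permutes_inv_o(1)[OF w] by (simp add: xw wreath_mult wreath_one)
  ultimately show "\<exists>h\<in>carrier WG. h \<otimes>\<^bsub>WG\<^esub> g = \<one>\<^bsub>WG\<^esub>" ..
qed

sublocale W: group WG
  by (rule group_wreath)

lemma wreath_inv:
  assumes "x \<in> N" "w permutes {..<n}"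
  shows "inv\<^bsub>WG\<^esub> (x, w) = (\<lambda>i. inverse (x (inv_into UNIV w i)), inv_into UNIV w)"
proof (rule W.inv_equality)
  show "(\<lambda>i. inverse (x (inv_into UNIV w i)), inv_into UNIV w) \<otimes>\<^bsub>WG\<^esub> (x, w) = \<one>\<^bsub>WG\<^esub>"
    using torus_nz[OF assms(1)] permutes_inv_o(1)[OF assms(2)] by (simp add: wreath_mult wreath_one)
qed (use assms torus_permute[OF torus_inverse[OF assms(1)] inv_perm[OF assms(2)]] inv_perm
      in \<open>auto simp: wreath_carrier\<close>)

text \<open>A tuple corresponds to its entries at 1, ..., n-1, arbitrary r-th roots of unity,
  together with its product, an arbitrary m-th root of unity; the entry at 0 is recovered by
  division.\<close>

lemma card_torus: "card N = r ^ (n - 1) * m"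
proof -
  let ?A = "({1..<n} \<rightarrow>\<^sub>E {z::complex. z ^ r = 1}) \<times> {z::complex. z ^ m = 1}"
  let ?f = "\<lambda>(y, c) i. if i = 0 then c / (\<Prod>j\<in>{1..<n}. y j) else if i < n then y i else (1::complex)"
  have ins: "{..<n} = insert 0 {1..<n}" using n_gt by auto
  have nz: "(\<Prod>j\<in>{1..<n}. y j) \<noteq> 0" "(\<Prod>j\<in>{1..<n}. y j) ^ r = 1"
    if "\<And>j. j \<in> {1..<n} \<Longrightarrow> y j ^ r = 1" for y :: "nat \<Rightarrow> complex"
  proof -
    show "(\<Prod>j\<in>{1..<n}. y j) ^ r = 1"
      unfolding prod_power_distrib using that by (intro prod.neutral) auto
    then show "(\<Prod>j\<in>{1..<n}. y j) \<noteq> 0"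
      using r_pos by (metis power_eq_0_iff zero_neq_one)
  qed
  have prod: "(\<Prod>i<n. ?f (y, c) i) = c / (\<Prod>j\<in>{1..<n}. y j) * (\<Prod>j\<in>{1..<n}. y j)" for y c
    unfolding ins by (subst prod.insert) (auto intro!: prod.cong)
  have mr: "c ^ r = 1" if "c ^ m = 1" for c :: complex
    using that r_eq by (metis mult.commute power_mult power_one)
  have "bij_betw ?f ?A N"
  proof (rule bij_betw_byWitness[where f' = "\<lambda>x. (restrict x {1..<n}, \<Prod>i<n. x i)"])
    show "\<forall>a\<in>?A. (restrict (?f a) {1..<n}, \<Prod>i<n. ?f a i) = a"
    proof
      fix a assume a: "a \<in> ?A"
      obtain y c where yc: "a = (y, c)" by (cases a)
      have "restrict (?f a) {1..<n} = y"
        using a yc by (auto simp: PiE_iff extensional_def fun_eq_iff restrict_def)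
      moreover have "(\<Prod>i<n. ?f a i) = c"
        using prod[of y c] nz(1)[of y] a yc by (auto simp: PiE_iff)
      ultimately show "(restrict (?f a) {1..<n}, \<Prod>i<n. ?f a i) = a"
        by (simp add: yc)
    qed
    show "\<forall>x\<in>N. ?f (restrict x {1..<n}, \<Prod>i<n. x i) = x"
    proof
      fix x assume x: "x \<in> N"
      have "(\<Prod>i<n. x i) = x 0 * (\<Prod>j\<in>{1..<n}. x j)"
        unfolding ins by (subst prod.insert) auto
      moreover have "(\<Prod>j\<in>{1..<n}. x j) \<noteq> 0"
        using nz(1)[of x] torus_pow[OF x] by blast
      ultimately show "?f (restrict x {1..<n}, \<Prod>i<n. x i) = x"
        using torus_out[OF x] n_gt by (auto simp: fun_eq_iff)
    qed
    show "?f ` ?A \<subseteq> N"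
    proof (rule image_subsetI)
      fix a assume a: "a \<in> ?A"
      obtain y c where yc: "a = (y, c)" by (cases a)
      have y: "\<And>j. j \<in> {1..<n} \<Longrightarrow> y j ^ r = 1" and c: "c ^ m = 1"
        using a yc by (auto simp: PiE_iff)
      show "?f a \<in> N"
        unfolding yc
      proof (rule torusI)
        show "(\<Prod>i<n. ?f (y, c) i) ^ m = 1"
          unfolding prod using nz(1)[of y] y c by simp
        show "?f (y, c) i ^ r = 1" if "i < n" for i
          using that nz(2)[of y] y mr[OF c] by (auto simp: power_divide)
      qed (use n_gt in auto)
    qed
    show "(\<lambda>x. (restrict x {1..<n}, \<Prod>i<n. x i)) ` N \<subseteq> ?A"
      using torus_pow torus_prod by auto
  qed
  then have "card N = card ?A"
    by (rule bij_betw_same_card[symmetric])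
  also have "\<dots> = r ^ (n - 1) * m"
    using card_roots_unity_eq[OF r_pos] card_roots_unity_eq[OF m_pos]
    by (simp add: card_cartesian_product card_PiE)
  finally show ?thesis .
qed

lemma card_wreath: "card (carrier WG) = fact n * (r ^ (n - 1) * m)"
  using card_torus by (simp add: wreath_def card_cartesian_product card_permutations)

lemma finite_wreath: "finite (carrier WG)"
  using card_wreath r_pos m_pos by (intro card_ge_0_finite) simp

lemma finite_torus: "finite N"
  using card_torus r_pos m_pos by (intro card_ge_0_finite) simp

lemma const_tuple_in_torus: "const_tuple n c \<in> N \<longleftrightarrow> c ^ r = 1 \<and> c ^ (n * m) = 1"
  using n_gt by (auto simp: torus_def const_tuple_def power_mult intro: exI[of _ 0])

text \<open>A scalar c is admissible if c^r = c^(n m) = 1, and gcd(r, n m) = m gcd(p, n) because r =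
  p m. These scalars give both the centre and the upper bound for the diagonal part of a displaced
  image.\<close>

lemma card_const_tuples: "card {x \<in> N. \<exists>c. x = const_tuple n c} = m * gcd p n"
proof -
  have "{x \<in> N. \<exists>c. x = const_tuple n c} = const_tuple n ` {c. c ^ r = 1 \<and> c ^ (n * m) = 1}"
    using const_tuple_in_torus by auto
  moreover have "inj (const_tuple n)"
    using n_gt by (intro injI) (auto simp: const_tuple_def fun_eq_iff dest: spec[of _ 0])
  ultimately have "card {x \<in> N. \<exists>c. x = const_tuple n c} = gcd r (n * m)"
    using card_common_roots[OF r_pos] by (simp add: card_image inj_on_subset)
  also have "gcd r (n * m) = m * gcd p n"
    by (metis gcd_mult_distrib_nat mult.commute r_eq)
  finally show ?thesis .
qed

lemma root_tuple_in_torus: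
  assumes "a < n" "b < n" "a \<noteq> b" shows "root_tuple r a b \<in> N"
proof (rule torusI)
  have one: "zeta r ^ r = 1" using zeta_pow_eq_one_iff[OF r_pos] by simp
  then show "root_tuple r a b i ^ r = 1" for i
    by (simp add: root_tuple_def power_inverse)
  show "root_tuple r a b i = 1" if "n \<le> i" for i
    using that assms by (simp add: root_tuple_def)
  have "(\<Prod>i<n. root_tuple r a b i) = (\<Prod>i\<in>{a, b}. root_tuple r a b i)"
    using assms by (intro prod.mono_neutral_right) (auto simp: root_tuple_def)
  also have "\<dots> = 1" using assms by (simp add: root_tuple_def)
  finally show "(\<Prod>i<n. root_tuple r a b i) ^ m = 1" by simp
qed

end

section \<open>The model as a matrix group\<close>

definition monomial_mat :: "nat \<Rightarrow> (nat \<Rightarrow> complex) \<times> (nat \<Rightarrow> nat) \<Rightarrow> complex mat" where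
  "monomial_mat n g = mat n n (\<lambda>(i, j). if j = snd g i then fst g i else 0)"

context rpn
begin

lemma monomial_mat_mult:
  assumes "g \<in> carrier WG" "h \<in> carrier WG"
  shows "monomial_mat n (g \<otimes>\<^bsub>WG\<^esub> h) = monomial_mat n g * monomial_mat n h"
proof (rule eq_matI)
  obtain x w y v where gh: "g = (x, w)" "h = (y, v)" by (cases g; cases h)
  have w: "w permutes {..<n}" using assms gh by (simp add: wreath_carrier)
  fix i j assume "i < dim_row (monomial_mat n g * monomial_mat n h)"
    "j < dim_col (monomial_mat n g * monomial_mat n h)"
  then have ij: "i < n" "j < n" by (auto simp: monomial_mat_def)
  then have wi: "w i < n" using permutes_in_image[OF w, of i] by simp
  have "(monomial_mat n g * monomial_mat n h) $$ (i, j)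
    = (\<Sum>k = 0..<n. (if k = w i then x i else 0) * (if j = v k then y k else 0))"
    using ij by (auto simp: monomial_mat_def gh scalar_prod_def intro!: sum.cong)
  also have "\<dots> = (\<Sum>k = 0..<n. if k = w i then x i * (if j = v k then y k else 0) else 0)"
    by (intro sum.cong) auto
  also have "\<dots> = monomial_mat n (g \<otimes>\<^bsub>WG\<^esub> h) $$ (i, j)"
    using ij wi by (simp add: monomial_mat_def gh wreath_mult)
  finally show "monomial_mat n (g \<otimes>\<^bsub>WG\<^esub> h) $$ (i, j) = (monomial_mat n g * monomial_mat n h) $$ (i, j)"
    by simp
qed (auto simp: monomial_mat_def)

lemma nz_positions_monomial_mat:
  assumes "x \<in> N" "w permutes {..<n}"
  shows "nz_positions n (monomial_mat n (x, w)) = (\<lambda>i. (i, w i)) ` {..<n}"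
  using torus_nz[OF assms(1)] permutes_in_image[OF assms(2)]
  by (auto simp: nz_positions_def monomial_mat_def split: if_splits)

lemma prod_nz_positions_monomial_mat:
  assumes "x \<in> N" "w permutes {..<n}"
  shows "(\<Prod>ij\<in>nz_positions n (monomial_mat n (x, w)). monomial_mat n (x, w) $$ ij) = (\<Prod>i<n. x i)"
  unfolding nz_positions_monomial_mat[OF assms]
  by (subst prod.reindex)
     (use permutes_in_image[OF assms(2)] in \<open>auto simp: monomial_mat_def inj_on_def intro!: prod.cong\<close>)

lemma monomial_mat_in_Grpn:
  assumes "g \<in> carrier WG" shows "monomial_mat n g \<in> carrier (Grpn r p n)"
proof -
  obtain x w where g: "g = (x, w)" by (cases g)
  then have x: "x \<in> N" and w: "w permutes {..<n}"
    using assms by (auto simp: wreath_carrier)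
  have wn: "w i < n \<longleftrightarrow> i < n" for i using permutes_in_image[OF w, of i] by simp
  have inj: "w i = w j \<longleftrightarrow> i = j" for i j using permutes_inj[OF w] by (auto dest: injD)
  have "gen_perm_mat n (monomial_mat n g)"
    unfolding gen_perm_mat_def
  proof (intro conjI allI impI)
    fix i assume "i < n"
    then show "\<exists>!j. j < n \<and> monomial_mat n g $$ (i, j) \<noteq> 0"
      using torus_nz[OF x, of i] wn[of i] by (auto simp: monomial_mat_def g intro!: ex1I[of _ "w i"] split: if_splits)
  next
    fix j assume j: "j < n"
    obtain i where i: "w i = j" using permutes_surj[OF w] by (metis surjD)
    then show "\<exists>!i. i < n \<and> monomial_mat n g $$ (i, j) \<noteq> 0"
      using torus_nz[OF x] j wn[of i] inj by (auto simp: monomial_mat_def g intro!: ex1I[of _ i] split: if_splits)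
  qed (simp add: monomial_mat_def)
  moreover have "\<forall>ij\<in>nz_positions n (monomial_mat n g). (monomial_mat n g $$ ij) ^ r = 1"
    unfolding g nz_positions_monomial_mat[OF x w]
    using torus_pow[OF x] wn by (auto simp: monomial_mat_def)
  moreover have "(\<Prod>ij\<in>nz_positions n (monomial_mat n g). monomial_mat n g $$ ij) ^ m = 1"
    unfolding g prod_nz_positions_monomial_mat[OF x w] using torus_prod[OF x] .
  ultimately show ?thesis by (simp add: Grpn_def)
qed

lemma monomial_mat_inj: "inj_on (monomial_mat n) (carrier WG)"
proof (rule inj_onI)
  fix g h assume gh: "g \<in> carrier WG" "h \<in> carrier WG" and eq: "monomial_mat n g = monomial_mat n h"
  obtain x w y v where xw: "g = (x, w)" "h = (y, v)" by (cases g; cases h)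
  with gh have x: "x \<in> N" "y \<in> N" and w: "w permutes {..<n}" "v permutes {..<n}"
    by (auto simp: wreath_carrier)
  have "w i = v i \<and> x i = y i" for i
  proof (cases "i < n")
    case True
    then have "w i < n" using permutes_in_image[OF w(1), of i] by simp
    then have "x i = (if w i = v i then y i else 0)"
      using arg_cong[OF eq, of "\<lambda>A. A $$ (i, w i)"] True by (simp add: monomial_mat_def xw)
    then show ?thesis using torus_nz[OF x(1), of i] by (auto split: if_splits)
  next
    case False
    then show ?thesis using torus_out x permutes_not_in w by (metis lessThan_iff not_less)
  qed
  then show "g = h" by (auto simp: xw)
qed

lemma monomial_mat_surj:
  assumes "A \<in> carrier (Grpn r p n)" shows "A \<in> monomial_mat n ` carrier WG"
proof -
  have A: "A \<in> carrier_mat n n"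
    and row: "\<And>i. i < n \<Longrightarrow> \<exists>!j. j < n \<and> A $$ (i, j) \<noteq> 0"
    and col: "\<And>j. j < n \<Longrightarrow> \<exists>!i. i < n \<and> A $$ (i, j) \<noteq> 0"
    and roots: "\<And>ij. ij \<in> nz_positions n A \<Longrightarrow> (A $$ ij) ^ r = 1"
    and prod: "(\<Prod>ij\<in>nz_positions n A. A $$ ij) ^ m = 1"
    using assms by (auto simp: Grpn_def gen_perm_mat_def)
  obtain f where f: "\<And>i. i < n \<Longrightarrow> f i < n \<and> A $$ (i, f i) \<noteq> 0"
    using row by metis
  have f_eq: "j = f i" if "i < n" "j < n" "A $$ (i, j) \<noteq> 0" for i j
    using row[OF that(1)] f[OF that(1)] that by blast
  define w where "w = (\<lambda>i. if i < n then f i else i)"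
  have "inj_on w {..<n}"
  proof (rule inj_onI)
    fix i j assume "i \<in> {..<n}" "j \<in> {..<n}" "w i = w j"
    then have "i < n" "j < n" "f i = f j" by (auto simp: w_def)
    then show "i = j" using col[of "f i"] f[of i] f[of j] by auto
  qed
  moreover have "w ` {..<n} \<subseteq> {..<n}" using f by (auto simp: w_def)
  ultimately have "bij_betw w {..<n} {..<n}" by (simp add: bij_betw_def endo_inj_surj)
  then have w: "w permutes {..<n}" by (rule bij_imp_permutes) (auto simp: w_def)
  define x where "x = (\<lambda>i. if i < n then A $$ (i, w i) else 1)"
  have eq: "A = monomial_mat n (x, w)"
  proof (rule eq_matI)
    fix i j assume "i < dim_row (monomial_mat n (x, w))" "j < dim_col (monomial_mat n (x, w))"
    then have ij: "i < n" "j < n" by (auto simp: monomial_mat_def)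
    then show "A $$ (i, j) = monomial_mat n (x, w) $$ (i, j)"
    proof (cases "j = f i")
      case True
      then show ?thesis using ij by (simp add: monomial_mat_def x_def w_def)
    next
      case False
      then have "A $$ (i, j) = 0" using f_eq[OF ij] by blast
      then show ?thesis using ij False by (simp add: monomial_mat_def x_def w_def)
    qed
  qed (use A in \<open>auto simp: monomial_mat_def\<close>)
  have nzp: "nz_positions n A = (\<lambda>i. (i, w i)) ` {..<n}"
    using f f_eq by (auto simp: nz_positions_def w_def)
  have "x \<in> N"
  proof (rule torusI)
    show "x i ^ r = 1" if "i < n" for i
      using roots[of "(i, w i)"] that nzp by (auto simp: x_def)
    have "(\<Prod>ij\<in>nz_positions n A. A $$ ij) = (\<Prod>i<n. x i)"
      unfolding nzp by (subst prod.reindex) (auto simp: inj_on_def x_def)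
    then show "(\<Prod>i<n. x i) ^ m = 1" using prod by simp
  qed (simp add: x_def)
  with w eq show ?thesis by (auto simp: wreath_carrier intro!: image_eqI[of _ _ "(x, w)"])
qed

lemma monomial_mat_iso: "monomial_mat n \<in> iso WG (Grpn r p n)"
proof -
  have "monomial_mat n \<in> hom WG (Grpn r p n)"
    using monomial_mat_in_Grpn monomial_mat_mult by (auto simp: hom_def) (simp add: Grpn_def)
  moreover have "bij_betw (monomial_mat n) (carrier WG) (carrier (Grpn r p n))"
    using monomial_mat_inj monomial_mat_in_Grpn monomial_mat_surj by (auto simp: bij_betw_def)
  ultimately show ?thesis by (simp add: iso_def)
qed

lemma group_Grpn: "group (Grpn r p n)"
proof -
  have hom: "monomial_mat n \<in> hom WG (Grpn r p n)"
    and img: "monomial_mat n ` carrier WG = carrier (Grpn r p n)"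
    using monomial_mat_iso by (auto simp: iso_def bij_betw_def)
  have one: "monomial_mat n \<one>\<^bsub>WG\<^esub> = \<one>\<^bsub>Grpn r p n\<^esub>"
    by (rule eq_matI) (auto simp: monomial_mat_def wreath_one Grpn_def)
  have "group ((Grpn r p n)\<lparr>carrier := carrier (Grpn r p n), one := \<one>\<^bsub>Grpn r p n\<^esub>\<rparr>)"
    using W.hom_imp_img_group[OF hom] unfolding img one .
  then show ?thesis by simp
qed

lemma card_Grpn: "card (carrier (Grpn r p n)) = fact n * (r ^ (n - 1) * m)"
  using monomial_mat_iso bij_betw_same_card[of "monomial_mat n" "carrier WG" "carrier (Grpn r p n)"]
  by (simp add: iso_def card_wreath)

lemma finite_Grpn: "finite (carrier (Grpn r p n))"
  using card_Grpn r_pos m_pos by (intro card_ge_0_finite) simp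

lemma card_auto_Grpn: "card (auto (Grpn r p n)) = card (auto WG)"
  using card_auto_iso[OF group_wreath group_Grpn finite_Grpn monomial_mat_iso] by simp

section \<open>The centre\<close>

lemma perm_mem: "w permutes {..<n} \<Longrightarrow> ((\<lambda>_. 1, w) :: (nat \<Rightarrow> complex) \<times> (nat \<Rightarrow> nat)) \<in> carrier WG"
  using torus_one by (simp add: wreath_carrier)

lemma torus_mem: "x \<in> N \<Longrightarrow> (x, id) \<in> carrier WG"
  using permutes_id by (simp add: wreath_carrier)

lemma const_on_orbit:
  assumes "x \<in> N" "\<And>i. i < n \<Longrightarrow> x i = x 0" shows "x = const_tuple n (x 0)"
proof
  fix i show "x i = const_tuple n (x 0) i"
    using assms(2)[of i] torus_out[OF assms(1), of i] by (cases "i < n") (simp_all add: const_tuple_def)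
qed

text \<open>A central (x, w) with w trivial commutes with all permutations, which makes x constant.
  If w moves a point a, commuting with a root tuple on a and w a forces zeta^2 = 1, so r is 1 or 2,
  and commuting with a transposition through w a and a third point forces n = 2.\<close>

lemma center_wreath:
  assumes "(r, p, n) \<noteq> (1, 1, 2)" "(r, p, n) \<noteq> (2, 2, 2)"
  shows "center WG = (\<lambda>x. (x, id :: nat \<Rightarrow> nat)) ` {x \<in> N. \<exists>c. x = const_tuple n c}"
proof (intro equalityI subsetI)
  fix g assume "g \<in> (\<lambda>x. (x, id :: nat \<Rightarrow> nat)) ` {x \<in> N. \<exists>c. x = const_tuple n c}"
  then obtain c where c: "const_tuple n c \<in> N" "g = (const_tuple n c, id)" by auto
  have const: "const_tuple n c (w i) = const_tuple n c i" if "w permutes {..<n}" for w i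
    using permutes_in_image[OF that, of i] by (simp add: const_tuple_def)
  have "g \<otimes>\<^bsub>WG\<^esub> h = h \<otimes>\<^bsub>WG\<^esub> g" if h: "h \<in> carrier WG" for h
  proof -
    obtain y v where yv: "h = (y, v)" by (cases h)
    then show ?thesis using h const by (auto simp: c(2) wreath_mult wreath_carrier mult.commute)
  qed
  then show "g \<in> center WG"
    using torus_mem c by (auto simp: center_def)
next
  fix g assume g: "g \<in> center WG"
  obtain x w where xw: "g = (x, w)" by (cases g)
  with g have x: "x \<in> N" and w: "w permutes {..<n}"
    by (auto simp: center_def wreath_carrier)
  have comm: "g \<otimes>\<^bsub>WG\<^esub> h = h \<otimes>\<^bsub>WG\<^esub> g" if "h \<in> carrier WG" for h
    using g that by (simp add: center_def)
  have inv_y: "y (w i) = y i" if "y \<in> N" for y i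
    using comm[OF torus_mem[OF that]] torus_nz[OF x, of i]
    by (auto simp: xw wreath_mult fun_eq_iff mult.commute dest: spec[of _ i])
  have v: "x (v i) = x i \<and> v (w i) = w (v i)" if "v permutes {..<n}" for v i
    using comm[OF perm_mem[OF that]]
    by (auto simp: xw wreath_mult fun_eq_iff dest: spec[of _ i])
  have "w = id"
  proof (rule ccontr)
    assume "w \<noteq> id"
    then obtain a where a: "w a \<noteq> a" by (metis eq_id_iff)
    have an: "a < n" "w a < n"
      using a permutes_not_in[OF w, of a] permutes_in_image[OF w, of a] by auto
    have "root_tuple r (w a) a (w a) = root_tuple r (w a) a a"
      using inv_y[OF root_tuple_in_torus[OF an(2,1)]] a by blast
    then have "zeta r = inverse (zeta r)"
      using a by (simp add: root_tuple_def split: if_splits)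
    then have "zeta r ^ 2 = 1"
      by (metis power2_eq_square right_inverse zeta_nz)
    then have "r dvd 2"
      using zeta_pow_eq_one_iff[OF r_pos] by blast
    then have r12: "r = 1 \<or> r = 2"
      using prime_nat_iff two_is_prime_nat by blast
    have "n = 2"
    proof (rule ccontr)
      assume "n \<noteq> 2"
      then have "\<not> {..<n} \<subseteq> {a, w a}"
        using card_mono[of "{a, w a}" "{..<n}"] n_gt a by auto
      then obtain c where c: "c < n" "c \<noteq> a" "c \<noteq> w a" by auto
      have "transpose (w a) c permutes {..<n}"
        using c an by (intro permutes_swap_id) auto
      from v[OF this, of a] have "transpose (w a) c (w a) = w (transpose (w a) c a)" by simp
      then show False using c a by (simp add: transpose_def)
    qed
    have "p = 1 \<or> p = 2"
      using p_dvd r12 prime_nat_iff two_is_prime_nat by (auto)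
    with r12 \<open>n = 2\<close> assms have "r = 2" "p = 1"
      using p_dvd by auto
    \<comment> \<open>The remaining case is (2,1,2), where a single entry -1 is allowed; this tuple
      is not fixed by the swap.\<close>
    define y :: "nat \<Rightarrow> complex" where "y = (\<lambda>i. if i = a then -1 else 1)"
    have "y \<in> N"
    proof (rule torusI)
      show "(\<Prod>i<n. y i) ^ m = 1"
        using \<open>r = 2\<close> \<open>p = 1\<close> by (simp add: y_def prod_power_distrib if_distrib[of "\<lambda>x. x ^ 2"] cong: if_cong)
    qed (use an \<open>r = 2\<close> in \<open>auto simp: y_def\<close>)
    from inv_y[OF this, of a] show False using a by (simp add: y_def)
  qed
  moreover have x0: "x i = x 0" if "i < n" for i
  proof -
    have "transpose 0 i permutes {..<n}" using that by (intro permutes_swap_id) auto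
    from v[OF this, of 0] show ?thesis by simp
  qed
  moreover have "x = const_tuple n (x 0)"
    by (rule const_on_orbit[OF x x0])
  ultimately show "g \<in> (\<lambda>x. (x, id :: nat \<Rightarrow> nat)) ` {x \<in> N. \<exists>c. x = const_tuple n c}"
    unfolding xw using x by blast
qed

text \<open>All tuples are constant here, so S_2 acts trivially on them. The groups have orders 2
  and 4 while their scalars number 1 and 2, which explains the value c' = 2.\<close>

lemma center_wreath_abelian:
  assumes "(r, p, n) = (1, 1, 2) \<or> (r, p, n) = (2, 2, 2)"
  shows "center WG = carrier WG"
proof -
  have n2: "n = 2" using assms by auto
  have x01: "x 0 = x 1" if "x \<in> N" for x
  proof (cases "r = 1")
    case True
    then show ?thesis using torus_pow[OF that, of 0] torus_pow[OF that, of 1] by simp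
  next
    case False
    then have "r = 2" "p = 2" using assms by auto
    then have sq: "x 0 ^ 2 = 1" "x 1 ^ 2 = 1" and "x 0 * x 1 = 1"
      using torus_pow[OF that, of 0] torus_pow[OF that, of 1] torus_prod[OF that] n2
      by (auto simp: numeral_2_eq_2)
    then show ?thesis
      by (metis mult.left_commute mult.right_neutral power2_eq_square)
  qed
  have inv: "x (w i) = x i" if "x \<in> N" "w permutes {..<n}" for x w i
    using that(2) x01[OF that(1)] n2 permutes_two_cases[of w] by (auto simp: transpose_def)
  have "g \<otimes>\<^bsub>WG\<^esub> h = h \<otimes>\<^bsub>WG\<^esub> g" if gh: "g \<in> carrier WG" "h \<in> carrier WG" for g h
  proof -
    obtain x w y v where xw: "g = (x, w)" "h = (y, v)" by (cases g; cases h)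
    with gh have "x \<in> N" "y \<in> N" "w permutes {..<n}" "v permutes {..<n}"
      by (auto simp: wreath_carrier)
    moreover from this have "w \<circ> v = v \<circ> w"
      using n2 permutes_two_cases[of w] permutes_two_cases[of v] by auto
    ultimately show ?thesis
      using inv[of x v] inv[of y w] by (auto simp: xw wreath_mult)
  qed
  then show ?thesis by (auto simp: center_def)
qed

lemma card_center_Grpn:
  "real (card (center (Grpn r p n))) = c_center r p n * (real r / real p) * real (gcd p n)"
proof -
  have rp: "real r / real p = real m"
    using r_eq p_pos by (metis nonzero_mult_div_cancel_left of_nat_eq_0_iff of_nat_mult less_not_refl)
  have iso: "card (center (Grpn r p n)) = card (center WG)"
    using card_center_iso[OF group_wreath monomial_mat_iso] by simp
  show ?thesis
  proof (cases "(r, p, n) = (1, 1, 2) \<or> (r, p, n) = (2, 2, 2)")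
    case True
    then show ?thesis
      using center_wreath_abelian[OF True] card_wreath iso
      by (auto simp: c_center_def fact_numeral)
  next
    case False
    then have "card (center WG) = card {x \<in> N. \<exists>c. x = const_tuple n c}"
      using center_wreath by (simp add: card_image inj_on_def)
    then show ?thesis
      using False iso rp card_const_tuples by (auto simp: c_center_def)
  qed
qed

end

section \<open>Automorphisms over the identity of the symmetric group\<close>

text \<open>The general automorphism over the identity of S_n: the power map \<open>k\<close>,
  multiplication by the \<open>v\<close>-th power of the product of the entries, conjugation by the
  diagonal matrix \<open>t\<close> of G(r,1,n), and, for \<open>d = 1\<close>, a twist by the scalar
  given by the sign of the permutation. The case distinction keeps the entries beyond
  \<open>n\<close> equal to 1.\<close>

definition wreath_map ::
    "nat \<Rightarrow> nat \<Rightarrow> nat \<Rightarrow> (nat \<Rightarrow> complex) \<Rightarrow> nat \<Rightarrow> (nat \<Rightarrow> complex) \<times> (nat \<Rightarrow> nat) \<Rightarrow> (nat \<Rightarrow> complex) \<times> (nat \<Rightarrow> nat)" where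
  "wreath_map n k v t d = (\<lambda>(x, w).
     (\<lambda>i. if i < n then x i ^ k * (\<Prod>j<n. x j) ^ v * (t i / t (w i)) * of_int (sign w) ^ d else 1, w))"

lemma coprime_power_eq:
  fixes a b :: complex
  assumes "m > 0" "a ^ m = 1" "b ^ m = 1" "a ^ s = b ^ s" "coprime s m" shows "a = b"
proof -
  have b0: "b \<noteq> 0" using assms(1,3) by (auto simp: power_0_left)
  have "(a / b) ^ gcd s m = 1"
    by (rule pow_gcd_eq_one) (use assms b0 in \<open>simp_all add: power_divide\<close>)
  then show ?thesis using assms(5) b0 by (simp add: coprime_iff_gcd_eq_1)
qed

context rpn
begin

lemma zeta_pow_inj: "a < r \<Longrightarrow> b < r \<Longrightarrow> zeta r ^ a = zeta r ^ b \<Longrightarrow> a = b"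
  using bij_betw_roots_unity[OF r_pos] unfolding zeta_power bij_betw_def by (auto dest: inj_onD)

lemma m_root_is_r_root: "c ^ m = 1 \<Longrightarrow> c ^ r = (1 :: complex)"
  using r_eq by (metis mult.commute power_mult power_one)

lemma m_root_eq_zeta_pow:
  assumes "c ^ m = 1" obtains v where "v < m" "c = zeta r ^ (p * v)"
proof -
  obtain k where k: "k < r" "c = zeta r ^ k"
    using root_unity_eq_zeta_pow[OF r_pos m_root_is_r_root[OF assms]] .
  then have "r dvd k * m"
    using assms zeta_pow_eq_one_iff[OF r_pos] by (simp add: power_mult[symmetric])
  then have "p * m dvd k * m" using r_eq by simp
  then have "p dvd k" using m_pos by simp
  then obtain v where v: "k = p * v" by (elim dvdE)
  then have "p * v < p * m" using k r_eq by simp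
  then have "v < m" by simp
  then show thesis using that k v by blast
qed

text \<open>Its product generates the m-th roots of unity, so it supplies what the root tuples, all
  of product 1, cannot reach.\<close>

definition first_tuple :: "nat \<Rightarrow> complex" where
  "first_tuple = (\<lambda>i. if i = 0 then zeta r ^ p else 1)"

lemma prod_first_tuple: "(\<Prod>i<n. first_tuple i) = zeta r ^ p"
proof -
  have "(\<Prod>i<n. first_tuple i) = (\<Prod>i\<in>{0}. first_tuple i)"
    using n_gt by (intro prod.mono_neutral_right) (auto simp: first_tuple_def)
  then show ?thesis by (simp add: first_tuple_def)
qed

lemma zeta_r: "zeta r ^ r = 1"
  using zeta_pow_eq_one_iff[OF r_pos] by simp

lemma zeta_pm: "(zeta r ^ p) ^ m = 1"
  using zeta_r r_eq by (simp add: power_mult[symmetric])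

lemma first_tuple_in_torus: "first_tuple \<in> N"
proof (rule torusI)
  show "first_tuple i ^ r = 1" for i
    using zeta_r by (simp add: first_tuple_def power_mult[symmetric] mult.commute[of p] power_mult)
  show "(\<Prod>i<n. first_tuple i) ^ m = 1"
    using zeta_pm by (simp add: prod_first_tuple)
qed (use n_gt in \<open>auto simp: first_tuple_def\<close>)

text \<open>Powers of the root tuples adjust the entries at 1, ..., n-1; a power of
  \<open>first_tuple\<close> then corrects the product and with it the entry at 0.\<close>

lemma torus_gen:
  assumes x: "x \<in> N" and one: "(\<lambda>_. 1) \<in> E"
    and mult: "\<And>y z. y \<in> E \<Longrightarrow> z \<in> E \<Longrightarrow> (\<lambda>i. y i * z i) \<in> E"
    and roots: "\<And>j. 0 < j \<Longrightarrow> j < n \<Longrightarrow> root_tuple r j 0 \<in> E"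
    and first: "first_tuple \<in> E"
  shows "x \<in> E"
proof -
  have pow: "(\<lambda>i. y i ^ k) \<in> E" if "y \<in> E" for y k
    by (induction k) (use one mult[OF that] in \<open>auto\<close>)
  have prod: "(\<lambda>i. \<Prod>j\<in>A. y j i) \<in> E" if "finite A" "\<And>j. j \<in> A \<Longrightarrow> y j \<in> E" for A :: "nat set" and y
    using that by (induction A rule: finite_induct) (use one mult in auto)
  have "\<exists>a. x j = zeta r ^ a" for j
    using root_unity_eq_zeta_pow[OF r_pos torus_pow[OF x]] by metis
  then obtain a where a: "\<And>j. x j = zeta r ^ a j" by metis
  obtain b where b: "(\<Prod>i<n. x i) = zeta r ^ (p * b)"
    using m_root_eq_zeta_pow[OF torus_prod[OF x]] by metis
  let ?y = "\<lambda>i. (\<Prod>j\<in>{1..<n}. root_tuple r j 0 i ^ a j) * first_tuple i ^ b"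
  have "?y \<in> E"
    by (rule mult[OF prod pow[OF first]]) (use pow[OF roots] in auto)
  moreover have "?y i = x i" for i
  proof -
    consider "i = 0" | "0 < i" "i < n" | "n \<le> i" "i \<noteq> 0" using n_gt by linarith
    then show ?thesis
    proof cases
      case 1
      have ins: "{..<n} = insert 0 {1..<n}" using n_gt by auto
      have "(\<Prod>i<n. x i) = x 0 * (\<Prod>j\<in>{1..<n}. x j)"
        unfolding ins by (subst prod.insert) auto
      moreover have "(\<Prod>j\<in>{1..<n}. root_tuple r j 0 0 ^ a j) = (\<Prod>j\<in>{1..<n}. inverse (x j))"
        by (intro prod.cong) (auto simp: root_tuple_def a power_inverse)
      moreover have "(\<Prod>j\<in>{1..<n}. inverse (x j)) = inverse (\<Prod>j\<in>{1..<n}. x j)"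
        using prod_inversef[of x "{1..<n}"] by (simp add: comp_def)
      moreover have "(\<Prod>j\<in>{1..<n}. x j) \<noteq> 0"
        using torus_nz[OF x] by simp
      ultimately show ?thesis
        using 1 b by (simp add: first_tuple_def power_mult[symmetric] field_simps)
    next
      case 2
      have "(\<Prod>j\<in>{1..<n}. root_tuple r j 0 i ^ a j) = (\<Prod>j\<in>{i}. root_tuple r j 0 i ^ a j)"
        using 2 by (intro prod.mono_neutral_right) (auto simp: root_tuple_def)
      then show ?thesis using 2 a by (simp add: root_tuple_def first_tuple_def)
    next
      case 3
      have "(\<Prod>j\<in>{1..<n}. root_tuple r j 0 i ^ a j) = 1"
        using 3 by (intro prod.neutral) (auto simp: root_tuple_def)
      then show ?thesis using 3 torus_out[OF x] by (simp add: first_tuple_def)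
    qed
  qed
  then have "?y = x" by (rule ext)
  ultimately show ?thesis by simp
qed

lemma wreath_gen:
  assumes g: "g \<in> carrier WG"
    and mult: "\<And>g h. g \<in> E \<Longrightarrow> h \<in> E \<Longrightarrow> g \<otimes>\<^bsub>WG\<^esub> h \<in> E"
    and roots: "\<And>j. 0 < j \<Longrightarrow> j < n \<Longrightarrow> (root_tuple r j 0, id) \<in> E"
    and first: "(first_tuple, id) \<in> E"
    and star: "\<And>j. 0 < j \<Longrightarrow> j < n \<Longrightarrow> (\<lambda>_. 1, transpose 0 j) \<in> E"
  shows "g \<in> E"
proof -
  obtain x w where xw: "g = (x, w)" by (cases g)
  with g have x: "x \<in> N" and w: "w permutes {..<n}" by (auto simp: wreath_carrier)
  have one: "(\<lambda>_. 1, id) \<in> E"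
    using mult[OF star[of 1] star[of 1]] n_gt by (simp add: wreath_mult)
  have "x \<in> {x. (x, id) \<in> E}"
    by (rule torus_gen[OF x]) (use one roots first mult[of "(_, id)" "(_, id)"] in \<open>auto simp: wreath_mult\<close>)
  moreover have "w \<in> {w. (\<lambda>_. 1, w) \<in> E}"
  proof (rule permutes_star_induct[OF w])
    fix u v assume "u \<in> {w. (\<lambda>_. 1, w) \<in> E}" "v \<in> {w. (\<lambda>_. 1, w) \<in> E}"
    then show "u \<circ> v \<in> {w. (\<lambda>_. 1, w) \<in> E}"
      using mult[of "(\<lambda>_. 1, v)" "(\<lambda>_. 1, u)"] by (simp add: wreath_mult)
  qed (use one star in auto)
  ultimately show ?thesis
    using mult[of "(x, id)" "(\<lambda>_. 1, w)"] by (simp add: wreath_mult xw)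
qed

lemma sign_pow_two: "(of_int (sign w) :: complex) ^ (2 * k) = 1"
  by (simp add: power_mult power2_eq_square flip: of_int_mult)

lemma sign_even_pow: "even k \<Longrightarrow> (of_int (sign w) :: complex) ^ k = 1"
  using sign_pow_two by (auto elim!: evenE)

text \<open>The conditions make the parameters unique: \<open>v\<close> matters only modulo
  \<open>m\<close>, since the product is an m-th root of unity, and \<open>t\<close> only up to
  scalars, whence \<open>t 0 = 1\<close>. For \<open>n = 2\<close> the sign twist is the conjugation
  by t = (1, -1), so \<open>d = 1\<close> is allowed only from \<open>n = 3\<close> on.\<close>

definition kernel_params :: "((nat \<times> nat) \<times> (nat \<Rightarrow> complex) \<times> nat) set" where
  "kernel_params =
     (SIGMA k:{k. k < r \<and> coprime k r}. {v. v < m \<and> coprime (k + n * v) m}) \<times>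
     {t \<in> torus r (Suc 0) n. t 0 = 1} \<times>
     {d. d = 0 \<or> d = Suc 0 \<and> 3 \<le> n \<and> even r \<and> even (n * m)}"

definition kernel_auts :: "((nat \<Rightarrow> complex) \<times> (nat \<Rightarrow> nat) \<Rightarrow> (nat \<Rightarrow> complex) \<times> (nat \<Rightarrow> nat)) set" where
  "kernel_auts = {\<alpha> \<in> auto WG. \<forall>g\<in>carrier WG. snd (\<alpha> g) = snd g}"

lemma full_torusD:
  assumes "t \<in> torus r (Suc 0) n" shows "t i ^ r = 1" "t i \<noteq> 0" "n \<le> i \<Longrightarrow> t i = 1"
proof -
  show 1: "t i ^ r = 1" using assms by (cases "i < n") (auto simp: torus_def)
  then show "t i \<noteq> 0" using r_pos by (auto simp: power_0_left)
  show "n \<le> i \<Longrightarrow> t i = 1" using assms by (auto simp: torus_def)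
qed

lemma full_torusI:
  assumes "\<And>i. i < n \<Longrightarrow> t i ^ r = 1" "\<And>i. n \<le> i \<Longrightarrow> t i = 1" shows "t \<in> torus r (Suc 0) n"
  using assms by (auto simp: torus_def prod_power_distrib)

lemma wreath_map_closed:
  assumes t: "t \<in> torus r (Suc 0) n" and d: "d = 0 \<or> even r \<and> even (n * m)" and g: "g \<in> carrier WG"
  shows "wreath_map n k v t d g \<in> carrier WG"
proof -
  obtain x w where xw: "g = (x, w)" by (cases g)
  with g have x: "x \<in> N" and w: "w permutes {..<n}" by (auto simp: wreath_carrier)
  let ?X = "\<Prod>j<n. x j" and ?s = "of_int (sign w) ^ d :: complex"
  let ?y = "\<lambda>i. if i < n then x i ^ k * ?X ^ v * (t i / t (w i)) * ?s else 1"
  \<comment> \<open>The twist must be an r-th root of unity, and it occurs n times in a product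
    whose m-th power has to be 1; these are the two parities.\<close>
  have dr: "even (d * r)" and dnm: "even (d * (n * m))" using d by auto
  have sr: "?s ^ r = 1" and snm: "?s ^ (n * m) = 1"
    using sign_even_pow[OF dr, of w] sign_even_pow[OF dnm, of w] by (simp_all only: power_mult)
  have "?y \<in> N"
  proof (rule torusI)
    fix i assume "i < n"
    have "(x i ^ k) ^ r = 1" "(?X ^ v) ^ r = 1"
      using torus_pow[OF x] m_root_is_r_root[OF torus_prod[OF x]]
      by (simp_all add: power_mult[symmetric] mult.commute[of _ r]) (simp_all add: power_mult)
    then show "?y i ^ r = 1"
      using \<open>i < n\<close> sr full_torusD(1)[OF t] by (simp add: power_mult_distrib power_divide)
  next
    have tt: "(\<Prod>i<n. t i / t (w i)) = 1"
      using prod_permute[OF w, of t] full_torusD(2)[OF t] by (simp add: prod_dividef)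
    have "(\<Prod>i<n. ?y i) = (\<Prod>i<n. x i ^ k * ?X ^ v * (t i / t (w i)) * ?s)"
      by (intro prod.cong) auto
    also have "\<dots> = ?X ^ k * (?X ^ v) ^ n * ?s ^ n"
      by (simp add: prod.distrib tt prod_power_distrib del: times_divide_eq_right times_divide_eq_left)
    finally have "(\<Prod>i<n. ?y i) ^ m = (?X ^ m) ^ k * (?X ^ m) ^ (v * n) * ?s ^ (n * m)"
      by (simp add: power_mult_distrib power_mult[symmetric] ac_simps)
    then show "(\<Prod>i<n. ?y i) ^ m = 1"
      using torus_prod[OF x] snm by simp
  qed simp
  then show ?thesis using w by (simp add: xw wreath_map_def wreath_carrier)
qed

lemma wreath_map_mult:
  assumes t: "t \<in> torus r (Suc 0) n" and g: "g \<in> carrier WG" and h: "h \<in> carrier WG"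
  shows "wreath_map n k v t d (g \<otimes>\<^bsub>WG\<^esub> h) = wreath_map n k v t d g \<otimes>\<^bsub>WG\<^esub> wreath_map n k v t d h"
proof -
  obtain x w y u where xw: "g = (x, w)" "h = (y, u)" by (cases g; cases h)
  with g h have w: "w permutes {..<n}" and u: "u permutes {..<n}" by (auto simp: wreath_carrier)
  have wn: "w i < n \<longleftrightarrow> i < n" for i using permutes_in_image[OF w, of i] by simp
  have "sign (u \<circ> w) = sign u * sign w"
    using w u by (intro sign_compose) (auto intro: permutes_imp_permutation[of "{..<n}"])
  moreover have "(\<Prod>j<n. x j * y (w j)) = (\<Prod>j<n. x j) * (\<Prod>j<n. y j)"
    by (simp add: prod.distrib prod_permute[OF w])
  ultimately show ?thesis
    using full_torusD(2)[OF t] wn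
    by (auto simp: xw wreath_mult wreath_map_def fun_eq_iff power_mult_distrib)
qed

text \<open>Multiplying all entries shows that the products satisfy A^(k + n v) = B^(k + n v), hence
  A = B because k + n v is prime to \<open>m\<close>. Cancelling them leaves equality of the k-th
  powers of the entries.\<close>

lemma wreath_map_inj:
  assumes t: "t \<in> torus r (Suc 0) n" and k: "coprime k r" and kv: "coprime (k + n * v) m"
  shows "inj_on (wreath_map n k v t d) (carrier WG)"
proof (rule inj_onI)
  fix g h assume gh: "g \<in> carrier WG" "h \<in> carrier WG"
    and eq: "wreath_map n k v t d g = wreath_map n k v t d h"
  obtain x w y u where xw: "g = (x, w)" "h = (y, u)" by (cases g; cases h)
  with gh have x: "x \<in> N" and y: "y \<in> N" by (auto simp: wreath_carrier)
  let ?A = "\<Prod>j<n. x j" and ?B = "\<Prod>j<n. y j"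
  have "u = w" using eq by (simp add: xw wreath_map_def)
  have s0: "(of_int (sign w) :: complex) ^ d \<noteq> 0" by simp
  have e: "x i ^ k * ?A ^ v = y i ^ k * ?B ^ v" if "i < n" for i
  proof -
    have "x i ^ k * ?A ^ v * (t i / t (w i)) * of_int (sign w) ^ d
      = y i ^ k * ?B ^ v * (t i / t (w i)) * of_int (sign w) ^ d"
      using arg_cong[OF eq, of "\<lambda>g. fst g i"] that \<open>u = w\<close> by (simp add: xw wreath_map_def)
    then show ?thesis
      using s0 full_torusD(2)[OF t, of i] full_torusD(2)[OF t, of "w i"] by simp
  qed
  have "(\<Prod>i<n. x i ^ k * ?A ^ v) = (\<Prod>i<n. y i ^ k * ?B ^ v)"
    using e by (intro prod.cong) auto
  then have "?A ^ (k + n * v) = ?B ^ (k + n * v)"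
    by (simp add: prod.distrib prod_power_distrib[symmetric] power_add power_mult[symmetric] mult.commute)
  then have AB: "?A = ?B"
    using coprime_power_eq[OF m_pos torus_prod[OF x] torus_prod[OF y]] kv by blast
  have A0: "?A \<noteq> 0" using torus_nz[OF x] by simp
  have "x i = y i" for i
  proof (cases "i < n")
    case True
    then have "x i ^ k = y i ^ k"
      using e[OF True] AB A0 by simp
    then show ?thesis
      using coprime_power_eq[OF r_pos torus_pow[OF x] torus_pow[OF y]] k by blast
  qed (use torus_out[OF x] torus_out[OF y] in auto)
  then show "g = h" using \<open>u = w\<close> by (auto simp: xw)
qed

lemma wreath_map_auto:
  assumes t: "t \<in> torus r (Suc 0) n" and k: "coprime k r" and kv: "coprime (k + n * v) m"
    and d: "d = 0 \<or> even r \<and> even (n * m)"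
  shows "restrict (wreath_map n k v t d) (carrier WG) \<in> kernel_auts"
proof -
  have "restrict (wreath_map n k v t d) (carrier WG) \<in> auto WG"
    by (rule restrict_autoI)
       (use finite_wreath wreath_map_closed[OF t d] wreath_map_inj[OF t k kv] wreath_map_mult[OF t] in auto)
  then show ?thesis by (auto simp: kernel_auts_def wreath_map_def)
qed

end

section \<open>Counting and separating the parameters\<close>

context rpn
begin

lemma card_kernel_params:
  assumes e: "e = (GREATEST d. d dvd m \<and> coprime d n)"
  shows "e * card kernel_params =
    totient r * (m * totient e) * r ^ (n - 1) *
    (if 3 \<le> n \<and> even r \<and> even (n * m) then 2 else 1)"
proof -
  let ?K = "{k. k < r \<and> coprime k r}"
  let ?V = "\<lambda>k. {v. v < m \<and> coprime (k + n * v) m}"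
  let ?T = "{t \<in> torus r (Suc 0) n. t 0 = 1}"
  let ?D = "{d. d = 0 \<or> d = Suc 0 \<and> 3 \<le> n \<and> even r \<and> even (n * m)}"
  have "e * card (SIGMA k:?K. ?V k) = (\<Sum>k\<in>?K. e * card (?V k))"
    by (subst card_SigmaI) (auto simp: sum_distrib_left)
  also have "\<dots> = (\<Sum>k\<in>?K. m * totient e)"
  proof (rule sum.cong)
    fix k assume "k \<in> ?K"
    then have "coprime k r" by simp
    then have "coprime k m" using r_eq by (metis coprime_mult_right_iff)
    then show "e * card (?V k) = m * totient e"
      by (rule card_coprime_shift[OF m_pos _ e])
  qed simp
  finally have S: "e * card (SIGMA k:?K. ?V k) = totient r * (m * totient e)"
    using card_coprime_lessThan[OF r_pos] by simp
  have "bij_betw (\<lambda>y i. if i \<in> {1..<n} then y i else 1) ({1..<n} \<rightarrow>\<^sub>E {z::complex. z ^ r = 1}) ?T"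
  proof (rule bij_betw_byWitness[where f' = "\<lambda>t. restrict t {1..<n}"])
    show "\<forall>y\<in>{1..<n} \<rightarrow>\<^sub>E {z::complex. z ^ r = 1}. restrict (\<lambda>i. if i \<in> {1..<n} then y i else 1) {1..<n} = y"
    proof
      fix y :: "nat \<Rightarrow> complex" assume "y \<in> {1..<n} \<rightarrow>\<^sub>E {z. z ^ r = 1}"
      then show "restrict (\<lambda>i. if i \<in> {1..<n} then y i else 1) {1..<n} = y"
        by (auto simp: PiE_iff extensional_def fun_eq_iff restrict_def)
    qed
    show "\<forall>t\<in>?T. (\<lambda>i. if i \<in> {1..<n} then restrict t {1..<n} i else 1) = t"
    proof
      fix t assume t: "t \<in> ?T"
      show "(\<lambda>i. if i \<in> {1..<n} then restrict t {1..<n} i else 1) = t"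
      proof
        fix i show "(if i \<in> {1..<n} then restrict t {1..<n} i else 1) = t i"
          using t full_torusD(3)[of t i] by (cases "i = 0") auto
      qed
    qed
    show "(\<lambda>y i. if i \<in> {1..<n} then y i else 1) ` ({1..<n} \<rightarrow>\<^sub>E {z::complex. z ^ r = 1}) \<subseteq> ?T"
      by (auto intro!: full_torusI simp: PiE_iff)
    show "(\<lambda>t. restrict t {1..<n}) ` ?T \<subseteq> {1..<n} \<rightarrow>\<^sub>E {z::complex. z ^ r = 1}"
      using full_torusD(1) by auto
  qed
  then have "card ?T = card ({1..<n} \<rightarrow>\<^sub>E {z::complex. z ^ r = 1})"
    by (rule bij_betw_same_card[symmetric])
  then have T: "card ?T = r ^ (n - 1)"
    using card_roots_unity_eq[OF r_pos] by (simp add: card_PiE)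
  have D: "card ?D = (if 3 \<le> n \<and> even r \<and> even (n * m) then 2 else 1)"
  proof (cases "3 \<le> n \<and> even r \<and> even (n * m)")
    case True
    then have "?D = {0, Suc 0}" by auto
    then have "card ?D = 2" by (simp only: card_2_iff) auto
    then show ?thesis using True by simp
  next
    case False
    then have "?D = {0}" by auto
    then have "card ?D = 1" by (simp only: card_1_singleton_iff) auto
    then show ?thesis using False by simp
  qed
  have "e * card kernel_params = (e * card (SIGMA k:?K. ?V k)) * (card ?T * card ?D)"
    by (simp add: kernel_params_def card_cartesian_product)
  then show ?thesis
    unfolding S T D by (simp add: mult.assoc)
qed

lemma prod_root_tuple:
  assumes "a < n" "b < n" "a \<noteq> b" shows "(\<Prod>i<n. root_tuple r a b i) = 1"
proof -
  have "(\<Prod>i<n. root_tuple r a b i) = (\<Prod>i\<in>{a, b}. root_tuple r a b i)"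
    using assms by (intro prod.mono_neutral_right) (auto simp: root_tuple_def)
  then show ?thesis using assms by (simp add: root_tuple_def)
qed

lemma wreath_map_root:
  assumes "0 < j" "j < n" "t \<in> torus r (Suc 0) n"
  shows "wreath_map n k v t d (root_tuple r j 0, id) = (\<lambda>i. root_tuple r j 0 i ^ k, id)"
  using assms prod_root_tuple[of j 0] full_torusD(2)[OF assms(3)]
  by (auto simp: wreath_map_def fun_eq_iff root_tuple_def)

lemma wreath_map_first:
  assumes "t \<in> torus r (Suc 0) n"
  shows "wreath_map n k v t d (first_tuple, id) =
    (\<lambda>i. if i < n then first_tuple i ^ k * zeta r ^ (p * v) else 1, id)"
  using full_torusD(2)[OF assms]
  by (auto simp: wreath_map_def fun_eq_iff prod_first_tuple power_mult)

lemma wreath_map_star: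
  assumes "0 < j" "j < n"
  shows "wreath_map n k v t d (\<lambda>_. 1, transpose 0 j) =
    (\<lambda>i. if i < n then t i / t (transpose 0 j i) * (-1) ^ d else 1, transpose 0 j)"
  using assms by (auto simp: wreath_map_def fun_eq_iff sign_swap_id)

abbreviation "param_map \<equiv> (\<lambda>((k, v), t, d). restrict (wreath_map n k v t d) (carrier WG))"

lemma star_mem: "j < n \<Longrightarrow> (\<lambda>_. 1, transpose 0 j) \<in> carrier WG"
  using n_gt by (intro perm_mem permutes_swap_id) auto

lemma root_mem: "0 < j \<Longrightarrow> j < n \<Longrightarrow> (root_tuple r j 0, id) \<in> carrier WG"
  by (intro torus_mem root_tuple_in_torus) auto

lemma first_mem: "(first_tuple, id) \<in> carrier WG"
  by (intro torus_mem first_tuple_in_torus)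

text \<open>The parameters are read off at the generators: \<open>k\<close> at a root tuple,
  \<open>v\<close> at entry 1 of the image of \<open>first_tuple\<close>, \<open>d\<close> at entry
  2 of the image of (0 1), and \<open>t j\<close> at entry j of the image of (0 j).\<close>

lemma param_map_inj: "inj_on param_map kernel_params"
proof (rule inj_onI)
  fix a a' assume a: "a \<in> kernel_params" "a' \<in> kernel_params" and eq: "param_map a = param_map a'"
  obtain k v t d where a1: "a = ((k, v), t, d)" by (metis prod.exhaust)
  obtain k' v' t' d' where a2: "a' = ((k', v'), t', d')" by (metis prod.exhaust)
  have 1: "k < r" "v < m" "t \<in> torus r (Suc 0) n" "t 0 = 1" "d = 0 \<or> d = Suc 0 \<and> 3 \<le> n"
    and 2: "k' < r" "v' < m" "t' \<in> torus r (Suc 0) n" "t' 0 = 1" "d' = 0 \<or> d' = Suc 0 \<and> 3 \<le> n"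
    using a by (auto simp: a1 a2 kernel_params_def)
  have ev: "wreath_map n k v t d g = wreath_map n k' v' t' d' g" if "g \<in> carrier WG" for g
    using fun_cong[OF eq, of g] that by (simp add: a1 a2)
  have "zeta r ^ k = zeta r ^ k'"
    using arg_cong[OF ev[OF root_mem[of 1]], of "\<lambda>g. fst g 1"] n_gt
      wreath_map_root[of 1 t] wreath_map_root[of 1 t'] 1(3) 2(3)
    by (simp add: root_tuple_def)
  then have "k = k'" by (rule zeta_pow_inj[OF 1(1) 2(1)])
  have "p * v < r" "p * v' < r"
    using 1 2 p_pos by (subst r_eq, simp)+
  moreover have "zeta r ^ (p * v) = zeta r ^ (p * v')"
    using arg_cong[OF ev[OF first_mem], of "\<lambda>g. fst g 1"] n_gt
      wreath_map_first[OF 1(3)] wreath_map_first[OF 2(3)]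
    by (simp add: first_tuple_def)
  ultimately have "p * v = p * v'" by (rule zeta_pow_inj)
  then have "v = v'" using p_pos by simp
  have tev: "t i / t (transpose 0 j i) * (-1) ^ d = t' i / t' (transpose 0 j i) * (-1) ^ d'"
    if "0 < j" "j < n" "i < n" for i j
    using arg_cong[OF ev[OF star_mem[OF that(2)]], of "\<lambda>g. fst g i"] that by (simp add: wreath_map_star)
  have "d = d'"
  proof (cases "3 \<le> n")
    case True
    then have "((-1) ^ d :: complex) = (-1) ^ d'"
      using tev[of 1 2] full_torusD(2)[OF 1(3), of 2] full_torusD(2)[OF 2(3), of 2] by simp
    then show ?thesis using 1(5) 2(5) by auto
  qed (use 1 2 in auto)
  have "t i = t' i" for i
  proof (cases "0 < i \<and> i < n")
    case True
    then show ?thesis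
      using tev[of i i] \<open>d = d'\<close> 1(4) 2(4) by simp
  next
    case False
    then show ?thesis
      using full_torusD(3)[OF 1(3), of i] full_torusD(3)[OF 2(3), of i] 1(4) 2(4) by (cases "i = 0") auto
  qed
  then show "a = a'"
    using \<open>k = k'\<close> \<open>v = v'\<close> \<open>d = d'\<close> by (auto simp: a1 a2)
qed

lemma param_map_in: "a \<in> kernel_params \<Longrightarrow> param_map a \<in> kernel_auts"
  using wreath_map_auto by (auto simp: kernel_params_def)

end

section \<open>Recovering the parameters of an automorphism over the identity\<close>

locale rpn_kernel = rpn +
  fixes \<alpha>
  assumes \<alpha>: "\<alpha> \<in> kernel_auts"
begin

text \<open>The two halves of the automorphism: an equivariant automorphism of the diagonal
  subgroup, and the cocycle by which permutations are displaced.\<close>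

definition "\<beta> x = fst (\<alpha> (x, id))"
definition "\<gamma> w = fst (\<alpha> (\<lambda>_. 1, w))"

lemma auto: "\<alpha> \<in> auto WG" and snd_eq: "g \<in> carrier WG \<Longrightarrow> snd (\<alpha> g) = snd g"
  using \<alpha> by (auto simp: kernel_auts_def)

lemma \<alpha>_torus: "x \<in> N \<Longrightarrow> \<alpha> (x, id) = (\<beta> x, id)"
  using snd_eq[OF torus_mem] by (metis \<beta>_def prod.collapse snd_conv)

lemma \<alpha>_perm: "w permutes {..<n} \<Longrightarrow> \<alpha> (\<lambda>_. 1, w) = (\<gamma> w, w)"
  using snd_eq[OF perm_mem] by (metis \<gamma>_def prod.collapse snd_conv)

lemma \<beta>_torus: "x \<in> N \<Longrightarrow> \<beta> x \<in> N"
  using auto_closed[OF auto torus_mem] \<alpha>_torus by (simp add: wreath_carrier)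

lemma \<gamma>_torus: "w permutes {..<n} \<Longrightarrow> \<gamma> w \<in> N"
  using auto_closed[OF auto perm_mem] \<alpha>_perm by (simp add: wreath_carrier)

lemma \<beta>_mult: "x \<in> N \<Longrightarrow> y \<in> N \<Longrightarrow> \<beta> (\<lambda>i. x i * y i) = (\<lambda>i. \<beta> x i * \<beta> y i)"
  using auto_mult[OF auto torus_mem torus_mem, of x y] \<alpha>_torus[of x] \<alpha>_torus[of y]
    \<alpha>_torus[OF torus_mult, of x y] by (simp add: wreath_mult)

lemma \<gamma>_mult:
  "v permutes {..<n} \<Longrightarrow> w permutes {..<n} \<Longrightarrow> \<gamma> (v \<circ> w) = (\<lambda>i. \<gamma> w i * \<gamma> v (w i))"
  using auto_mult[OF auto perm_mem perm_mem, of w v] \<alpha>_perm[of v] \<alpha>_perm[of w]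
    \<alpha>_perm[OF permutes_compose, of w v] by (simp add: wreath_mult)

lemma \<beta>_perm:
  assumes "x \<in> N" "w permutes {..<n}" shows "\<beta> (\<lambda>i. x (w i)) = (\<lambda>i. \<beta> x (w i))"
proof -
  have "(\<lambda>i. x (w i), id) \<otimes>\<^bsub>WG\<^esub> (\<lambda>_. 1, w) = (\<lambda>_. 1, w) \<otimes>\<^bsub>WG\<^esub> (x, id)"
    by (simp add: wreath_mult)
  then have "\<alpha> (\<lambda>i. x (w i), id) \<otimes>\<^bsub>WG\<^esub> \<alpha> (\<lambda>_. 1, w) = \<alpha> (\<lambda>_. 1, w) \<otimes>\<^bsub>WG\<^esub> \<alpha> (x, id)"
    using assms by (simp add: torus_mem perm_mem torus_permute flip: auto_mult[OF auto])
  then have "\<beta> (\<lambda>i. x (w i)) i * \<gamma> w i = \<gamma> w i * \<beta> x (w i)" for i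
    using assms by (simp add: \<alpha>_torus \<alpha>_perm torus_permute wreath_mult fun_eq_iff)
  then show ?thesis
    using torus_nz[OF \<gamma>_torus[OF assms(2)]] by (auto simp: mult.commute)
qed

lemma \<beta>_one: "\<beta> (\<lambda>_. 1) = (\<lambda>_. 1)"
  using auto_one[OF group_wreath auto] by (simp add: \<beta>_def wreath_one)

lemma \<gamma>_id: "\<gamma> id = (\<lambda>_. 1)"
  using auto_one[OF group_wreath auto] by (simp add: \<gamma>_def wreath_one)

lemma torus_power: "x \<in> N \<Longrightarrow> (\<lambda>i. x i ^ k) \<in> N"
  by (induction k) (auto simp: torus_one torus_mult)

lemma \<beta>_power: "x \<in> N \<Longrightarrow> \<beta> (\<lambda>i. x i ^ k) = (\<lambda>i. \<beta> x i ^ k)"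
  by (induction k) (auto simp: \<beta>_one \<beta>_mult torus_power)

lemma \<beta>_surj:
  assumes "y \<in> N" obtains x where "x \<in> N" "\<beta> x = y"
proof -
  obtain g where g: "g \<in> carrier WG" "\<alpha> g = (y, id)"
    using auto_image[OF auto] torus_mem[OF assms] by (metis imageE)
  then have "g = (fst g, id)" "fst g \<in> N"
    using snd_eq[OF g(1)] by (cases g; auto simp: wreath_carrier)+
  then show thesis using that g by (metis \<beta>_def fst_conv)
qed

lemma \<beta>_inj: "x \<in> N \<Longrightarrow> y \<in> N \<Longrightarrow> \<beta> x = \<beta> y \<Longrightarrow> x = y"
  using inj_onD[OF auto_inj[OF auto] _ torus_mem torus_mem, of x y] \<alpha>_torus by auto

end

context rpn_kernel
begin

abbreviation "\<eta> \<equiv> \<beta> (root_tuple r 1 0)"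

lemma root_tuple_permute:
  assumes "w permutes {..<n}" "w a = 1" "w b = 0"
  shows "root_tuple r a b = (\<lambda>i. root_tuple r 1 0 (w i))"
proof
  fix i
  have "w i = w a \<longleftrightarrow> i = a" "w i = w b \<longleftrightarrow> i = b"
    using permutes_inj[OF assms(1)] by (auto dest: injD)
  then show "root_tuple r a b i = root_tuple r 1 0 (w i)"
    using assms by (simp add: root_tuple_def)
qed

lemma one_zero_in_torus: "root_tuple r 1 0 \<in> N"
  using n_gt by (intro root_tuple_in_torus) auto

lemma \<beta>_root:
  assumes "w permutes {..<n}" "w a = 1" "w b = 0" shows "\<beta> (root_tuple r a b) = (\<lambda>i. \<eta> (w i))"
  unfolding root_tuple_permute[OF assms] by (rule \<beta>_perm[OF one_zero_in_torus assms(1)])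

text \<open>The root tuple on (0, 1) is both the inverse of the one on (1, 0) and its transform
  under the swap of 0 and 1; equivariance compares the two descriptions.\<close>

lemma \<eta>_zero_one: "\<eta> 0 * \<eta> 1 = 1"
proof -
  have w: "transpose 0 1 permutes {..<n}" using n_gt by (intro permutes_swap_id) auto
  have "\<beta> (\<lambda>i. root_tuple r 0 1 i * root_tuple r 1 0 i) 0 = \<eta> 1 * \<eta> 0"
    using \<beta>_root[OF w, of 0 1] root_tuple_in_torus[of 0 1] one_zero_in_torus n_gt by (simp add: \<beta>_mult)
  moreover have "(\<lambda>i. root_tuple r 0 1 i * root_tuple r 1 0 i) = (\<lambda>_. 1)"
    by (auto simp: root_tuple_def)
  ultimately show ?thesis by (simp add: \<beta>_one mult.commute)
qed

text \<open>Equivariance alone shows only that the entries beyond 1 agree with each other. The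
  relation root(i,0) root(0,1) = root(i,1), read at entry 0 after applying \<beta>, gives \<eta> i =
  \<eta> 0 \<eta> 1 = 1.\<close>

lemma \<eta>_other:
  assumes "2 \<le> i" shows "\<eta> i = 1"
proof (cases "i < n")
  case True
  have w1: "transpose 1 i permutes {..<n}" "transpose 0 1 permutes {..<n}" "transpose 0 i permutes {..<n}"
    using True n_gt by (auto intro: permutes_swap_id)
  then have w3: "transpose 0 1 \<circ> transpose 0 i permutes {..<n}" by (intro permutes_compose)
  have 1: "\<beta> (root_tuple r i 0) = (\<lambda>j. \<eta> (transpose 1 i j))"
    using assms by (intro \<beta>_root w1) (auto simp: transpose_def)
  have 2: "\<beta> (root_tuple r 0 1) = (\<lambda>j. \<eta> (transpose 0 1 j))"
    using assms by (intro \<beta>_root w1) (auto simp: transpose_def)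
  have 3: "\<beta> (root_tuple r i 1) = (\<lambda>j. \<eta> ((transpose 0 1 \<circ> transpose 0 i) j))"
    using assms by (intro \<beta>_root w3) (auto simp: transpose_def)
  have "(\<lambda>j. root_tuple r i 0 j * root_tuple r 0 1 j) = root_tuple r i 1"
    using assms by (auto simp: root_tuple_def fun_eq_iff)
  then have "\<beta> (root_tuple r i 1) = (\<lambda>j. \<beta> (root_tuple r i 0) j * \<beta> (root_tuple r 0 1) j)"
    using \<beta>_mult[of "root_tuple r i 0" "root_tuple r 0 1"] True assms n_gt
    by (simp add: root_tuple_in_torus)
  then have "\<eta> ((transpose 0 1 \<circ> transpose 0 i) 0) = \<eta> (transpose 1 i 0) * \<eta> (transpose 0 1 0)"
    unfolding 1 2 3 by (rule fun_cong)
  then show ?thesis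
    using assms \<eta>_zero_one by (simp add: transpose_def)
next
  case False
  then show ?thesis using torus_out[OF \<beta>_torus[OF one_zero_in_torus]] by simp
qed

lemma \<beta>_star_root:
  assumes k: "\<eta> 1 = zeta r ^ k" and j: "0 < j" "j < n"
  shows "\<beta> (root_tuple r j 0) = (\<lambda>i. root_tuple r j 0 i ^ k)"
proof -
  have w: "transpose 1 j permutes {..<n}" using j n_gt by (intro permutes_swap_id) auto
  have \<eta>0: "\<eta> 0 = inverse (zeta r) ^ k"
    using \<eta>_zero_one k by (simp add: power_inverse) (metis inverse_unique mult.commute)
  have "\<eta> (transpose 1 j i) = root_tuple r j 0 i ^ k" for i
  proof -
    consider "i = j" | "i = 0" | "i \<noteq> j" "i \<noteq> 0" by blast
    then show ?thesis
    proof cases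
      case 1
      then show ?thesis using k j by (simp add: root_tuple_def)
    next
      case 2
      then show ?thesis using \<eta>0 j by (simp add: root_tuple_def transpose_def)
    next
      case 3
      then have "transpose 1 j i \<ge> 2" using j by (auto simp: transpose_def)
      then show ?thesis using \<eta>_other 3 by (simp add: root_tuple_def)
    qed
  qed
  then show ?thesis
    using \<beta>_root[OF w, of j 0] j by (simp add: transpose_def)
qed

text \<open>Invariance under the permutations fixing 0 makes the entries of the image away from 0
  equal, and their common value is an m-th root of unity because \<open>first_tuple\<close> has
  exponent m.\<close>

lemma \<beta>_first:
  assumes k: "\<eta> 1 = zeta r ^ k"
  obtains v where "v < m"
    "\<beta> first_tuple = (\<lambda>i. if i < n then first_tuple i ^ k * zeta r ^ (p * v) else 1)"
proof -
  let ?z = "\<beta> first_tuple"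
  have z: "?z \<in> N" by (rule \<beta>_torus[OF first_tuple_in_torus])
  have const: "?z i = ?z 1" if "0 < i" "i < n" for i
  proof -
    have w: "transpose 1 i permutes {..<n}" using that n_gt by (intro permutes_swap_id) auto
    have "(\<lambda>j. first_tuple (transpose 1 i j)) = first_tuple"
      using that by (auto simp: first_tuple_def transpose_def fun_eq_iff)
    then have "?z = (\<lambda>j. ?z (transpose 1 i j))"
      using \<beta>_perm[OF first_tuple_in_torus w] by simp
    from fun_cong[OF this, of i] show ?thesis by simp
  qed
  have w: "transpose 0 1 permutes {..<n}" using n_gt by (intro permutes_swap_id) auto
  have r01: "root_tuple r 0 1 \<in> N" using n_gt by (intro root_tuple_in_torus) auto
  \<comment> \<open>Moving the entry zeta^p from position 1 to position 0 costs the p-th power of a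
    root tuple, on which \<beta> is already known; this determines entry 0 of the image.\<close>
  have "first_tuple = (\<lambda>i. first_tuple (transpose 0 1 i) * root_tuple r 0 1 i ^ p)"
    by (auto simp: first_tuple_def root_tuple_def transpose_def fun_eq_iff power_inverse)
  then have "?z = \<beta> (\<lambda>i. first_tuple (transpose 0 1 i) * root_tuple r 0 1 i ^ p)"
    by (rule arg_cong)
  also have "\<dots> = (\<lambda>i. ?z (transpose 0 1 i) * \<beta> (root_tuple r 0 1) i ^ p)"
    using \<beta>_mult[OF torus_permute[OF first_tuple_in_torus w] torus_power[OF r01]]
      \<beta>_perm[OF first_tuple_in_torus w] \<beta>_power[OF r01] by simp
  finally have "?z = (\<lambda>i. ?z (transpose 0 1 i) * \<beta> (root_tuple r 0 1) i ^ p)" .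
  from fun_cong[OF this, of 0] have z0: "?z 0 = ?z 1 * (zeta r ^ k) ^ p"
    using \<beta>_root[OF w, of 0 1] k by simp
  have "(\<lambda>i. first_tuple i ^ m) = (\<lambda>_. 1)"
    using zeta_pm by (auto simp: first_tuple_def)
  then have "(\<lambda>i. ?z i ^ m) = (\<lambda>_. 1)"
    using \<beta>_power[OF first_tuple_in_torus, of m] \<beta>_one by simp
  then have "?z 1 ^ m = 1" by (rule fun_cong)
  then obtain v where v: "v < m" "?z 1 = zeta r ^ (p * v)"
    by (rule m_root_eq_zeta_pow)
  have "?z i = (if i < n then first_tuple i ^ k * zeta r ^ (p * v) else 1)" for i
  proof -
    consider "i = 0" | "0 < i" "i < n" | "n \<le> i" "i \<noteq> 0" using n_gt by linarith
    then show ?thesis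
    proof cases
      case 1
      then show ?thesis
        using z0 v n_gt by (simp add: first_tuple_def power_mult[symmetric] mult.commute)
    next
      case 2
      then have "first_tuple i = 1" by (simp add: first_tuple_def)
      then show ?thesis using const[OF 2] v(2) 2 by simp
    next
      case 3
      then show ?thesis using torus_out[OF z] by simp
    qed
  qed
  then show thesis using that v(1) by blast
qed

lemma \<beta>_eq:
  assumes k: "\<eta> 1 = zeta r ^ k"
    and v: "\<beta> first_tuple = (\<lambda>i. if i < n then first_tuple i ^ k * zeta r ^ (p * v) else 1)"
    and x: "x \<in> N"
  shows "\<beta> x = (\<lambda>i. if i < n then x i ^ k * (\<Prod>j<n. x j) ^ v else 1)"
proof -
  let ?b = "\<lambda>x i. if i < n then x i ^ k * (\<Prod>j<n. x j) ^ v else (1::complex)"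
  have "x \<in> {x \<in> N. \<beta> x = ?b x}"
  proof (rule torus_gen[OF x])
    fix y z assume "y \<in> {x \<in> N. \<beta> x = ?b x}" "z \<in> {x \<in> N. \<beta> x = ?b x}"
    then show "(\<lambda>i. y i * z i) \<in> {x \<in> N. \<beta> x = ?b x}"
      by (auto simp: \<beta>_mult torus_mult prod.distrib power_mult_distrib fun_eq_iff)
  next
    fix j assume j: "0 < j" "j < n"
    then show "root_tuple r j 0 \<in> {x \<in> N. \<beta> x = ?b x}"
      using \<beta>_star_root[OF k j] prod_root_tuple[of j 0] root_tuple_in_torus[of j 0]
      by (auto simp: fun_eq_iff root_tuple_def)
  next
    show "first_tuple \<in> {x \<in> N. \<beta> x = ?b x}"
      using v first_tuple_in_torus by (simp add: prod_first_tuple power_mult cong: if_cong)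
  qed (auto simp: \<beta>_one torus_one fun_eq_iff)
  then show ?thesis by simp
qed

text \<open>With g = gcd(k, r), the power r/g of a root tuple is killed by \<beta>, so injectivity
  forces g = 1.\<close>

lemma coprime_k:
  assumes k: "\<eta> 1 = zeta r ^ k" shows "coprime k r"
proof -
  let ?g = "gcd k r"
  let ?a = "r div ?g"
  have g: "?g * ?a = r" by simp
  have "k * ?a = r * (k div ?g)"
    by (metis dvd_div_mult dvd_mult_div_cancel gcd_dvd1 gcd_dvd2 mult.commute mult.left_commute div_mult_swap)
  then have ka: "zeta r ^ (k * ?a) = 1" using zeta_pow_eq_one_iff[OF r_pos] by simp
  have "\<beta> (\<lambda>i. root_tuple r 1 0 i ^ ?a) = (\<lambda>i. (root_tuple r 1 0 i ^ k) ^ ?a)"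
    using \<beta>_power[OF one_zero_in_torus] \<beta>_star_root[OF k, of 1] n_gt by simp
  also have "\<dots> = (\<lambda>_. 1)"
    using ka by (auto simp: root_tuple_def fun_eq_iff power_inverse power_mult)
  also have "\<dots> = \<beta> (\<lambda>_. 1)" by (simp add: \<beta>_one)
  finally have "(\<lambda>i. root_tuple r 1 0 i ^ ?a) = (\<lambda>_. 1)"
    by (rule \<beta>_inj[OF torus_power[OF one_zero_in_torus] torus_one])
  from fun_cong[OF this, of 1] have "zeta r ^ ?a = 1" by (simp add: root_tuple_def)
  then have "r dvd ?a" using zeta_pow_eq_one_iff[OF r_pos] by simp
  moreover have "?a > 0" using g r_pos by (metis gr0I mult_0_right)
  ultimately have "r \<le> ?a" by (rule dvd_imp_le)
  then have "?g \<le> 1" using g \<open>?a > 0\<close>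
    by (metis mult_le_cancel2 mult_1 le_trans order_refl)
  then show ?thesis
    using r_pos by (simp add: coprime_iff_gcd_eq_1 le_Suc_eq)
qed

text \<open>The product of the entries of \<beta> x is the (k + n v)-th power of that of x. By
  surjectivity it takes the value zeta^p of exact order m, so k + n v is prime to
  \<open>m\<close>.\<close>

lemma coprime_kv:
  assumes k: "\<eta> 1 = zeta r ^ k"
    and v: "\<beta> first_tuple = (\<lambda>i. if i < n then first_tuple i ^ k * zeta r ^ (p * v) else 1)"
  shows "coprime (k + n * v) m"
proof -
  let ?s = "k + n * v"
  let ?g = "gcd ?s m"
  let ?a = "m div ?g"
  have g: "?g * ?a = m" by simp
  obtain x where x: "x \<in> N" "\<beta> x = first_tuple"
    using \<beta>_surj[OF first_tuple_in_torus] .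
  obtain b where b: "(\<Prod>i<n. x i) = zeta r ^ (p * b)"
    using m_root_eq_zeta_pow[OF torus_prod[OF x(1)]] by metis
  have "zeta r ^ p = (\<Prod>i<n. \<beta> x i)"
    using x(2) prod_first_tuple by simp
  also have "\<dots> = (\<Prod>i<n. x i ^ k * (\<Prod>j<n. x j) ^ v)"
    unfolding \<beta>_eq[OF k v x(1)] by (intro prod.cong) auto
  also have "\<dots> = (\<Prod>i<n. x i) ^ ?s"
    by (simp add: prod.distrib prod_power_distrib[symmetric] power_add power_mult[symmetric] mult.commute)
  finally have e: "zeta r ^ p = zeta r ^ (p * b * ?s)"
    unfolding b by (simp add: power_mult)
  have "?s * ?a = m * (?s div ?g)"
    by (metis div_mult_swap dvd_div_mult gcd_dvd1 gcd_dvd2 mult.commute)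
  then have "p * b * ?s * ?a = r * (b * (?s div ?g))"
    by (subst r_eq) (simp only: mult.assoc mult.left_commute)
  then have "zeta r ^ (p * b * ?s * ?a) = 1"
    using zeta_pow_eq_one_iff[OF r_pos] by (metis dvd_triv_left)
  then have "zeta r ^ (p * ?a) = 1"
    using e by (metis power_mult)
  then have "p * m dvd p * ?a" using zeta_pow_eq_one_iff[OF r_pos] r_eq by metis
  then have "m dvd ?a" using p_pos by simp
  moreover have "?a > 0" using g m_pos by (metis gr0I mult_0_right)
  ultimately have "m \<le> ?a" by (rule dvd_imp_le)
  then have "?g \<le> 1" using g \<open>?a > 0\<close>
    by (metis mult_le_cancel2 mult_1 le_trans order_refl)
  then show ?thesis
    using m_pos by (simp add: coprime_iff_gcd_eq_1 le_Suc_eq)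
qed

abbreviation "\<sigma> j \<equiv> \<gamma> (transpose 0 j)"

lemma transpose_permutes: "a < n \<Longrightarrow> b < n \<Longrightarrow> transpose a b permutes {..<n}"
  by (intro permutes_swap_id) auto

lemma \<gamma>_nz: "a < n \<Longrightarrow> b < n \<Longrightarrow> \<gamma> (transpose a b) i \<noteq> 0"
  using torus_nz[OF \<gamma>_torus[OF transpose_permutes]] .

lemma \<gamma>_invol: "a < n \<Longrightarrow> b < n \<Longrightarrow> \<gamma> (transpose a b) i * \<gamma> (transpose a b) (transpose a b i) = 1"
  using \<gamma>_mult[OF transpose_permutes transpose_permutes, of a b a b] \<gamma>_id by (simp add: fun_eq_iff)

lemma \<sigma>_pair: "0 < j \<Longrightarrow> j < n \<Longrightarrow> \<sigma> j 0 * \<sigma> j j = 1"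
  using \<gamma>_invol[of 0 j 0] by simp

text \<open>The transpositions (i l) and (0 j) commute; the cocycle identity for the two orders of
  composition, read at i, gives the equality.\<close>

lemma \<sigma>_fixed:
  assumes "0 < j" "j < n" "i < n" "l < n" "i \<noteq> 0" "i \<noteq> j" "l \<noteq> 0" "l \<noteq> j"
  shows "\<sigma> j i = \<sigma> j l"
proof (cases "i = l")
  case False
  let ?u = "transpose i l" and ?w = "transpose 0 j"
  have "?u \<circ> ?w = ?w \<circ> ?u"
    using assms by (intro transpose_disjoint_commute) auto
  then have "\<gamma> (?u \<circ> ?w) i = \<gamma> (?w \<circ> ?u) i" by simp
  then have "\<sigma> j i * \<gamma> ?u (?w i) = \<gamma> ?u i * \<sigma> j (?u i)"
    using assms n_gt by (simp add: \<gamma>_mult transpose_permutes)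
  then show ?thesis
    using assms \<gamma>_nz[of i l i] by (simp add: transpose_def)
qed simp

text \<open>Expands the cocycle along (0 j) = (i j)(0 i)(i j); the two values at (i j) cancel
  because (i j) is an involution.\<close>

lemma \<sigma>_swap:
  assumes "0 < j" "j < n" "0 < i" "i < n" "i \<noteq> j"
  shows "\<sigma> j i = \<sigma> i j"
proof -
  let ?u = "transpose i j" and ?w = "transpose 0 i"
  have e: "transpose 0 j = ?u \<circ> (?w \<circ> ?u)"
    using assms by (auto simp: transpose_def fun_eq_iff)
  have P: "?w \<circ> ?u permutes {..<n}" using assms n_gt by (intro permutes_compose transpose_permutes) auto
  have "\<sigma> j i = \<gamma> (?w \<circ> ?u) i * \<gamma> ?u ((?w \<circ> ?u) i)"
    unfolding e using \<gamma>_mult[OF transpose_permutes P] assms by simp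
  also have "\<gamma> (?w \<circ> ?u) i = \<gamma> ?u i * \<sigma> i j"
    using \<gamma>_mult[OF transpose_permutes transpose_permutes, of 0 i i j] assms n_gt by simp
  also have "(?w \<circ> ?u) i = j" using assms by (simp add: transpose_def)
  also have "\<gamma> ?u i * \<sigma> i j * \<gamma> ?u j = \<sigma> i j"
    using \<gamma>_invol[of i j i] assms by (simp add: mult.commute mult.left_commute)
  finally show ?thesis .
qed

text \<open>The previous two lemmas connect all the entries of star images away from the moved
  points, so they have one common value. That value becomes the sign twist.\<close>

lemma \<sigma>_sign:
  assumes "3 \<le> n" "0 < j" "j < n" "0 < i" "i < n" "i \<noteq> j"
  shows "\<sigma> j i = \<sigma> 1 2"
proof (cases "j = 1")
  case True
  then show ?thesis using \<sigma>_fixed[of 1 i 2] assms by simp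
next
  case j1: False
  show ?thesis
  proof (cases "i = 1")
    case True
    then have "\<sigma> j i = \<sigma> 1 j" using \<sigma>_swap[of j 1] assms by simp
    also have "\<dots> = \<sigma> 1 2" using \<sigma>_fixed[of 1 j 2] assms j1 by simp
    finally show ?thesis .
  next
    case False
    then have "\<sigma> j i = \<sigma> j 1" using \<sigma>_fixed[of j i 1] assms j1 by simp
    also have "\<dots> = \<sigma> 1 j" using \<sigma>_swap[of j 1] assms j1 by simp
    also have "\<dots> = \<sigma> 1 2" using \<sigma>_fixed[of 1 j 2] assms j1 by simp
    finally show ?thesis .
  qed
qed

text \<open>The common value away from the moved points squares to 1, which gives \<open>d\<close>;
  the two entries on the support of (0 j) are inverse to each other, which leaves one free value and
  gives \<open>t j\<close>. So the cocycle is a coboundary times a power of the sign. For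
  \<open>n = 2\<close> there is no third point and \<open>d\<close> is 0.\<close>

lemma \<sigma>_params:
  obtains t d where "t \<in> torus r (Suc 0) n" "t 0 = 1"
    "d = 0 \<or> d = Suc 0 \<and> 3 \<le> n \<and> even r \<and> even (n * m)"
    "\<And>j. 0 < j \<Longrightarrow> j < n \<Longrightarrow>
      \<sigma> j = (\<lambda>i. if i < n then t i / t (transpose 0 j i) * (-1) ^ d else 1)"
proof -
  define d :: nat where "d = (if 3 \<le> n \<and> \<sigma> 1 2 = -1 then 1 else 0)"
  define s :: complex where "s = (-1) ^ d"
  have ss: "s * s = 1" by (simp add: s_def flip: power_mult_distrib)
  have s12: "\<sigma> 1 2 = s" if "3 \<le> n"
  proof -
    have "\<sigma> 1 2 * \<sigma> 1 2 = 1" using \<gamma>_invol[of 0 1 2] that by (simp add: transpose_def)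
    then have "\<sigma> 1 2 = 1 \<or> \<sigma> 1 2 = -1" by (simp add: square_eq_1_iff)
    then show ?thesis using that by (auto simp: s_def d_def)
  qed
  have \<sigma>N: "\<sigma> j \<in> N" if "j < n" for j using that n_gt by (intro \<gamma>_torus transpose_permutes) auto
  have d: "d = 0 \<or> d = Suc 0 \<and> 3 \<le> n \<and> even r \<and> even (n * m)"
  proof (cases "3 \<le> n \<and> \<sigma> 1 2 = -1")
    case True
    have "even r" using torus_pow[OF \<sigma>N[of 1], of 2] True n_gt
      by (simp add: minus_one_power_iff split: if_splits)
    \<comment> \<open>The entries at 0 and 1 have product 1 and the others are -1, so the product
      condition on the image of (0 1) reads (-1)^((n-2) m) = 1.\<close>
    moreover have "even (n * m)"
    proof -
      have s1: "{..<n} = insert 0 (insert 1 {2..<n})" using True by auto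
      have "(\<Prod>i\<in>{2..<n}. \<sigma> 1 i) = (\<Prod>i\<in>{2..<n}. -1)"
        using \<sigma>_sign[of 1] True by (intro prod.cong) auto
      then have "(\<Prod>i<n. \<sigma> 1 i) = \<sigma> 1 0 * (\<sigma> 1 1 * (-1) ^ (n - 2))"
        unfolding s1 by simp
      then have "(\<Prod>i<n. \<sigma> 1 i) = (-1) ^ (n - 2)"
        using \<sigma>_pair[of 1] n_gt by simp
      then have "(-1 :: complex) ^ ((n - 2) * m) = 1"
        using torus_prod[OF \<sigma>N[of 1]] n_gt by (simp add: power_mult)
      then have "even ((n - 2) * m)"
        by (simp add: minus_one_power_iff split: if_splits)
      then show ?thesis using True by auto
    qed
    ultimately show ?thesis using True by (simp add: d_def)
  qed (auto simp: d_def)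
  have sr: "s ^ r = 1" using d by (auto simp: s_def minus_one_power_iff)
  \<comment> \<open>The factor \<open>s\<close> compensates the twist, which also acts at the moved
    position.\<close>
  define t where "t = (\<lambda>i. if 0 < i \<and> i < n then \<sigma> i i * s else 1)"
  have t0: "t 0 = 1" by (simp add: t_def)
  have tT: "t \<in> torus r (Suc 0) n"
    using torus_pow[OF \<sigma>N] sr by (intro full_torusI) (auto simp: t_def power_mult_distrib)
  have "\<sigma> j i = (if i < n then t i / t (transpose 0 j i) * (-1) ^ d else 1)" if j: "0 < j" "j < n" for i j
  proof -
    consider "i = 0" | "i = j" | "0 < i" "i < n" "i \<noteq> j" | "n \<le> i" using n_gt by linarith
    then show ?thesis
    proof cases
      case 1
      have "s \<noteq> 0" using ss by auto
      moreover have "\<sigma> j 0 = 1 / \<sigma> j j"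
        using \<sigma>_pair[OF j] \<gamma>_nz[of 0 j j] j n_gt by (simp add: eq_divide_eq)
      ultimately have "\<sigma> j 0 = 1 / (\<sigma> j j * s) * s" by simp
      then show ?thesis using 1 j n_gt by (simp add: t_def s_def)
    next
      case 2
      then show ?thesis using j ss by (simp add: t_def s_def[symmetric] mult.assoc)
    next
      case 3
      then have "3 \<le> n" using j by linarith
      then have "\<sigma> j i = s" using \<sigma>_sign[of j i] 3 j s12 by simp
      moreover have "t i \<noteq> 0" by (rule full_torusD(2)[OF tT])
      ultimately show ?thesis using 3 by (simp add: s_def)
    next
      case 4
      then show ?thesis using torus_out[OF \<sigma>N[OF j(2)]] by simp
    qed
  qed
  then show thesis using that[OF tT t0 d] by blast
qed

lemma in_param_image: "\<alpha> \<in> param_map ` kernel_params"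
proof -
  have "\<eta> 1 ^ r = 1" by (rule torus_pow[OF \<beta>_torus[OF one_zero_in_torus]])
  then obtain k where k: "k < r" "\<eta> 1 = zeta r ^ k"
    using root_unity_eq_zeta_pow[OF r_pos] by metis
  obtain v where v: "v < m"
    "\<beta> first_tuple = (\<lambda>i. if i < n then first_tuple i ^ k * zeta r ^ (p * v) else 1)"
    using \<beta>_first[OF k(2)] .
  obtain t d where td: "t \<in> torus r (Suc 0) n" "t 0 = 1"
    "d = 0 \<or> d = Suc 0 \<and> 3 \<le> n \<and> even r \<and> even (n * m)"
    and \<sigma>: "\<And>j. 0 < j \<Longrightarrow> j < n \<Longrightarrow>
      \<sigma> j = (\<lambda>i. if i < n then t i / t (transpose 0 j i) * (-1) ^ d else 1)"
    by (rule \<sigma>_params) blast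
  have par: "((k, v), t, d) \<in> kernel_params"
    using k v td coprime_k coprime_kv by (auto simp: kernel_params_def)
  have wm: "restrict (wreath_map n k v t d) (carrier WG) \<in> auto WG"
    using param_map_in[OF par] by (simp add: kernel_auts_def)
  have "\<alpha> = restrict (wreath_map n k v t d) (carrier WG)"
  proof (rule auto_ext[OF auto wm])
    fix g assume g: "g \<in> carrier WG"
    have "g \<in> {g \<in> carrier WG. \<alpha> g = wreath_map n k v t d g}"
    proof (rule wreath_gen[OF g])
      fix g h assume "g \<in> {g \<in> carrier WG. \<alpha> g = wreath_map n k v t d g}"
        "h \<in> {g \<in> carrier WG. \<alpha> g = wreath_map n k v t d g}"
      then show "g \<otimes>\<^bsub>WG\<^esub> h \<in> {g \<in> carrier WG. \<alpha> g = wreath_map n k v t d g}"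
        using auto_mult[OF auto] wreath_map_mult[OF td(1)] by simp
    next
      fix j assume j: "0 < j" "j < n"
      show "(root_tuple r j 0, id) \<in> {g \<in> carrier WG. \<alpha> g = wreath_map n k v t d g}"
        using root_mem[OF j] wreath_map_root[OF j td(1)] \<beta>_star_root[OF k(2) j]
          \<alpha>_torus[OF root_tuple_in_torus[of j 0]] j by simp
      show "(\<lambda>_. 1, transpose 0 j) \<in> {g \<in> carrier WG. \<alpha> g = wreath_map n k v t d g}"
        using star_mem[OF j(2)] wreath_map_star[OF j] \<sigma>[OF j] \<alpha>_perm[OF transpose_permutes[of 0 j]] j n_gt by simp
    next
      show "(first_tuple, id) \<in> {g \<in> carrier WG. \<alpha> g = wreath_map n k v t d g}"
        using first_mem wreath_map_first[OF td(1)] \<alpha>_torus[OF first_tuple_in_torus] v(2) by simp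
    qed
    then show "\<alpha> g = restrict (wreath_map n k v t d) (carrier WG) g" using g by simp
  qed
  then show ?thesis using par by (intro image_eqI[of _ _ "((k, v), t, d)"]) auto
qed

end

context rpn
begin

lemma card_kernel_auts: "card kernel_auts = card kernel_params"
proof -
  have "param_map ` kernel_params = kernel_auts"
  proof (intro equalityI subsetI)
    fix \<alpha> assume "\<alpha> \<in> kernel_auts"
    then interpret rpn_kernel r p n \<alpha> by unfold_locales
    show "\<alpha> \<in> param_map ` kernel_params" by (rule in_param_image)
  qed (use param_map_in in blast)
  then show ?thesis using card_image[OF param_map_inj] by simp
qed

end

section \<open>The stabiliser of the diagonal subgroup\<close>

context rpn
begin

abbreviation "NG \<equiv> (\<lambda>x. (x, id :: nat \<Rightarrow> nat)) ` N"

text \<open>Conjugation by the permutation matrix of the inverse of \<open>u\<close>, in keeping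
  with the reversed order of composition in the model.\<close>

definition perm_conj :: "(nat \<Rightarrow> nat) \<Rightarrow> (nat \<Rightarrow> complex) \<times> (nat \<Rightarrow> nat) \<Rightarrow> (nat \<Rightarrow> complex) \<times> (nat \<Rightarrow> nat)" where
  "perm_conj u = (\<lambda>(x, w). (\<lambda>i. x (inv_into UNIV u i), u \<circ> w \<circ> inv_into UNIV u))"

lemma NG_sub: "NG \<subseteq> carrier WG"
  using torus_mem by auto

lemma mem_NG_iff: "g \<in> NG \<longleftrightarrow> g \<in> carrier WG \<and> snd g = id"
  using permutes_id by (cases g) (auto simp: wreath_carrier)

lemma card_NG: "card NG = card N"
  by (rule card_image) (auto intro: inj_onI)

lemma snd_permutes: "g \<in> carrier WG \<Longrightarrow> snd g permutes {..<n}"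
  by (cases g) (simp add: wreath_carrier)

lemma snd_wreath_inv: "g \<in> carrier WG \<Longrightarrow> snd (inv\<^bsub>WG\<^esub> g) = inv_into UNIV (snd g)"
  by (cases g) (simp add: wreath_inv wreath_carrier)

lemma perm_conj_mem:
  assumes "u permutes {..<n}" "g \<in> carrier WG" shows "perm_conj u g \<in> carrier WG"
  using assms inv_perm[OF assms(1)]
  by (cases g) (auto simp: perm_conj_def wreath_carrier torus_permute intro!: permutes_compose)

lemma perm_conj_mult:
  assumes "u permutes {..<n}"
  shows "perm_conj u (g \<otimes>\<^bsub>WG\<^esub> h) = perm_conj u g \<otimes>\<^bsub>WG\<^esub> perm_conj u h"
  using permutes_inverses(2)[OF assms]
  by (cases g; cases h) (auto simp: perm_conj_def wreath_mult fun_eq_iff)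

lemma perm_conj_inverse:
  assumes "u permutes {..<n}"
  shows "perm_conj u (perm_conj (inv_into UNIV u) g) = g"
  using permutes_inverses[OF assms] permutes_inv_inv[OF assms]
  by (cases g) (auto simp: perm_conj_def fun_eq_iff)

lemma snd_perm_conj: "snd (perm_conj u g) = u \<circ> snd g \<circ> inv_into UNIV u"
  by (cases g) (simp add: perm_conj_def)

lemma perm_conj_eq:
  assumes "u permutes {..<n}" "g \<in> carrier WG"
  shows "perm_conj u g =
    (\<lambda>_. 1, inv_into UNIV u) \<otimes>\<^bsub>WG\<^esub> g \<otimes>\<^bsub>WG\<^esub> inv\<^bsub>WG\<^esub> (\<lambda>_. 1, inv_into UNIV u)"
  using permutes_inv_inv[OF assms(1)] wreath_inv[OF torus_one inv_perm[OF assms(1)]]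
  by (cases g) (simp add: perm_conj_def wreath_mult fun_eq_iff)

lemma perm_conj_auto:
  assumes u: "u permutes {..<n}" shows "restrict (perm_conj u) (carrier WG) \<in> auto WG"
proof (rule restrict_autoI[OF finite_wreath])
  show "inj_on (perm_conj u) (carrier WG)"
    using perm_conj_inverse[OF inv_perm[OF u]] permutes_inv_inv[OF u] by (metis inj_onI)
qed (use perm_conj_mem[OF u] perm_conj_mult[OF u] in auto)

text \<open>Larger in general than \<open>Inn\<close>: only the automorphism induced on S_n is
  required to be inner.\<close>

definition inner_auts ::
    "((nat \<Rightarrow> complex) \<times> (nat \<Rightarrow> nat) \<Rightarrow> (nat \<Rightarrow> complex) \<times> (nat \<Rightarrow> nat)) set" where
  "inner_auts = {\<alpha> \<in> auto WG. \<exists>u. u permutes {..<n} \<and>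
     (\<forall>g\<in>carrier WG. snd (\<alpha> g) = u \<circ> snd g \<circ> inv_into UNIV u)}"

lemma permutes_centralizes_imp_id:
  assumes "3 \<le> n" "u permutes {..<n}"
    and comm: "\<And>w. w permutes {..<n} \<Longrightarrow> u \<circ> w = w \<circ> u"
  shows "u = id"
proof (rule ccontr)
  assume "u \<noteq> id"
  then obtain a where a: "u a \<noteq> a" by (metis eq_id_iff)
  then have an: "a < n" "u a < n"
    using permutes_not_in[OF assms(2), of a] permutes_in_image[OF assms(2), of a] by auto
  have "\<not> {..<n} \<subseteq> {a, u a}" using card_mono[of "{a, u a}" "{..<n}"] assms(1) a by auto
  then obtain c where c: "c < n" "c \<noteq> a" "c \<noteq> u a" by auto
  have "transpose (u a) c permutes {..<n}" using an c by (intro permutes_swap_id) auto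
  from fun_cong[OF comm[OF this], of a] have "u (transpose (u a) c a) = transpose (u a) c (u a)" by simp
  then show False using a c by (simp add: transpose_def)
qed

text \<open>Each member is uniquely a permutation conjugation after an automorphism over the
  identity. If \<open>u\<close> and \<open>v\<close> induce the same automorphism of S_n, the
  inverse of \<open>v\<close> composed with \<open>u\<close> centralises S_n and is trivial for n >=
  3.\<close>

lemma card_inner_auts:
  assumes "3 \<le> n" shows "card inner_auts = fact n * card kernel_auts"
proof -
  interpret A: group "AutoGroup WG" by (rule W.AutoGroup)
  let ?P = "{u. u permutes {..<n}}"
  let ?c = "\<lambda>u. restrict (perm_conj u) (carrier WG)"
  let ?F = "\<lambda>(u, \<kappa>). compose (carrier WG) (?c u) \<kappa>"
  have K: "\<kappa> \<in> auto WG" "\<And>g. g \<in> carrier WG \<Longrightarrow> snd (\<kappa> g) = snd g" if "\<kappa> \<in> kernel_auts" for \<kappa>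
    using that by (auto simp: kernel_auts_def)
  have F: "?F (u, \<kappa>) = ?c u \<otimes>\<^bsub>AutoGroup WG\<^esub> \<kappa>" if "u \<in> ?P" "\<kappa> \<in> kernel_auts" for u \<kappa>
    using that perm_conj_auto K by (simp add: mult_AutoGroup)
  have ev: "?F (u, \<kappa>) g = perm_conj u (\<kappa> g)" if "\<kappa> \<in> kernel_auts" "g \<in> carrier WG" for u \<kappa> g
    using that auto_closed[OF K(1)] by (simp add: compose_def)
  have inj: "inj_on ?F (?P \<times> kernel_auts)"
  proof (rule inj_onI)
    fix a b assume "a \<in> ?P \<times> kernel_auts" "b \<in> ?P \<times> kernel_auts" and eq: "?F a = ?F b"
    then obtain u \<kappa> v \<mu> where ab: "a = (u, \<kappa>)" "b = (v, \<mu>)" and u: "u permutes {..<n}"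
      and v: "v permutes {..<n}" and \<kappa>: "\<kappa> \<in> kernel_auts" and \<mu>: "\<mu> \<in> kernel_auts" by auto
    have uw: "u \<circ> w \<circ> inv_into UNIV u = v \<circ> w \<circ> inv_into UNIV v" if "w permutes {..<n}" for w
    proof -
      have "snd (?F a (\<lambda>_. 1, w)) = snd (?F b (\<lambda>_. 1, w))" using eq by simp
      then show ?thesis
        unfolding ab ev[OF \<kappa> perm_mem[OF that]] ev[OF \<mu> perm_mem[OF that]] snd_perm_conj
        using K(2)[OF \<kappa> perm_mem[OF that]] K(2)[OF \<mu> perm_mem[OF that]] by simp
    qed
    have "inv_into UNIV v \<circ> u = id"
    proof (rule permutes_centralizes_imp_id[OF assms permutes_compose[OF u inv_perm[OF v]]])
      fix w assume w: "w permutes {..<n}"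
      show "inv_into UNIV v \<circ> u \<circ> w = w \<circ> (inv_into UNIV v \<circ> u)"
      proof
        fix i
        have "inv_into UNIV v ((u \<circ> w \<circ> inv_into UNIV u) (u i)) = inv_into UNIV v ((v \<circ> w \<circ> inv_into UNIV v) (u i))"
          using uw[OF w] by simp
        then show "(inv_into UNIV v \<circ> u \<circ> w) i = (w \<circ> (inv_into UNIV v \<circ> u)) i"
          using permutes_inverses(2)[OF u] permutes_inverses(2)[OF v] by simp
      qed
    qed
    then have uv: "u = v"
      using permutes_inverses(1)[OF v] by (metis comp_apply id_apply ext)
    have "\<kappa> = \<mu>"
      using eq F[of u \<kappa>] F[of v \<mu>] u v \<kappa> \<mu> ab uv K(1)[OF \<kappa>] K(1)[OF \<mu>] perm_conj_auto[OF v]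
        A.l_cancel[of "?c v" \<kappa> \<mu>] by simp
    then show "a = b" using ab uv by simp
  qed
  have "?F ` (?P \<times> kernel_auts) = inner_auts"
  proof (intro equalityI subsetI)
    fix \<alpha> assume "\<alpha> \<in> ?F ` (?P \<times> kernel_auts)"
    then obtain u \<kappa> where u: "u permutes {..<n}" and \<kappa>: "\<kappa> \<in> kernel_auts" and \<alpha>: "\<alpha> = ?F (u, \<kappa>)" by auto
    have "\<alpha> \<in> auto WG"
      using A.m_closed[of "?c u" \<kappa>] perm_conj_auto[OF u] K(1)[OF \<kappa>] F[of u \<kappa>] u \<kappa> \<alpha> by simp
    moreover have "snd (\<alpha> g) = u \<circ> snd g \<circ> inv_into UNIV u" if "g \<in> carrier WG" for g
      unfolding \<alpha> ev[OF \<kappa> that] snd_perm_conj K(2)[OF \<kappa> that] ..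
    ultimately show "\<alpha> \<in> inner_auts" using u unfolding inner_auts_def by blast
  next
    fix \<alpha> assume "\<alpha> \<in> inner_auts"
    then obtain u where \<alpha>: "\<alpha> \<in> auto WG" and u: "u permutes {..<n}"
      and s: "\<And>g. g \<in> carrier WG \<Longrightarrow> snd (\<alpha> g) = u \<circ> snd g \<circ> inv_into UNIV u"
      unfolding inner_auts_def by blast
    let ?\<kappa> = "compose (carrier WG) (?c (inv_into UNIV u)) \<alpha>"
    have evk: "?\<kappa> g = perm_conj (inv_into UNIV u) (\<alpha> g)" if "g \<in> carrier WG" for g
      using that auto_closed[OF \<alpha>] by (simp add: compose_def)
    have "?\<kappa> \<in> auto WG"
      using A.m_closed[of "?c (inv_into UNIV u)" \<alpha>] perm_conj_auto[OF inv_perm[OF u]] \<alpha>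
      by (simp add: mult_AutoGroup)
    moreover have "snd (?\<kappa> g) = snd g" if "g \<in> carrier WG" for g
      unfolding evk[OF that] snd_perm_conj s[OF that] permutes_inv_inv[OF u]
      using permutes_inverses(2)[OF u] by (simp add: fun_eq_iff)
    ultimately have \<kappa>: "?\<kappa> \<in> kernel_auts" by (simp add: kernel_auts_def)
    have "\<alpha> = ?F (u, ?\<kappa>)"
    proof (rule auto_ext[OF \<alpha>])
      show "?F (u, ?\<kappa>) \<in> auto WG"
        using A.m_closed[of "?c u" ?\<kappa>] perm_conj_auto[OF u] K(1)[OF \<kappa>] F[of u ?\<kappa>] u \<kappa> by simp
      fix g assume g: "g \<in> carrier WG"
      show "\<alpha> g = ?F (u, ?\<kappa>) g"
        unfolding ev[OF \<kappa> g] evk[OF g] perm_conj_inverse[OF u] ..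
    qed
    then show "\<alpha> \<in> ?F ` (?P \<times> kernel_auts)" using u \<kappa> by (intro image_eqI[of _ _ "(u, ?\<kappa>)"]) auto
  qed
  then have "card inner_auts = card (?P \<times> kernel_auts)"
    using card_image[OF inj] by simp
  then show ?thesis by (simp add: card_cartesian_product card_permutations)
qed

end

section \<open>Automorphisms that stabilise the diagonal subgroup\<close>

locale rpn_stab = rpn +
  fixes \<alpha>
  assumes auto: "\<alpha> \<in> auto WG" and stab: "\<alpha> ` NG = NG"
begin

definition "h w = snd (\<alpha> (\<lambda>_. 1, w))"
definition "\<beta> x = fst (\<alpha> (x, id))"

lemma mem_iff: "g \<in> carrier WG \<Longrightarrow> \<alpha> g \<in> NG \<longleftrightarrow> g \<in> NG"
  using stab inj_on_image_mem_iff[OF auto_inj[OF auto] _ NG_sub] by metis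

lemma snd_stab: "g \<in> carrier WG \<Longrightarrow> snd (\<alpha> g) = h (snd g)"
proof -
  assume g: "g \<in> carrier WG"
  obtain x w where xw: "g = (x, w)" by (cases g)
  with g have x: "x \<in> N" and w: "w permutes {..<n}" by (auto simp: wreath_carrier)
  have "\<alpha> g = \<alpha> (x, id) \<otimes>\<^bsub>WG\<^esub> \<alpha> (\<lambda>_. 1, w)"
    using auto_mult[OF auto torus_mem[OF x] perm_mem[OF w]] by (simp add: wreath_mult xw)
  moreover have "snd (\<alpha> (x, id)) = id"
    using mem_iff[OF torus_mem[OF x]] x by (auto simp: mem_NG_iff torus_mem)
  ultimately show ?thesis by (simp add: snd_wreath_mult h_def xw)
qed

lemma h_permutes: "w permutes {..<n} \<Longrightarrow> h w permutes {..<n}"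
  unfolding h_def by (intro snd_permutes auto_closed[OF auto] perm_mem)

lemma h_comp: "v permutes {..<n} \<Longrightarrow> w permutes {..<n} \<Longrightarrow> h (v \<circ> w) = h v \<circ> h w"
  using auto_mult[OF auto perm_mem perm_mem, of w v] by (simp add: h_def wreath_mult snd_wreath_mult)

lemma h_inj: "inj_on h {w. w permutes {..<n}}"
proof (rule inj_onI; clarsimp)
  fix w v assume w: "w permutes {..<n}" and v: "v permutes {..<n}" and eq: "h w = h v"
  let ?g = "(\<lambda>_. 1, w) \<otimes>\<^bsub>WG\<^esub> inv\<^bsub>WG\<^esub> (\<lambda>_. 1, v)"
  have g: "?g \<in> carrier WG" using perm_mem[OF w] perm_mem[OF v] by simp
  have "\<alpha> ?g = \<alpha> (\<lambda>_. 1, w) \<otimes>\<^bsub>WG\<^esub> inv\<^bsub>WG\<^esub> \<alpha> (\<lambda>_. 1, v)"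
    using auto_mult[OF auto perm_mem[OF w] W.inv_closed[OF perm_mem[OF v]]]
      auto_inv[OF group_wreath auto perm_mem[OF v]] by simp
  then have "snd (\<alpha> ?g) = inv_into UNIV (h v) \<circ> h w"
    using snd_wreath_inv[OF auto_closed[OF auto perm_mem[OF v]]] by (simp add: snd_wreath_mult h_def)
  then have "snd (\<alpha> ?g) = id"
    using eq permutes_inv_o(2)[OF h_permutes[OF v]] by simp
  then have "?g \<in> NG" using mem_iff[OF g] auto_closed[OF auto g] by (simp add: mem_NG_iff)
  then have "inv_into UNIV v \<circ> w = id"
    using snd_wreath_inv[OF perm_mem[OF v]] by (simp add: mem_NG_iff snd_wreath_mult)
  then show "w = v"
    using permutes_inverses(1)[OF v] by (metis comp_apply id_apply ext)
qed

lemma \<alpha>_torus: "x \<in> N \<Longrightarrow> \<alpha> (x, id) = (\<beta> x, id)" and \<beta>_torus: "x \<in> N \<Longrightarrow> \<beta> x \<in> N"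
proof -
  assume x: "x \<in> N"
  then have "\<alpha> (x, id) \<in> NG" using mem_iff[OF torus_mem[OF x]] by simp
  then show "\<alpha> (x, id) = (\<beta> x, id)" "\<beta> x \<in> N" by (auto simp: \<beta>_def)
qed

lemma \<beta>_mult: "x \<in> N \<Longrightarrow> y \<in> N \<Longrightarrow> \<beta> (\<lambda>i. x i * y i) = (\<lambda>i. \<beta> x i * \<beta> y i)"
  using auto_mult[OF auto torus_mem torus_mem, of x y] \<alpha>_torus[of x] \<alpha>_torus[of y]
    \<alpha>_torus[OF torus_mult, of x y] by (simp add: wreath_mult)

lemma \<beta>_perm:
  assumes "x \<in> N" "w permutes {..<n}" shows "\<beta> (\<lambda>i. x (w i)) = (\<lambda>i. \<beta> x (h w i))"
proof -
  obtain f where f: "\<alpha> (\<lambda>_. 1, w) = (f, h w)" by (metis h_def prod.collapse)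
  then have fN: "f \<in> N" using auto_closed[OF auto perm_mem[OF assms(2)]] by (simp add: wreath_carrier)
  have "(\<lambda>i. x (w i), id) \<otimes>\<^bsub>WG\<^esub> (\<lambda>_. 1, w) = (\<lambda>_. 1, w) \<otimes>\<^bsub>WG\<^esub> (x, id)"
    by (simp add: wreath_mult)
  then have "\<alpha> (\<lambda>i. x (w i), id) \<otimes>\<^bsub>WG\<^esub> \<alpha> (\<lambda>_. 1, w) = \<alpha> (\<lambda>_. 1, w) \<otimes>\<^bsub>WG\<^esub> \<alpha> (x, id)"
    using assms by (simp add: torus_mem perm_mem torus_permute flip: auto_mult[OF auto])
  then have "\<beta> (\<lambda>i. x (w i)) i * f i = f i * \<beta> x (h w i)" for i
    using assms by (simp add: \<alpha>_torus f torus_permute wreath_mult fun_eq_iff)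
  then show ?thesis
    using torus_nz[OF fN] by (auto simp: mult.commute)
qed

lemma \<beta>_surj:
  assumes "y \<in> N" obtains x where "x \<in> N" "\<beta> x = y"
proof -
  have "(y, id) \<in> \<alpha> ` NG" using assms unfolding stab by blast
  then obtain x where "x \<in> N" "\<alpha> (x, id) = (y, id)" by (elim imageE) (metis (no_types))
  then show thesis using that by (simp add: \<beta>_def)
qed

text \<open>The commutators of (a b) with the diagonal subgroup are the tuples with z at a, 1/z at b
  and 1 elsewhere, at most \<open>r\<close> of them. Equivariance of \<beta> through
  \<open>h\<close> carries them onto the commutators with the image of (a b), so the same bound
  holds there.\<close>

lemma commutator_card_le:
  assumes "a < n" "b < n"
  shows "card ((\<lambda>y i. y i * inverse (y (h (transpose a b) i))) ` N) \<le> r"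
proof -
  let ?s = "transpose a b"
  have s: "?s permutes {..<n}" using assms by (intro permutes_swap_id) auto
  let ?d = "\<lambda>w x i. x i * inverse (x (w i) :: complex)"
  let ?e = "\<lambda>z i. if a = b then 1 else if i = a then z else if i = b then inverse z else (1::complex)"
  have "?d (h ?s) y \<in> (\<beta> \<circ> ?e) ` {z. z ^ r = 1}" if y: "y \<in> N" for y
  proof -
    obtain x where x: "x \<in> N" "\<beta> x = y" using \<beta>_surj[OF y] .
    have xs: "(\<lambda>i. inverse (x (?s i))) \<in> N" using torus_inverse[OF torus_permute[OF x(1) s]] .
    have "\<beta> (\<lambda>i. (\<lambda>i. x (?s i)) i * (\<lambda>i. inverse (x (?s i))) i) = \<beta> (\<lambda>_. 1)"
      using torus_nz[OF x(1)] by simp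
    then have "(\<lambda>i. y (h ?s i) * \<beta> (\<lambda>i. inverse (x (?s i))) i) = \<beta> (\<lambda>_. 1)"
      using \<beta>_mult[OF torus_permute[OF x(1) s] xs] \<beta>_perm[OF x(1) s] x(2) by simp
    moreover have "\<beta> (\<lambda>_. 1) = (\<lambda>_. 1)"
      using auto_one[OF group_wreath auto] by (simp add: \<beta>_def wreath_one)
    ultimately have "y (h ?s i) * \<beta> (\<lambda>i. inverse (x (?s i))) i = 1" for i
      by (rule_tac fun_cong) simp
    then have "\<beta> (\<lambda>i. inverse (x (?s i))) i = inverse (y (h ?s i))" for i
      by (metis inverse_unique)
    then have bd: "\<beta> (?d ?s x) = ?d (h ?s) y"
      using \<beta>_mult[OF x(1) xs] x(2) by simp
    have dx: "?d ?s x = ?e (x a * inverse (x b))"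
      using torus_nz[OF x(1)] by (auto simp: transpose_def fun_eq_iff)
    have "(x a * inverse (x b)) ^ r = 1"
      using torus_pow[OF x(1)] by (simp add: power_mult_distrib power_inverse)
    then have mem: "x a * inverse (x b) \<in> {z. z ^ r = 1}" by simp
    show ?thesis
      by (rule image_eqI[OF _ mem]) (simp only: comp_apply bd[symmetric] dx)
  qed
  then have "card (?d (h ?s) ` N) \<le> card ((\<beta> \<circ> ?e) ` {z. z ^ r = 1})"
    using r_pos by (intro card_mono finite_imageI finite_roots_unity) auto
  also have "\<dots> \<le> card {z :: complex. z ^ r = 1}"
    using r_pos by (intro card_image_le finite_roots_unity) auto
  finally show ?thesis using card_roots_unity_eq[OF r_pos] by simp
qed

text \<open>A fixed-point-free involution of six points has at least r^2 commutators: exponents can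
  be chosen independently at points c and e of two different 2-cycles, both avoiding the cycle of 0,
  and are read off at c and e. For r > 1 this exceeds \<open>r\<close>.\<close>

lemma not_ffree:
  assumes "a < n" "b < n" "n = 6" "r \<noteq> 1" "h (transpose a b) \<circ> h (transpose a b) = id"
  shows "\<exists>i<n. h (transpose a b) i = i"
proof (rule ccontr)
  assume neg: "\<not> ?thesis"
  define s where "s = h (transpose a b)"
  have ff: "s i \<noteq> i" if "i < n" for i using neg that by (auto simp: s_def)
  have ss: "s (s i) = i" for i using assms(5) by (metis s_def comp_apply id_apply)
  have sP: "s permutes {..<n}" unfolding s_def using assms(1,2) by (intro h_permutes permutes_swap_id) auto
  have sn: "s i < n" if "i < n" for i using permutes_in_image[OF sP, of i] that by simp
  have "card {0, s 0} \<le> 2" using card_length[of "[0, s 0]"] by simp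
  then have "\<not> {..<n} \<subseteq> {0, s 0}" using card_mono[of "{0, s 0}" "{..<n}"] assms(3) by auto
  then obtain c where c: "c < n" "c \<noteq> 0" "c \<noteq> s 0" by auto
  have "card {0, s 0, c, s c} \<le> 4" using card_length[of "[0, s 0, c, s c]"] by simp
  then have "\<not> {..<n} \<subseteq> {0, s 0, c, s c}" using card_mono[of "{0, s 0, c, s c}" "{..<n}"] assms(3) by auto
  then obtain e where e: "e < n" "e \<noteq> 0" "e \<noteq> s 0" "e \<noteq> c" "e \<noteq> s c" by auto
  have sc: "s c \<noteq> 0" "s c \<noteq> c" "s c \<noteq> e" and se: "s e \<noteq> 0" "s e \<noteq> c" "s e \<noteq> e"
    using c e ss ff by metis+
  let ?y = "\<lambda>(k, l) i. root_tuple r c 0 i ^ k * root_tuple r e 0 i ^ l"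
  let ?d = "\<lambda>y i. y i * inverse (y (s i) :: complex)"
  have pw: "(\<lambda>i. x i ^ k) \<in> N" if "x \<in> N" for x k
    by (induction k) (use that in \<open>auto simp: torus_one torus_mult\<close>)
  have y: "?y kl \<in> N" for kl
    using c e by (cases kl) (auto intro!: torus_mult pw root_tuple_in_torus)
  have "inj_on (\<lambda>kl. ?d (?y kl)) ({..<r} \<times> {..<r})"
  proof (rule inj_onI)
    fix a b assume ab: "a \<in> {..<r} \<times> {..<r}" "b \<in> {..<r} \<times> {..<r}" and eq: "?d (?y a) = ?d (?y b)"
    obtain k l k' l' where kl: "a = (k, l)" "b = (k', l')" by (cases a; cases b)
    have "zeta r ^ k = zeta r ^ k'"
      using fun_cong[OF eq, of c] c e sc by (simp add: kl root_tuple_def)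
    moreover have "zeta r ^ l = zeta r ^ l'"
      using fun_cong[OF eq, of e] c e se by (simp add: kl root_tuple_def)
    ultimately show "a = b" using zeta_pow_inj ab kl by auto
  qed
  then have "card ({..<r} \<times> {..<r}) \<le> card (?d ` N)"
    using y by (intro card_inj_on_le[where f = "\<lambda>kl. ?d (?y kl)"] finite_imageI finite_torus) auto
  also have "\<dots> \<le> r" using commutator_card_le[OF assms(1,2)] by (simp add: s_def)
  finally have "r * r \<le> r * 1" by simp
  then have "r \<le> 1" using r_pos by (simp only: mult_le_cancel1)
  then show False using r_pos assms(4) by simp
qed

lemma in_inner_auts:
  assumes "3 \<le> n"
    and ff: "\<And>a b. a < n \<Longrightarrow> b < n \<Longrightarrow> a \<noteq> b \<Longrightarrow> n = 6 \<Longrightarrow> r = 1 \<Longrightarrow> \<exists>i<n. h (transpose a b) i = i"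
  shows "\<alpha> \<in> inner_auts"
proof -
  interpret sym_endo n h
    using assms(1) h_permutes h_comp h_inj by unfold_locales auto
  have "\<exists>c d. c < n \<and> d < n \<and> c \<noteq> d \<and> h (transpose a b) = transpose c d"
    if ab: "a < n" "b < n" "a \<noteq> b" for a b
  proof -
    have tr: "transpose a b permutes {..<n}" using ab by (intro permutes_swap_id) auto
    have "h (transpose a b) \<circ> h (transpose a b) = id"
      using comp[OF tr tr] h_id by simp
    then have "\<exists>i<n. h (transpose a b) i = i" if "n \<in> {4, 6}"
      using that not_ffree_four[OF _ ab] not_ffree[OF ab(1,2)] ff[OF ab] by blast
    then show ?thesis using image_transpose[OF ab] by blast
  qed
  then obtain u where "u permutes {..<n}"
    "\<And>w. w permutes {..<n} \<Longrightarrow> h w = u \<circ> w \<circ> inv_into UNIV u"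
    using inner by blast
  then show ?thesis
    using auto snd_stab snd_permutes unfolding inner_auts_def by auto
qed

end

context rpn
begin

lemma inner_auts_stab:
  assumes "\<alpha> \<in> inner_auts" shows "\<alpha> \<in> auto WG" "\<alpha> ` NG = NG"
proof -
  show \<alpha>: "\<alpha> \<in> auto WG" using assms by (simp add: inner_auts_def)
  obtain u where u: "u permutes {..<n}"
    and s: "\<And>g. g \<in> carrier WG \<Longrightarrow> snd (\<alpha> g) = u \<circ> snd g \<circ> inv_into UNIV u"
    using assms unfolding inner_auts_def by blast
  have "\<alpha> ` NG \<subseteq> NG"
  proof (rule image_subsetI)
    fix g assume g: "g \<in> NG"
    then have gc: "g \<in> carrier WG" and "snd g = id" by (auto simp: mem_NG_iff)
    then have "snd (\<alpha> g) = id" using s[OF gc] permutes_inv_o(1)[OF u] by simp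
    then show "\<alpha> g \<in> NG" using auto_closed[OF \<alpha> gc] by (simp add: mem_NG_iff)
  qed
  moreover have "inj_on \<alpha> NG" using auto_inj[OF \<alpha>] NG_sub by (rule inj_on_subset)
  ultimately show "\<alpha> ` NG = NG"
    using finite_torus by (intro endo_inj_surj) auto
qed

lemma stab_eq_kernel_auts:
  assumes "n = 2" shows "{\<alpha> \<in> auto WG. \<alpha> ` NG = NG} = kernel_auts"
proof (intro equalityI subsetI)
  fix \<alpha> assume "\<alpha> \<in> {\<alpha> \<in> auto WG. \<alpha> ` NG = NG}"
  then interpret rpn_stab r p n \<alpha> by unfold_locales auto
  have two: "w = id \<or> w = transpose 0 1" if "w permutes {..<n}" for w
    using that permutes_two_cases assms by blast
  have h1: "h id = id" using snd_stab[OF W.one_closed] auto_one[OF group_wreath auto] by (simp add: wreath_one)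
  have t: "transpose 0 1 permutes {..<n}" using n_gt by (intro permutes_swap_id) auto
  have "transpose 0 1 \<noteq> (id :: nat \<Rightarrow> nat)" by (metis id_apply transpose_apply_first zero_neq_one)
  then have "h (transpose 0 1) = transpose 0 1"
    using two[OF h_permutes[OF t]] h1 inj_onD[OF h_inj, of "transpose 0 1" id] t permutes_id by auto
  then have "h w = w" if "w permutes {..<n}" for w using two[OF that] h1 by auto
  then show "\<alpha> \<in> kernel_auts"
    using auto snd_stab snd_permutes by (simp add: kernel_auts_def)
next
  fix \<alpha> assume a: "\<alpha> \<in> kernel_auts"
  then have "\<alpha> \<in> inner_auts"
    unfolding inner_auts_def kernel_auts_def by (auto intro!: exI[of _ id] permutes_id)
  then show "\<alpha> \<in> {\<alpha> \<in> auto WG. \<alpha> ` NG = NG}" using inner_auts_stab by simp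
qed

lemma card_stab:
  assumes "\<not> (n = 6 \<and> r = 1)"
  shows "card {\<alpha> \<in> auto WG. \<alpha> ` NG = NG} = (if n = 2 then 1 else fact n) * card kernel_auts"
proof (cases "n = 2")
  case False
  then have n3: "3 \<le> n" using n_gt by simp
  have "{\<alpha> \<in> auto WG. \<alpha> ` NG = NG} = inner_auts"
  proof (intro equalityI subsetI)
    fix \<alpha> assume "\<alpha> \<in> {\<alpha> \<in> auto WG. \<alpha> ` NG = NG}"
    then interpret rpn_stab r p n \<alpha> by unfold_locales auto
    show "\<alpha> \<in> inner_auts" using in_inner_auts[OF n3] assms by blast
  qed (use inner_auts_stab in auto)
  then show ?thesis using card_inner_auts[OF n3] False by simp
next
  case True
  show ?thesis unfolding stab_eq_kernel_auts[OF True] using True by simp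
qed

end

section \<open>Images of the diagonal subgroup\<close>

text \<open>Keeps of an image of the diagonal subgroup only what bounds the parameters: its order,
  commutativity and invariance under permutation conjugation.\<close>

locale rpn_other = rpn +
  fixes L
  assumes L_sub: "subgroup L WG" and card_L: "card L = card N" and L_ne: "L \<noteq> NG"
    and L_conj: "u permutes {..<n} \<Longrightarrow> g \<in> L \<Longrightarrow> perm_conj u g \<in> L"
    and L_comm: "g \<in> L \<Longrightarrow> h \<in> L \<Longrightarrow> g \<otimes>\<^bsub>WG\<^esub> h = h \<otimes>\<^bsub>WG\<^esub> g"
begin

abbreviation "H \<equiv> snd ` L"

lemma L_mem: "g \<in> L \<Longrightarrow> g \<in> carrier WG"
  using L_sub subgroup.subset by blast

lemma H_permutes: "h \<in> H \<Longrightarrow> h permutes {..<n}"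
  using L_mem snd_permutes by blast

lemma finite_L: "finite L"
  using finite_subset[OF subgroup.subset[OF L_sub] finite_wreath] .

lemma exists_nonid: obtains h where "h \<in> H" "h \<noteq> id"
proof -
  have "\<not> L \<subseteq> NG"
    using card_seteq[of NG L] finite_torus card_NG card_L L_ne by auto
  then show thesis using that L_mem mem_NG_iff by blast
qed

lemma H_conj: "u permutes {..<n} \<Longrightarrow> h \<in> H \<Longrightarrow> u \<circ> h \<circ> inv_into UNIV u \<in> H"
  using L_conj snd_perm_conj by (metis (no_types, lifting) image_iff)

lemma H_comm: "h \<in> H \<Longrightarrow> k \<in> H \<Longrightarrow> h (k i) = k (h i)"
  using L_comm by (metis (no_types, lifting) comp_apply image_iff snd_wreath_mult)

text \<open>A nontrivial \<open>h\<close> moves some a to h a, and double transitivity of S_n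
  supplies a conjugate that moves i to j.\<close>

lemma H_trans:
  assumes "i < n" "j < n" "i \<noteq> j" obtains h where "h \<in> H" "h i = j"
proof -
  obtain h where h: "h \<in> H" "h \<noteq> id" using exists_nonid .
  then obtain a where a: "h a \<noteq> a" by (metis eq_id_iff)
  have an: "a < n" "h a < n"
    using permutes_not_in[OF H_permutes[OF h(1)], of a] permutes_in_image[OF H_permutes[OF h(1)], of a] a by auto
  obtain u where u: "u permutes {..<n}" "u a = i" "u (h a) = j"
    using permutes_two_points[OF an assms(1,2) a[symmetric] assms(3)] .
  have "(u \<circ> h \<circ> inv_into UNIV u) i = j"
    using u permutes_inverses(2)[OF u(1), of a] by auto
  then show thesis using that H_conj[OF u(1) h(1)] by blast
qed

text \<open>Some element of \<open>H\<close> moves the point of agreement to any other given point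
  and commutes with both permutations. So \<open>H\<close> is regular.\<close>

lemma H_eq:
  assumes "h \<in> H" "k \<in> H" "h i = k i" "i < n" shows "h = k"
proof
  fix j show "h j = k j"
  proof (cases "j < n \<and> j \<noteq> i")
    case True
    then obtain l where l: "l \<in> H" "l i = j" using H_trans[of i j] assms(4) by auto
    then show ?thesis using H_comm[OF assms(1) l(1), of i] H_comm[OF assms(2) l(1), of i] assms(3) by simp
  next
    case False
    then show ?thesis
      using permutes_not_in[OF H_permutes] assms by (metis lessThan_iff)
  qed
qed

lemma id_H: "id \<in> H"
  using subgroup.one_closed[OF L_sub] by (force simp: wreath_one)

lemma card_H: "card H = n"
proof -
  have "bij_betw (\<lambda>h. h 0) H {..<n}"
    unfolding bij_betw_def
  proof (intro conjI equalityI subsetI)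
    show "inj_on (\<lambda>h. h 0) H" using H_eq n_gt by (intro inj_onI) auto
    show "j \<in> (\<lambda>h. h 0) ` H" if j: "j \<in> {..<n}" for j
    proof (cases "j = 0")
      case True
      then show ?thesis using id_H by (intro image_eqI[of _ _ id]) auto
    next
      case False
      then obtain l where "l \<in> H" "l 0 = j" using H_trans[of 0 j] j n_gt by auto
      then show ?thesis by (intro image_eqI[of _ _ l]) auto
    qed
    fix j assume "j \<in> (\<lambda>h. h 0) ` H"
    then obtain h where "h \<in> H" "j = h 0" by auto
    then show "j \<in> {..<n}" using permutes_in_image[OF H_permutes, of h 0] n_gt by simp
  qed
  then show ?thesis using bij_betw_same_card by fastforce
qed

text \<open>A conjugate of \<open>h\<close> that agrees with \<open>h\<close> at one point is
  \<open>h\<close>. Hence every permutation fixing both i and h i commutes with \<open>h\<close>,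
  which leaves little room once there are many points.\<close>

lemma H_fixes_conj:
  assumes "h \<in> H" "u permutes {..<n}" "u i = i" "u (h i) = h i" "i < n"
  shows "u (h j) = h (u j)"
proof -
  have "(u \<circ> h \<circ> inv_into UNIV u) i = h i"
    using assms(3,4) permutes_inverses(2)[OF assms(2), of i] by simp
  then have e: "u \<circ> h \<circ> inv_into UNIV u = h"
    by (rule H_eq[OF H_conj[OF assms(2,1)] assms(1) _ assms(5)])
  have "(u \<circ> h \<circ> inv_into UNIV u) (u j) = u (h j)"
    using permutes_inverses(2)[OF assms(2), of j] by simp
  then show ?thesis unfolding e by simp
qed

text \<open>Were i, h i, h (h i) distinct, the transposition of h (h i) with a fourth point would
  fix i and h i and therefore commute with \<open>h\<close>, which it does not.\<close>

lemma H_invol: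
  assumes "h \<in> H" "h i \<noteq> i" "i < n" "4 \<le> n" shows "h (h i) = i"
proof (rule ccontr)
  assume c: "h (h i) \<noteq> i"
  have P: "h permutes {..<n}" using H_permutes assms(1) .
  have hn: "h i < n" "h (h i) < n" using permutes_in_image[OF P] assms(3) by simp_all
  have ne: "h (h i) \<noteq> h i" using assms(2) permutes_inj[OF P] by (auto dest: injD)
  have "card {i, h i, h (h i)} \<le> 3" using card_length[of "[i, h i, h (h i)]"] by simp
  then have "\<not> {..<n} \<subseteq> {i, h i, h (h i)}"
    using card_mono[of "{i, h i, h (h i)}" "{..<n}"] assms(4) by auto
  then obtain d where d: "d < n" "d \<noteq> i" "d \<noteq> h i" "d \<noteq> h (h i)" by auto
  have "transpose (h (h i)) d permutes {..<n}" using hn d by (intro permutes_swap_id) auto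
  from H_fixes_conj[OF assms(1) this, of i "h i"] assms(2,3) c ne d
  show False by (simp add: transpose_def split: if_splits)
qed

text \<open>For \<open>h\<close> swapping 0 and 1, the transposition of \<open>h 2\<close> with a
  fifth point fixes 0 and 1, hence would commute with \<open>h\<close>; but it fixes 2 and moves
  \<open>h 2\<close>.\<close>

lemma n_le_four: "n \<le> 4"
proof (rule ccontr)
  assume "\<not> n \<le> 4"
  then have n5: "5 \<le> n" by simp
  obtain h where h: "h \<in> H" "h 0 = 1" using H_trans[of 0 1] n_gt by auto
  have P: "h permutes {..<n}" using H_permutes h(1) .
  have inj: "h a = h b \<longleftrightarrow> a = b" for a b using permutes_inj[OF P] by (auto dest: injD)
  have h1: "h 1 = 0" using H_invol[OF h(1), of 0] h(2) n5 by simp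
  have h2: "h 2 \<noteq> 0" "h 2 \<noteq> 1" using inj[of 2 1] inj[of 2 0] h h1 by auto
  have "h 2 \<noteq> 2"
  proof
    assume "h 2 = 2"
    then have "h = id" using H_eq[OF h(1) id_H, of 2] n5 by simp
    then show False using h(2) by simp
  qed
  have h2n: "h 2 < n" using permutes_in_image[OF P, of 2] n5 by simp
  have "card {0, 1, 2, h 2} \<le> 4" using card_length[of "[0, 1, 2, h 2]"] by simp
  then have "\<not> {..<n} \<subseteq> {0, 1, 2, h 2}"
    using card_mono[of "{0, 1, 2, h 2}" "{..<n}"] n5 by auto
  then obtain e where e: "e < n" "e \<noteq> 0" "e \<noteq> 1" "e \<noteq> 2" "e \<noteq> h 2" by auto
  have "transpose (h 2) e permutes {..<n}" using h2n e by (intro permutes_swap_id) auto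
  from H_fixes_conj[OF h(1) this, of 0 2] h h2 \<open>h 2 \<noteq> 2\<close> e n5
  show False by (simp add: transpose_def split: if_splits)
qed

abbreviation "L0 \<equiv> {x \<in> N. (x, id) \<in> L}"

text \<open>A diagonal element of \<open>L\<close> commutes with an element of \<open>L\<close>
  whose permutation takes 0 to i, so its entries at 0 and i coincide.\<close>

lemma L0_const:
  assumes "x \<in> L0" shows "\<exists>c. x = const_tuple n c"
proof -
  have x: "x \<in> N" "(x, id) \<in> L" using assms by auto
  have "x i = x 0" if i: "i < n" for i
  proof (cases "i = 0")
    case False
    then obtain h where "h \<in> H" "h 0 = i" using H_trans[of 0 i] i n_gt by auto
    then obtain a where a: "(a, h) \<in> L" by force
    then have "a \<in> N" using L_mem by (auto simp: wreath_carrier)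
    have "a 0 * x (h 0) = x 0 * a 0"
      using arg_cong[OF L_comm[OF a x(2)], of "\<lambda>g. fst g 0"] by (simp add: wreath_mult)
    then show ?thesis using torus_nz[OF \<open>a \<in> N\<close>, of 0] \<open>h 0 = i\<close> by simp
  qed simp
  then have "x = const_tuple n (x 0)" by (rule const_on_orbit[OF x(1)])
  then show ?thesis ..
qed

lemma card_L_eq: "card N = n * card L0"
proof -
  have "card L = card H * card ((\<lambda>x. (x, id :: nat \<Rightarrow> nat)) ` L0)"
  proof (rule W.card_eq_card_image_mult[OF L_sub finite_L])
    show "(\<lambda>x. (x, id)) ` L0 \<subseteq> L" by auto
    fix a b assume ab: "a \<in> L" "b \<in> L"
    have mem: "inv\<^bsub>WG\<^esub> a \<otimes>\<^bsub>WG\<^esub> b \<in> L"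
      using ab subgroup.m_inv_closed[OF L_sub] subgroup.m_closed[OF L_sub] by blast
    have "snd (inv\<^bsub>WG\<^esub> a \<otimes>\<^bsub>WG\<^esub> b) = snd b \<circ> inv_into UNIV (snd a)"
      using snd_wreath_inv[OF L_mem[OF ab(1)]] by (simp add: snd_wreath_mult)
    moreover have "snd b \<circ> inv_into UNIV (snd a) = id \<longleftrightarrow> snd a = snd b"
      using permutes_inverses[OF snd_permutes[OF L_mem[OF ab(1)]]] by (metis comp_apply ext id_apply)
    moreover have "g \<in> (\<lambda>x. (x, id)) ` L0 \<longleftrightarrow> snd g = id" if "g \<in> L" for g
      using that L_mem[OF that] by (cases g) (auto simp: wreath_carrier)
    ultimately show "snd a = snd b \<longleftrightarrow> inv\<^bsub>WG\<^esub> a \<otimes>\<^bsub>WG\<^esub> b \<in> (\<lambda>x. (x, id)) ` L0"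
      using mem by auto
  qed
  then show ?thesis
    using card_L card_H by (simp add: card_image inj_on_def)
qed

lemma card_L0_le: "card L0 \<le> m * gcd p n"
proof -
  have sub: "L0 \<subseteq> {x \<in> N. \<exists>c. x = const_tuple n c}" using L0_const by blast
  show ?thesis using card_mono[OF _ sub] finite_torus card_const_tuples by simp
qed

lemma r_bound: "r ^ (n - 1) \<le> n * gcd p n"
proof -
  have "r ^ (n - 1) * m \<le> n * gcd p n * m"
    using card_L_eq card_torus mult_le_mono2[OF card_L0_le, of n] by (simp add: ac_simps)
  then show ?thesis using m_pos by simp
qed

lemma r_ne_one: "r \<noteq> 1"
proof
  assume r1: "r = 1"
  then have "p = 1" using p_dvd by simp
  then have "card N = 1" using card_torus r1 by simp
  then have "n * card L0 = 1" unfolding card_L_eq[symmetric] .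
  then show False using n_gt by simp
qed

text \<open>Since gcd(p, n) <= n, the bound on r^(n-1) gives r <= 4, 3, 2 for n = 2, 3, 4, and the
  exact gcd with p | r leaves six triples. The triple (4,4,2) passes this numerical test and is
  excluded separately.\<close>

lemma params: "(r, p, n) \<in> {(2, 1, 2), (2, 2, 2), (4, 2, 2), (4, 4, 2), (3, 3, 3), (2, 2, 4)}"
proof -
  have r2: "2 \<le> r" using r_ne_one r_pos by simp
  have pr: "p \<le> r" using p_dvd r_pos by (rule dvd_imp_le)
  consider "n = 2" | "n = 3" | "n = 4" using n_le_four n_gt by linarith
  then show ?thesis
  proof cases
    case 1
    then have b: "r \<le> 2 * gcd p 2" using r_bound by simp
    moreover have "gcd p 2 \<le> 2" by (rule gcd_le2_nat) simp
    ultimately have "r \<le> 4" by linarith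
    then have "r \<in> {2, 3, 4}" "p \<in> {1, 2, 3, 4}" using r2 pr p_pos by auto
    then show ?thesis using 1 b p_dvd by (auto simp: gcd.commute)
  next
    case 2
    then have b: "r * r \<le> 3 * gcd p 3" using r_bound by (simp add: power2_eq_square)
    moreover have "gcd p 3 \<le> 3" by (rule gcd_le2_nat) simp
    ultimately have 9: "r * r \<le> 9" by linarith
    have 16: "r * r \<ge> 16" if "r \<ge> 4" using mult_le_mono[OF that that] by simp
    have "r < 4" using 9 16 by (cases "r < 4") auto
    then have "r \<in> {2, 3}" "p \<in> {1, 2, 3}" using r2 pr p_pos by auto
    then show ?thesis using 2 b p_dvd by auto
  next
    case 3
    then have b: "r * (r * r) \<le> 4 * gcd p 4" using r_bound by (simp add: power3_eq_cube mult.assoc)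
    moreover have "gcd p 4 \<le> 4" by (rule gcd_le2_nat) simp
    ultimately have 16: "r * (r * r) \<le> 16" by linarith
    have 27: "r * (r * r) \<ge> 27" if "r \<ge> 3" using mult_le_mono[OF that mult_le_mono[OF that that]] by simp
    have "r < 3" using 16 27 by (cases "r < 3") auto
    then have "r = 2" "p \<in> {1, 2}" using r2 pr p_pos by auto
    then show ?thesis using 3 b p_dvd by auto
  qed
qed

end

context rpn
begin

lemma other_of_auto:
  assumes \<alpha>: "\<alpha> \<in> auto WG" and ne: "\<alpha> ` NG \<noteq> NG"
  shows "rpn_other r p n (\<alpha> ` NG)"
proof (rule rpn_other.intro[OF rpn_axioms rpn_other_axioms.intro])
  have hom: "group_hom WG WG \<alpha>"
    using \<alpha> group_wreath by (intro group_hom.intro group_hom_axioms.intro) (auto simp: auto_def)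
  have sub: "subgroup NG WG"
  proof (rule W.subgroupI)
    show "NG \<subseteq> carrier WG" by (rule NG_sub)
    show "NG \<noteq> {}" using torus_one by blast
    show "inv\<^bsub>WG\<^esub> a \<in> NG" if "a \<in> NG" for a
      using that snd_wreath_inv[of a] by (simp add: mem_NG_iff)
    show "a \<otimes>\<^bsub>WG\<^esub> b \<in> NG" if "a \<in> NG" "b \<in> NG" for a b
      using that by (simp add: mem_NG_iff snd_wreath_mult)
  qed
  show "subgroup (\<alpha> ` NG) WG"
    using group_hom.subgroup_img_is_subgroup[OF hom sub] .
  show "card (\<alpha> ` NG) = card N"
    using card_image[OF inj_on_subset[OF auto_inj[OF \<alpha>] NG_sub]] card_NG by simp
  show "\<alpha> ` NG \<noteq> NG" by fact
  show "perm_conj u g \<in> \<alpha> ` NG" if u: "u permutes {..<n}" and g: "g \<in> \<alpha> ` NG" for u g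
  proof -
    obtain x where x: "x \<in> NG" "g = \<alpha> x"
      by (rule imageE[OF g])
    have xc: "x \<in> carrier WG" using x(1) NG_sub by blast
    let ?u = "(\<lambda>_. 1, inv_into UNIV u)"
    have uc: "?u \<in> carrier WG" by (rule perm_mem[OF inv_perm[OF u]])
    then have ui: "?u \<in> \<alpha> ` carrier WG"
      unfolding auto_image[OF \<alpha>] .
    \<comment> \<open>Normality is transported through \<alpha>: the conjugating permutation has
      some preimage k, and conjugation by k preserves \<open>NG\<close>.\<close>
    obtain k where k: "?u = \<alpha> k" "k \<in> carrier WG"
      by (rule imageE[OF ui])
    have "perm_conj u g = \<alpha> (k \<otimes>\<^bsub>WG\<^esub> x \<otimes>\<^bsub>WG\<^esub> inv\<^bsub>WG\<^esub> k)"
      using perm_conj_eq[OF u auto_closed[OF \<alpha> xc]] k xc auto_inv[OF group_wreath \<alpha> k(2)] x(2)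
      by (simp add: auto_mult[OF \<alpha>])
    moreover have "k \<otimes>\<^bsub>WG\<^esub> x \<otimes>\<^bsub>WG\<^esub> inv\<^bsub>WG\<^esub> k \<in> NG"
      using x k xc snd_wreath_inv[OF k(2)] permutes_inv_o(2)[OF snd_permutes[OF k(2)]]
      by (simp add: mem_NG_iff snd_wreath_mult)
    ultimately show ?thesis by blast
  qed
  show "g \<otimes>\<^bsub>WG\<^esub> h = h \<otimes>\<^bsub>WG\<^esub> g" if "g \<in> \<alpha> ` NG" "h \<in> \<alpha> ` NG" for g h
  proof -
    obtain x y where xy: "x \<in> N" "y \<in> N" "g = \<alpha> (x, id)" "h = \<alpha> (y, id)" using \<open>g \<in> _\<close> \<open>h \<in> _\<close> by blast
    have "(x, id) \<otimes>\<^bsub>WG\<^esub> (y, id) = (y, id) \<otimes>\<^bsub>WG\<^esub> (x, id)"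
      by (simp add: wreath_mult mult.commute)
    then show ?thesis
      using xy by (simp add: torus_mem flip: auto_mult[OF \<alpha>])
  qed
qed

text \<open>G(4,4,2) is dihedral of order 8 with cyclic diagonal subgroup of order 4. Another image
  would contain only scalars 1, -1 and elements over the swap, all of square 1, while the diagonal
  subgroup has an element of order 4.\<close>

lemma torus_char_442:
  assumes \<alpha>: "\<alpha> \<in> auto WG" and eq: "(r, p, n) = (4, 4, 2)" shows "\<alpha> ` NG = NG"
proof (rule ccontr)
  assume "\<alpha> ` NG \<noteq> NG"
  then interpret rpn_other r p n "\<alpha> ` NG" by (rule other_of_auto[OF \<alpha>])
  have rpn: "r = 4" "p = 4" "n = 2" using eq by auto
  have sq: "g \<otimes>\<^bsub>WG\<^esub> g = \<one>\<^bsub>WG\<^esub>" if g: "g \<in> \<alpha> ` NG" for g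
  proof -
    obtain a h where ah: "g = (a, h)" by (cases g)
    then have a: "a \<in> N" and h: "h permutes {..<n}" using L_mem[OF g] by (auto simp: wreath_carrier)
    have a01: "a 0 * a 1 = 1" using torus_prod[OF a] rpn by (simp add: numeral_2_eq_2)
    consider "h = id" | "h = transpose 0 1" using h permutes_two_cases rpn by blast
    then have "a i * a (h i) = 1" if "i < 2" for i
    proof cases
      case 1
      then have "a \<in> L0" using g a ah by simp
      then obtain c where "a = const_tuple n c" using L0_const by blast
      then show ?thesis using 1 a01 that rpn by (simp add: const_tuple_def)
    next
      case 2
      then show ?thesis using that a01 by (auto simp: less_2_cases_iff mult.commute)
    qed
    moreover have "a i * a (h i) = 1" if "\<not> i < 2" for i
      using that torus_out[OF a] permutes_not_in[OF h, of i] rpn by simp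
    ultimately have "a i * a (h i) = 1" for i by blast
    moreover have "h \<circ> h = id"
      using h permutes_two_cases[of h] rpn by auto
    ultimately show ?thesis by (simp add: ah wreath_mult wreath_one)
  qed
  let ?x = "(root_tuple r 0 1, id)"
  have x: "?x \<in> NG" using root_tuple_in_torus[of 0 1] n_gt by simp
  then have xc: "?x \<in> carrier WG" using NG_sub by blast
  have "\<alpha> (?x \<otimes>\<^bsub>WG\<^esub> ?x) = \<alpha> \<one>\<^bsub>WG\<^esub>"
    using sq x auto_mult[OF \<alpha> xc xc] auto_one[OF group_wreath \<alpha>] by simp
  then have "?x \<otimes>\<^bsub>WG\<^esub> ?x = \<one>\<^bsub>WG\<^esub>"
    using inj_onD[OF auto_inj[OF \<alpha>]] xc by blast
  then have "zeta r ^ 2 = 1"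
    by (auto simp: wreath_mult wreath_one root_tuple_def fun_eq_iff power2_eq_square dest: spec[of _ 0])
  then show False using zeta_pow_eq_one_iff[OF r_pos, of 2] rpn by simp
qed

end

section \<open>Counting the images in the exceptional cases\<close>

context rpn_other
begin

lemma H_conj_mem:
  assumes "g \<in> L" "snd g \<noteq> id" "k \<in> H" "k \<noteq> id"
  obtains u where "u permutes {..<n}" "snd (perm_conj u g) = k"
proof -
  obtain a where a: "snd g a \<noteq> a" using assms(2) by (metis eq_id_iff)
  obtain i where i: "k i \<noteq> i" using assms(4) by (metis eq_id_iff)
  have gP: "snd g permutes {..<n}" and kP: "k permutes {..<n}"
    using assms H_permutes by auto
  have an: "a < n" "snd g a < n" and "i < n" "k i < n"
    using permutes_not_in[OF gP, of a] permutes_in_image[OF gP, of a] a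
      permutes_not_in[OF kP, of i] permutes_in_image[OF kP, of i] i by auto
  then obtain u where u: "u permutes {..<n}" "u a = i" "u (snd g a) = k i"
    using permutes_two_points[OF an \<open>i < n\<close> \<open>k i < n\<close> a[symmetric] i[symmetric]] by metis
  have "snd (perm_conj u g) i = k i"
    using u permutes_inverses(2)[OF u(1), of a] by (auto simp: snd_perm_conj)
  then have "snd (perm_conj u g) = k"
    using H_eq[of "snd (perm_conj u g)" k i] L_conj[OF u(1) assms(1)] assms(3) \<open>i < n\<close> by blast
  then show thesis using that u(1) by blast
qed

end

section \<open>Reconstructing an image from one element, and its diagonal conjugates\<close>

context rpn
begin

lemma mult_inv_same_perm:
  assumes "(a, h) \<in> carrier WG" "(b, h) \<in> carrier WG"
  shows "(a, h) \<otimes>\<^bsub>WG\<^esub> inv\<^bsub>WG\<^esub> (b, h) = (\<lambda>i. a i / b i, id)"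
proof -
  have h: "h permutes {..<n}" and b: "b \<in> N" using assms by (auto simp: wreath_carrier)
  show ?thesis
    using permutes_inverses(2)[OF h] permutes_inv_o(2)[OF h]
    by (simp add: wreath_inv[OF b h] wreath_mult divide_inverse)
qed

text \<open>The conjugates of \<open>g\<close> by permutations lie over all nontrivial elements of
  \<open>H\<close> and belong to both subgroups; every other element differs from one of them by a
  diagonal element of \<open>L\<close>.\<close>

lemma other_subset:
  assumes L: "rpn_other r p n L" and L': "rpn_other r p n L'"
    and eq: "{x \<in> N. (x, id) \<in> L} = {x \<in> N. (x, id) \<in> L'}"
    and g: "g \<in> L" "g \<in> L'" "snd g \<noteq> id"
  shows "L \<subseteq> L'"
proof
  interpret L: rpn_other r p n L by fact
  interpret L': rpn_other r p n L' by fact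
  have L0: "l \<in> L'" if "l \<in> L" "snd l = id" for l
    using that L.L_mem[OF that(1)] eq by (cases l) (auto simp: wreath_carrier)
  fix l assume l: "l \<in> L"
  show "l \<in> L'"
  proof (cases "snd l = id")
    case False
    then obtain u where u: "u permutes {..<n}" "snd (perm_conj u g) = snd l"
      using L.H_conj_mem[OF g(1,3) imageI[OF l]] by metis
    let ?k = "perm_conj u g"
    have k: "?k \<in> L" "?k \<in> L'" using L.L_conj[OF u(1) g(1)] L'.L_conj[OF u(1) g(2)] .
    have kc: "?k \<in> carrier WG" and lc: "l \<in> carrier WG" using L.L_mem k l by auto
    have "l \<otimes>\<^bsub>WG\<^esub> inv\<^bsub>WG\<^esub> ?k \<in> L"
      using subgroup.m_closed[OF L.L_sub l subgroup.m_inv_closed[OF L.L_sub k(1)]] .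
    moreover have "snd (l \<otimes>\<^bsub>WG\<^esub> inv\<^bsub>WG\<^esub> ?k) = id"
      using u(2) permutes_inv_o(2)[OF snd_permutes[OF lc]] snd_wreath_inv[OF kc] by (simp add: snd_wreath_mult)
    ultimately have "l \<otimes>\<^bsub>WG\<^esub> inv\<^bsub>WG\<^esub> ?k \<in> L'" by (rule L0)
    then have "l \<otimes>\<^bsub>WG\<^esub> inv\<^bsub>WG\<^esub> ?k \<otimes>\<^bsub>WG\<^esub> ?k \<in> L'"
      using k(2) by (rule subgroup.m_closed[OF L'.L_sub])
    then show ?thesis using kc lc by (simp add: W.m_assoc)
  qed (use L0 l in blast)
qed

lemma other_eq:
  assumes "rpn_other r p n L" "rpn_other r p n L'"
    and "{x \<in> N. (x, id) \<in> L} = {x \<in> N. (x, id) \<in> L'}"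
    and "g \<in> L" "g \<in> L'" "snd g \<noteq> id"
  shows "L = L'"
  using other_subset[OF assms] other_subset[OF assms(2,1) assms(3)[symmetric] assms(5,4,6)] by blast

text \<open>Conjugation by \<open>diag(z, 1, \<dots>, 1)\<close>, which lies in \<open>G(r,1,n)\<close> but in general not in
  \<open>G(r,p,n)\<close>, moves a pure permutation \<open>h\<close> to \<open>(diag_tuple h z, h)\<close>.\<close>

definition diag_tuple :: "(nat \<Rightarrow> nat) \<Rightarrow> complex \<Rightarrow> nat \<Rightarrow> complex" where
  "diag_tuple h z = (\<lambda>i. (if i = 0 then z else 1) / (if h i = 0 then z else 1))"

definition diag_conj :: "complex \<Rightarrow> (nat \<Rightarrow> complex) \<times> (nat \<Rightarrow> nat) \<Rightarrow> (nat \<Rightarrow> complex) \<times> (nat \<Rightarrow> nat)" where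
  "diag_conj z = restrict (wreath_map n 1 0 (\<lambda>i. if i = 0 then z else 1) 0) (carrier WG)"

lemma diag_conj_auto:
  assumes "z ^ r = 1" shows "diag_conj z \<in> auto WG"
proof -
  have "(\<lambda>i. if i = 0 then z else 1) \<in> torus r (Suc 0) n"
    using assms n_gt by (intro full_torusI) auto
  then have "diag_conj z \<in> kernel_auts"
    unfolding diag_conj_def by (rule wreath_map_auto) auto
  then show ?thesis by (simp add: kernel_auts_def)
qed

lemma diag_conj_eq:
  assumes "(x, w) \<in> carrier WG"
  shows "diag_conj z (x, w) = (\<lambda>i. x i * diag_tuple w z i, w)"
proof -
  have x: "x \<in> N" and w: "w permutes {..<n}" using assms by (auto simp: wreath_carrier)
  have "w i = i" if "\<not> i < n" for i using that permutes_not_in[OF w] by simp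
  then show ?thesis
    using assms torus_out[OF x] n_gt by (auto simp: diag_conj_def wreath_map_def diag_tuple_def fun_eq_iff)
qed

text \<open>The common scheme of the exceptional counts. One image containing a pure permutation
  \<open>h\<close> is given; the others different from \<open>NG\<close> are to be its conjugates by
  diag(z, 1, ..., 1) with \<open>z\<close> in \<open>R\<close>. \<open>Z\<close> is their common
  diagonal part, \<open>A\<close> says that each of them is reached, \<open>B\<close> that distinct
  \<open>z\<close> give distinct images. The successor counts \<open>NG\<close> itself.\<close>

lemma orbit_card:
  assumes \<tau>: "\<tau> \<in> auto WG" and one: "(\<lambda>_. 1, h) \<in> \<tau> ` NG" and h: "h \<noteq> id"
    and R: "finite R" "\<And>z. z \<in> R \<Longrightarrow> z ^ r = 1"
    and Z: "\<And>\<alpha>. \<alpha> \<in> auto WG \<Longrightarrow> \<alpha> ` NG \<noteq> NG \<Longrightarrow> {x \<in> N. (x, id) \<in> \<alpha> ` NG} = Z"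
    and A: "\<And>\<alpha>. \<alpha> \<in> auto WG \<Longrightarrow> \<alpha> ` NG \<noteq> NG \<Longrightarrow>
      \<exists>a z. (a, h) \<in> \<alpha> ` NG \<and> z \<in> R \<and> (\<lambda>i. a i / diag_tuple h z i) \<in> Z"
    and B: "\<And>z z'. z \<in> R \<Longrightarrow> z' \<in> R \<Longrightarrow> (\<lambda>i. diag_tuple h z i / diag_tuple h z' i) \<in> Z \<Longrightarrow> z = z'"
  shows "card ((\<lambda>\<alpha>. \<alpha> ` NG) ` auto WG) = Suc (card R)"
proof -
  interpret Au: group "AutoGroup WG" by (rule W.AutoGroup)
  let ?O = "(\<lambda>\<alpha>. \<alpha> ` NG) ` auto WG"
  let ?f = "\<lambda>z. diag_conj z ` \<tau> ` NG"
  have "\<tau> ` NG \<subseteq> carrier WG"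
    using image_mono[OF NG_sub, of \<tau>] unfolding auto_image[OF \<tau>] .
  then have hc: "(\<lambda>_. 1, h) \<in> carrier WG" using one by (rule subsetD)
  have f_eq: "?f z = compose (carrier WG) (diag_conj z) \<tau> ` NG" for z
    unfolding image_image[of "diag_conj z" \<tau>]
  proof (rule image_cong[OF refl])
    fix g assume "g \<in> NG"
    then have "g \<in> carrier WG" using NG_sub by (rule subsetD[rotated])
    then show "diag_conj z (\<tau> g) = compose (carrier WG) (diag_conj z) \<tau> g" by (simp add: compose_def)
  qed
  have comp: "compose (carrier WG) (diag_conj z) \<tau> \<in> auto WG" if "z \<in> R" for z
    using Au.m_closed[of "diag_conj z" \<tau>] diag_conj_auto[OF R(2)[OF that]] \<tau> by (simp add: mult_AutoGroup)
  have mem: "(diag_tuple h z, h) \<in> ?f z" for z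
    using imageI[OF one, of "diag_conj z"] diag_conj_eq[OF hc, of z] by simp
  have ne: "?f z \<noteq> NG" for z
  proof
    assume "?f z = NG"
    with mem[of z] have "(diag_tuple h z, h) \<in> NG" by (simp only:)
    then show False using h unfolding mem_NG_iff by simp
  qed
  have oth: "rpn_other r p n (?f z)" and Zf: "{x \<in> N. (x, id) \<in> ?f z} = Z" if "z \<in> R" for z
    using other_of_auto[OF comp[OF that]] Z[OF comp[OF that]] ne[of z] unfolding f_eq by blast+
  have inj: "inj_on ?f R"
  proof (rule inj_onI)
    fix z z' assume z: "z \<in> R" "z' \<in> R" and eq: "?f z = ?f z'"
    interpret L: rpn_other r p n "?f z" by (rule oth[OF z(1)])
    have m: "(diag_tuple h z, h) \<in> ?f z" "(diag_tuple h z', h) \<in> ?f z"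
      by (rule mem) (unfold eq, rule mem)
    have "(diag_tuple h z, h) \<otimes>\<^bsub>WG\<^esub> inv\<^bsub>WG\<^esub> (diag_tuple h z', h) \<in> ?f z"
      using subgroup.m_closed[OF L.L_sub m(1) subgroup.m_inv_closed[OF L.L_sub m(2)]] .
    then have q: "(\<lambda>i. diag_tuple h z i / diag_tuple h z' i, id) \<in> ?f z"
      using mult_inv_same_perm L.L_mem[OF m(1)] L.L_mem[OF m(2)] by simp
    then have "(\<lambda>i. diag_tuple h z i / diag_tuple h z' i) \<in> N"
      using L.L_mem[OF q] by (simp add: wreath_carrier)
    then show "z = z'" using B[OF z] Zf[OF z(1)] q by blast
  qed
  have O: "?O = insert NG (?f ` R)"
  proof (intro equalityI subsetI)
    fix L assume "L \<in> ?O"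
    then obtain \<alpha> where \<alpha>: "\<alpha> \<in> auto WG" "L = \<alpha> ` NG" by blast
    show "L \<in> insert NG (?f ` R)"
    proof (cases "L = NG")
      case False
      then have ne': "\<alpha> ` NG \<noteq> NG" using \<alpha> by simp
      obtain a z where az: "(a, h) \<in> \<alpha> ` NG" "z \<in> R" "(\<lambda>i. a i / diag_tuple h z i) \<in> Z"
        using A[OF \<alpha>(1) ne'] by blast
      interpret L': rpn_other r p n "?f z" by (rule oth[OF az(2)])
      have z0: "z \<noteq> 0" using R(2)[OF az(2)] r_pos by (auto simp: power_0_left)
      have "(\<lambda>i. a i / diag_tuple h z i, id) \<in> ?f z" using az(3) Zf[OF az(2)] by blast
      then have "(\<lambda>i. a i / diag_tuple h z i, id) \<otimes>\<^bsub>WG\<^esub> (diag_tuple h z, h) \<in> ?f z"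
        using mem by (rule subgroup.m_closed[OF L'.L_sub])
      moreover have "(\<lambda>i. a i / diag_tuple h z i, id) \<otimes>\<^bsub>WG\<^esub> (diag_tuple h z, h) = (a, h)"
        using z0 by (auto simp: wreath_mult diag_tuple_def)
      ultimately have ah: "(a, h) \<in> ?f z" by simp
      have Z2: "{x \<in> N. (x, id) \<in> \<alpha> ` NG} = {x \<in> N. (x, id) \<in> ?f z}"
        using Z[OF \<alpha>(1) ne'] Zf[OF az(2)] by simp
      have "\<alpha> ` NG = ?f z"
        by (rule other_eq[OF other_of_auto[OF \<alpha>(1) ne'] oth[OF az(2)] Z2 az(1) ah]) (use h in simp)
      then show ?thesis using az(2) \<alpha>(2) by blast
    qed simp
  next
    fix L assume L: "L \<in> insert NG (?f ` R)"
    show "L \<in> ?O"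
    proof (cases "L = NG")
      case True
      have "(\<lambda>x\<in>carrier WG. x) ` NG = (\<lambda>x. x) ` NG"
        using NG_sub by (intro image_cong) auto
      then have "L = (\<lambda>x\<in>carrier WG. x) ` NG" using True by simp
      then show ?thesis using W.id_in_auto by (rule image_eqI)
    next
      case False
      then obtain z where "z \<in> R" "L = ?f z" using L by blast
      then show ?thesis using comp f_eq by blast
    qed
  qed
  have notin: "NG \<notin> ?f ` R"
  proof
    assume "NG \<in> ?f ` R"
    then obtain z where "NG = ?f z" by (rule imageE)
    then show False using ne[of z] by simp
  qed
  show ?thesis
    unfolding O card_insert_disjoint[OF finite_imageI[OF R(1)] notin] card_image[OF inj] ..
qed

definition intertwines ::
    "(nat \<Rightarrow> nat \<Rightarrow> complex) \<Rightarrow> (nat \<Rightarrow> complex) \<times> (nat \<Rightarrow> nat) \<Rightarrow> (nat \<Rightarrow> complex) \<times> (nat \<Rightarrow> nat) \<Rightarrow> bool" where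
  "intertwines U g g' \<longleftrightarrow> (\<forall>i<n. \<forall>k<n. U i k * fst g k = fst g' i * U (snd g' i) (snd g k))"

text \<open>In matrix terms \<open>intertwines U g g'\<close> says \<open>U g = g' U\<close>, so an intertwining matrix \<open>U\<close> whose
  rows and columns are pairwise non-proportional normalises the group.\<close>

lemma intertwiner_auto:
  assumes U: "\<And>i k. i < n \<Longrightarrow> k < n \<Longrightarrow> U i k \<noteq> 0"
    and rows: "\<And>i j c. i < n \<Longrightarrow> j < n \<Longrightarrow> (\<And>k. k < n \<Longrightarrow> U i k = c * U j k) \<Longrightarrow> i = j"
    and cols: "\<And>i j c. i < n \<Longrightarrow> j < n \<Longrightarrow> (\<And>k. k < n \<Longrightarrow> U k i = c * U k j) \<Longrightarrow> i = j"
    and roots: "\<And>j. 0 < j \<Longrightarrow> j < n \<Longrightarrow> \<exists>g'\<in>carrier WG. intertwines U (root_tuple r j 0, id) g'"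
    and first: "\<exists>g'\<in>carrier WG. intertwines U (first_tuple, id) g'"
    and star: "\<And>j. 0 < j \<Longrightarrow> j < n \<Longrightarrow> \<exists>g'\<in>carrier WG. intertwines U (\<lambda>_. 1, transpose 0 j) g'"
  obtains \<tau> where "\<tau> \<in> auto WG"
    "\<And>g g'. g \<in> carrier WG \<Longrightarrow> g' \<in> carrier WG \<Longrightarrow> intertwines U g g' \<Longrightarrow> \<tau> g = g'"
proof -
  have lt: "snd g i < n \<longleftrightarrow> i < n" if "g \<in> carrier WG" for g i
    using permutes_in_image[OF snd_permutes[OF that], of i] by simp
  have nz: "fst g i \<noteq> 0" if "g \<in> carrier WG" for g i
    using that torus_nz by (cases g) (auto simp: wreath_carrier)
  have out: "fst g i = 1" "snd g i = i" if "g \<in> carrier WG" "\<not> i < n" for g i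
  proof -
    obtain x w where xw: "g = (x, w)" by (cases g)
    then have "x \<in> N" "w permutes {..<n}" using that by (auto simp: wreath_carrier)
    then show "fst g i = 1" "snd g i = i"
      using torus_out[of x i] permutes_not_in[of w "{..<n}" i] that xw by simp_all
  qed
  have mult: "intertwines U (g \<otimes>\<^bsub>WG\<^esub> h) (g' \<otimes>\<^bsub>WG\<^esub> h')"
    if c: "g \<in> carrier WG" "g' \<in> carrier WG" and i: "intertwines U g g'" "intertwines U h h'" for g h g' h'
    unfolding intertwines_def
  proof (intro allI impI)
    fix i k assume ik: "i < n" "k < n"
    have "U i k * fst g k * fst h (snd g k) = fst g' i * (U (snd g' i) (snd g k) * fst h (snd g k))"
      using i(1) ik by (simp add: intertwines_def)
    also have "\<dots> = fst g' i * (fst h' (snd g' i) * U (snd h' (snd g' i)) (snd h (snd g k)))"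
      using i(2) ik lt c by (simp add: intertwines_def)
    finally show "U i k * fst (g \<otimes>\<^bsub>WG\<^esub> h) k = fst (g' \<otimes>\<^bsub>WG\<^esub> h') i *
        U (snd (g' \<otimes>\<^bsub>WG\<^esub> h') i) (snd (g \<otimes>\<^bsub>WG\<^esub> h) k)"
      by (cases g; cases h; cases g'; cases h') (simp add: wreath_mult mult.assoc)
  qed
  have ex: "\<exists>g'\<in>carrier WG. intertwines U g g'" if g: "g \<in> carrier WG" for g
  proof -
    have "g \<in> {g \<in> carrier WG. \<exists>g'\<in>carrier WG. intertwines U g g'}"
    proof (rule wreath_gen[OF g])
      fix g h assume g: "g \<in> {g \<in> carrier WG. \<exists>g'\<in>carrier WG. intertwines U g g'}"
        and h: "h \<in> {g \<in> carrier WG. \<exists>g'\<in>carrier WG. intertwines U g g'}"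
      obtain g' where g': "g' \<in> carrier WG" "intertwines U g g'" using g by blast
      obtain h' where h': "h' \<in> carrier WG" "intertwines U h h'" using h by blast
      have "intertwines U (g \<otimes>\<^bsub>WG\<^esub> h) (g' \<otimes>\<^bsub>WG\<^esub> h')" using mult g g' h' by blast
      then show "g \<otimes>\<^bsub>WG\<^esub> h \<in> {g \<in> carrier WG. \<exists>g'\<in>carrier WG. intertwines U g g'}"
        using g h g'(1) h'(1) by auto
    qed (use roots first star root_mem first_mem star_mem in auto)
    then show ?thesis by simp
  qed
  \<comment> \<open>The rows of g' U are multiples of rows of \<open>U\<close>; as these are
    pairwise non-proportional, they determine g'.\<close>
  have uniq: "g' = g''" if c: "g \<in> carrier WG" "g' \<in> carrier WG" "g'' \<in> carrier WG"
    and i: "intertwines U g g'" "intertwines U g g''" for g g' g''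
  proof -
    have "snd g' i = snd g'' i \<and> fst g' i = fst g'' i" for i
    proof (cases "i < n")
      case True
      have e: "fst g' i * U (snd g' i) l = fst g'' i * U (snd g'' i) l" if l: "l < n" for l
      proof -
        obtain k where k: "snd g k = l" using permutes_surj[OF snd_permutes[OF c(1)]] by (metis surjD)
        then have "k < n" using lt[OF c(1), of k] l by simp
        then have "U i k * fst g k = fst g' i * U (snd g' i) (snd g k)"
          "U i k * fst g k = fst g'' i * U (snd g'' i) (snd g k)"
          using i True by (simp_all add: intertwines_def)
        then show ?thesis using k by simp
      qed
      have "snd g' i = snd g'' i"
      proof (rule rows)
        show "snd g' i < n" "snd g'' i < n" using lt c True by auto
        fix k assume "k < n"
        from e[OF this] show "U (snd g' i) k = (fst g'' i / fst g' i) * U (snd g'' i) k"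
          using nz[OF c(2), of i] by (simp add: field_simps)
      qed
      moreover from this have "fst g' i = fst g'' i"
        using e[of 0] U[of "snd g'' i" 0] lt[OF c(3), of i] True n_gt by simp
      ultimately show ?thesis by simp
    qed (use out c in auto)
    then show ?thesis by (simp add: prod_eq_iff fun_eq_iff)
  qed
  define \<tau> where "\<tau> g = (SOME g'. g' \<in> carrier WG \<and> intertwines U g g')" for g
  have \<tau>: "\<tau> g \<in> carrier WG" "intertwines U g (\<tau> g)" if "g \<in> carrier WG" for g
    using someI_ex[of "\<lambda>g'. g' \<in> carrier WG \<and> intertwines U g g'"] ex[OF that] unfolding \<tau>_def by blast+
  have "restrict \<tau> (carrier WG) \<in> auto WG"
  proof (rule restrict_autoI[OF finite_wreath])
    \<comment> \<open>Dually, non-proportional columns of \<open>U\<close> recover g from its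
      image.\<close>
    show "inj_on \<tau> (carrier WG)"
    proof (rule inj_onI)
      fix g h assume c: "g \<in> carrier WG" "h \<in> carrier WG" and eq: "\<tau> g = \<tau> h"
      let ?k = "\<tau> g"
      have kc: "?k \<in> carrier WG" using \<tau>(1)[OF c(1)] .
      have e1: "U i k * fst g k = fst ?k i * U (snd ?k i) (snd g k)" if "i < n" "k < n" for i k
        using \<tau>(2)[OF c(1)] that by (simp add: intertwines_def)
      have e2: "U i k * fst h k = fst ?k i * U (snd ?k i) (snd h k)" if "i < n" "k < n" for i k
        using \<tau>(2)[OF c(2)] that by (simp add: intertwines_def eq)
      have "snd g k = snd h k \<and> fst g k = fst h k" for k
      proof (cases "k < n")
        case True
        have e: "U j (snd g k) * fst h k = U j (snd h k) * fst g k" if j: "j < n" for j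
        proof -
          obtain i where i: "snd ?k i = j" using permutes_surj[OF snd_permutes[OF kc]] by (metis surjD)
          then have "i < n" using lt[OF kc, of i] j by simp
          have "(fst ?k i * U j (snd g k)) * fst h k = (fst ?k i * U j (snd h k)) * fst g k"
            using e1[OF \<open>i < n\<close> True, symmetric] e2[OF \<open>i < n\<close> True, symmetric]
            unfolding i by (simp add: ac_simps)
          then show ?thesis using nz[OF kc, of i] by (simp add: mult.assoc)
        qed
        have "snd g k = snd h k"
        proof (rule cols)
          show "snd g k < n" "snd h k < n" using lt c True by auto
          fix j assume "j < n"
          from e[OF this] show "U j (snd g k) = (fst g k / fst h k) * U j (snd h k)"
            using nz[OF c(2), of k] by (simp add: field_simps)
        qed
        moreover from this have "fst g k = fst h k"
          using e[of 0] U[of 0 "snd h k"] lt[OF c(2), of k] True n_gt by simp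
        ultimately show ?thesis by simp
      qed (use out c in auto)
      then show "g = h" by (simp add: prod_eq_iff fun_eq_iff)
    qed
    fix g h assume c: "g \<in> carrier WG" "h \<in> carrier WG"
    then have gh: "g \<otimes>\<^bsub>WG\<^esub> h \<in> carrier WG" by simp
    show "\<tau> (g \<otimes>\<^bsub>WG\<^esub> h) = \<tau> g \<otimes>\<^bsub>WG\<^esub> \<tau> h"
      using uniq[OF gh \<tau>(1)[OF gh] _ \<tau>(2)[OF gh] mult[OF c(1) \<tau>(1)[OF c(1)] \<tau>(2)[OF c(1)] \<tau>(2)[OF c(2)]]]
        \<tau>(1) c by simp
  qed (use \<tau> in auto)
  then show thesis
    using that[of "restrict \<tau> (carrier WG)"] uniq \<tau> by simp
qed

end

lemma all_less_two: "(\<forall>i<2::nat. Q i) \<longleftrightarrow> Q 0 \<and> Q 1"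
  by (auto simp: less_2_cases_iff)

lemma all_less_three: "(\<forall>i<3::nat. Q i) \<longleftrightarrow> Q 0 \<and> Q 1 \<and> Q 2"
  by (auto simp: less_Suc_eq numeral_3_eq_3 numeral_2_eq_2)

lemma all_less_four: "(\<forall>i<4::nat. Q i) \<longleftrightarrow> Q 0 \<and> Q 1 \<and> Q 2 \<and> Q 3"
  by (auto simp: less_Suc_eq numeral_eq_Suc)

lemma prod_less_three: "(\<Prod>i<3::nat. x i) = x 0 * x 1 * (x 2 :: complex)"
  by (simp add: numeral_3_eq_3 numeral_2_eq_2)

lemma prod_less_two: "(\<Prod>i<2::nat. x i) = x 0 * (x 1 :: complex)"
  by (simp add: numeral_2_eq_2)

lemma permutes_shift_three:
  assumes "h permutes {..<3::nat}" "h 0 = 1" "h 1 \<noteq> 1" "h 2 \<noteq> 2"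
  shows "h = transpose 0 1 \<circ> transpose 1 2"
proof -
  have inj: "h a = h b \<longleftrightarrow> a = b" for a b using permutes_inj[OF assms(1)] by (auto dest: injD)
  have "h 1 < 3" "h 2 < 3" using permutes_in_image[OF assms(1), of 1] permutes_in_image[OF assms(1), of 2] by auto
  moreover have "h 1 \<noteq> h 2" "h 2 \<noteq> 1" using inj[of 1 2] inj[of 2 0] assms(2) by auto
  ultimately have h12: "h 1 = 2" "h 2 = 0" using assms by linarith+
  show ?thesis
  proof
    fix i show "h i = (transpose 0 1 \<circ> transpose 1 2) i"
    proof (cases "i < 3")
      case True
      then consider "i = 0" | "i = 1" | "i = 2" by linarith
      then show ?thesis using h12 assms(2) by cases (auto simp: transpose_def)
    qed (use permutes_not_in[OF assms(1), of i] in \<open>auto simp: transpose_def\<close>)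
  qed
qed

lemma permutes_double_four:
  assumes "h permutes {..<4::nat}" "h 0 = 1" "h 1 = 0" "h 2 \<noteq> 2"
  shows "h = transpose 0 1 \<circ> transpose 2 3"
proof -
  have inj: "h a = h b \<longleftrightarrow> a = b" for a b using permutes_inj[OF assms(1)] by (auto dest: injD)
  have "h 2 < 4" "h 3 < 4" using permutes_in_image[OF assms(1), of 2] permutes_in_image[OF assms(1), of 3] by auto
  moreover have "h 3 \<noteq> h 2" "h 2 \<noteq> 1" "h 2 \<noteq> 0" "h 3 \<noteq> 1" "h 3 \<noteq> 0"
    using inj[of 3 2] inj[of 2 0] inj[of 2 1] inj[of 3 0] inj[of 3 1] assms(2,3) by auto
  ultimately have h23: "h 2 = 3" "h 3 = 2" using assms by linarith+
  show ?thesis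
  proof
    fix i show "h i = (transpose 0 1 \<circ> transpose 2 3) i"
    proof (cases "i < 4")
      case True
      then consider "i = 0" | "i = 1" | "i = 2" | "i = 3" by linarith
      then show ?thesis using h23 assms(2,3) by cases (auto simp: transpose_def)
    qed (use permutes_not_in[OF assms(1), of i] in \<open>auto simp: transpose_def\<close>)
  qed
qed

context rpn_other
begin

lemma L0_eq_consts:
  assumes "n * (m * gcd p n) = card N" shows "L0 = {x \<in> N. \<exists>c. x = const_tuple n c}"
proof (rule card_subset_eq)
  show "L0 \<subseteq> {x \<in> N. \<exists>c. x = const_tuple n c}" using L0_const by blast
  show "card L0 = card {x \<in> N. \<exists>c. x = const_tuple n c}"
    using card_L_eq assms card_const_tuples n_gt by simp
qed (use finite_torus in simp)

lemma L0_eq_one: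
  assumes "card N = n" shows "L0 = {\<lambda>_. 1}"
proof -
  have "card L0 = 1" using card_L_eq assms n_gt by simp
  then obtain x where x: "L0 = {x}" by (rule card_1_singletonE)
  have "(\<lambda>_. 1) \<in> L0"
    using torus_one subgroup.one_closed[OF L_sub] by (simp add: wreath_one)
  then show ?thesis using x by simp
qed

lemma exists_over:
  assumes "i < n" "j < n" "i \<noteq> j" obtains a h where "(a, h) \<in> L" "a \<in> N" "h \<in> H" "h i = j"
proof -
  obtain h where h: "h \<in> H" "h i = j" using H_trans[OF assms] .
  then obtain a where a: "(a, h) \<in> L" by force
  then have "a \<in> N" using L_mem by (auto simp: wreath_carrier)
  then show thesis using that a h by blast
qed

lemma swap_over:
  assumes "n = 2" obtains a where "(a, transpose 0 1) \<in> L" "a \<in> N"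
proof -
  obtain a h where a: "(a, h) \<in> L" "a \<in> N" "h \<in> H" "h 0 = 1"
    using exists_over[of 0 1] n_gt by auto
  have "h = transpose 0 1"
    using permutes_two_cases[of h] H_permutes[OF a(3)] a(4) assms by auto
  then show thesis using that a by blast
qed

lemma shift_over:
  assumes "n = 3" obtains a where "(a, transpose 0 1 \<circ> transpose 1 2) \<in> L" "a \<in> N"
proof -
  obtain a h where a: "(a, h) \<in> L" "a \<in> N" "h \<in> H" "h 0 = 1"
    using exists_over[of 0 1] n_gt by auto
  have "h i \<noteq> i" if "i < n" for i
    using H_eq[OF a(3) id_H _ that] a(4) by auto
  then have "h = transpose 0 1 \<circ> transpose 1 2"
    using permutes_shift_three[of h] H_permutes[OF a(3)] a(4) assms by auto
  then show thesis using that a by blast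
qed

lemma double_over:
  assumes "n = 4" obtains a where "(a, transpose 0 1 \<circ> transpose 2 3) \<in> L" "a \<in> N"
proof -
  obtain a h where a: "(a, h) \<in> L" "a \<in> N" "h \<in> H" "h 0 = 1"
    using exists_over[of 0 1] n_gt by auto
  have "h i \<noteq> i" if "i < n" for i
    using H_eq[OF a(3) id_H _ that] a(4) by auto
  moreover have "h 1 = 0" using H_invol[OF a(3), of 0] a(4) assms by simp
  ultimately have "h = transpose 0 1 \<circ> transpose 2 3"
    using permutes_double_four[of h] H_permutes[OF a(3)] a(4) assms by auto
  then show thesis using that a by blast
qed

end

section \<open>The exceptional triples\<close>

context rpn
begin

lemma const_quotient:
  assumes "x \<in> N" "\<And>i. i < n \<Longrightarrow> x i / y i = c" "\<And>i. n \<le> i \<Longrightarrow> y i = 1" "c ^ r = 1" "c ^ (n * m) = 1"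
  shows "(\<lambda>i. x i / y i) \<in> {x \<in> N. \<exists>c. x = const_tuple n c}"
proof -
  have "(\<lambda>i. x i / y i) = const_tuple n c"
    using assms(2,3) torus_out[OF assms(1)] by (auto simp: const_tuple_def fun_eq_iff)
  then show ?thesis using const_tuple_in_torus[of c] assms(4,5) by auto
qed

lemma intertwines_iff:
  assumes "n = k"
  shows "intertwines U g g' \<longleftrightarrow>
    (\<forall>i<k. \<forall>j<k. U i j * fst g j = fst g' i * U (snd g' i) (snd g j))"
  unfolding intertwines_def unfolding assms ..

lemma diag_tuple_out: "n \<le> i \<Longrightarrow> h permutes {..<n} \<Longrightarrow> diag_tuple h z i = 1"
  using permutes_not_in[of h "{..<n}" i] n_gt by (simp add: diag_tuple_def)

text \<open>For \<open>r = 2\<close> the diagonal subgroup has exponent 2, and so does its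
  image.\<close>

lemma other_square:
  assumes \<alpha>: "\<alpha> \<in> auto WG" and "r = 2" and g: "(a, h) \<in> \<alpha> ` NG" shows "a i * a (h i) = 1"
proof -
  obtain x where x: "x \<in> N" "(a, h) = \<alpha> (x, id)" using g by blast
  have "(x, id) \<otimes>\<^bsub>WG\<^esub> (x, id) = \<one>\<^bsub>WG\<^esub>"
    using torus_pow[OF x(1)] assms(2) by (simp add: wreath_mult wreath_one power2_eq_square)
  then have "(a, h) \<otimes>\<^bsub>WG\<^esub> (a, h) = \<one>\<^bsub>WG\<^esub>"
    using auto_mult[OF \<alpha> torus_mem[OF x(1)] torus_mem[OF x(1)]] auto_one[OF group_wreath \<alpha>] x(2) by simp
  then show ?thesis by (simp add: wreath_mult wreath_one fun_eq_iff)
qed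

lemma zeta_half:
  assumes "r = 2 * k" shows "zeta r ^ k = -1"
proof -
  have "(zeta r ^ k) ^ 2 = 1" using zeta_r assms by (simp add: power_mult[symmetric] mult.commute)
  moreover have "zeta r ^ k \<noteq> 1"
    using zeta_pow_eq_one_iff[OF r_pos, of k] assms r_pos by (auto dest: dvd_imp_le)
  ultimately show ?thesis by (simp add: power2_eq_1_iff)
qed

text \<open>Conjugation by the 2 x 2 Hadamard matrix normalises G(2,1,2) and G(4,2,2) and takes
  diag(1, -1) to the swap.\<close>

lemma hadamard_auto:
  assumes n: "n = 2" and m: "m = 2" and r: "r = 2 \<or> r = 4"
  obtains \<tau> where "\<tau> \<in> auto WG" "(\<lambda>_. 1, transpose 0 1) \<in> \<tau> ` NG"
proof -
  define U :: "nat \<Rightarrow> nat \<Rightarrow> complex" where "U = (\<lambda>i k. if i = 1 \<and> k = 1 then -1 else 1)"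
  define y :: "nat \<Rightarrow> complex" where "y = (\<lambda>i. if i = 1 then -1 else 1)"
  have even_r: "even r" using r by auto
  \<comment> \<open>So \<open>first_tuple\<close> is diag(-1, 1), which the Hadamard matrix takes to
    minus the swap.\<close>
  have "r = 2 * p" using r_eq m by (metis mult.commute)
  then have zp: "zeta r ^ p = -1" by (rule zeta_half)
  have yN: "y \<in> N"
    by (rule torusI) (use n m even_r in \<open>auto simp: y_def prod_less_two\<close>)
  have cN: "const_tuple n c \<in> N" if "c ^ 4 = 1" "c ^ r = 1" for c
    unfolding const_tuple_in_torus using that n m by simp
  have s: "transpose 0 1 permutes {..<n}" using n by (intro permutes_swap_id) auto
  have id: "id permutes {..<n}" by (rule permutes_id)
  have i4: "(zeta r)\<^sup>2 = -1" if "r = 4" using zeta_half[of 2] that by simp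
  have i2: "zeta r = -1" if "r = 2" using zeta_half[of 1] that by simp
  obtain \<tau> where \<tau>: "\<tau> \<in> auto WG"
    "\<And>g g'. g \<in> carrier WG \<Longrightarrow> g' \<in> carrier WG \<Longrightarrow> intertwines U g g' \<Longrightarrow> \<tau> g = g'"
  proof (rule intertwiner_auto[of U])
    show "U i k \<noteq> 0" for i k by (simp add: U_def)
    show "i = j" if ij: "i < n" "j < n" and e: "\<And>k. k < n \<Longrightarrow> U i k = c * U j k" for i j c
      using ij e[of 0] e[of 1] n by (auto simp: U_def less_2_cases_iff)
    show "i = j" if ij: "i < n" "j < n" and e: "\<And>k. k < n \<Longrightarrow> U k i = c * U k j" for i j c
      using ij e[of 0] e[of 1] n by (auto simp: U_def less_2_cases_iff)
    have first: "intertwines U (first_tuple, id) (const_tuple n (-1), transpose 0 1)"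
      using zp n_gt unfolding intertwines_iff[OF n] all_less_two by (simp add: U_def first_tuple_def const_tuple_def)
    show "\<exists>g'\<in>carrier WG. intertwines U (first_tuple, id) g'"
      using first cN[of "-1"] s even_r by (auto simp: wreath_carrier)
    fix j assume "0 < j" "j < n"
    then have j: "j = 1" using n by simp
    have star: "intertwines U (\<lambda>_. 1, transpose 0 1) (y, id)"
      unfolding intertwines_iff[OF n] all_less_two by (simp add: U_def y_def)
    show "\<exists>g'\<in>carrier WG. intertwines U (\<lambda>_. 1, transpose 0 j) g'"
      unfolding j using star yN id by (auto simp: wreath_carrier)
    show "\<exists>g'\<in>carrier WG. intertwines U (root_tuple r j 0, id) g'"
    proof (cases "r = 4")
      case True
      have inv: "inverse (zeta r) = - zeta r"
        using i4[OF True] by (simp add: power2_eq_square inverse_unique)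
      have "intertwines U (root_tuple r 1 0, id) (const_tuple n (- zeta r), transpose 0 1)"
        using n_gt unfolding intertwines_iff[OF n] all_less_two by (simp add: U_def root_tuple_def const_tuple_def inv)
      then show ?thesis
        unfolding j using cN[of "- zeta r"] s zeta_r True by (auto simp: wreath_carrier)
    next
      case False
      then have z: "zeta r = -1" using i2 r by blast
      have "intertwines U (root_tuple r 1 0, id) (const_tuple n (-1), id)"
        using n_gt unfolding intertwines_iff[OF n] all_less_two by (simp add: U_def root_tuple_def const_tuple_def z)
      then show ?thesis
        unfolding j using cN[of "-1"] id even_r by (auto simp: wreath_carrier)
    qed
  qed (rule that)
  have "intertwines U (y, id) (\<lambda>_. 1, transpose 0 1)"
    unfolding intertwines_iff[OF n] all_less_two by (simp add: U_def y_def)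
  then have "\<tau> (y, id) = (\<lambda>_. 1, transpose 0 1)"
    using \<tau>(2)[OF torus_mem[OF yN] perm_mem[OF s]] by blast
  then show thesis using that \<tau>(1) yN by (metis (no_types, lifting) image_eqI)
qed

lemma swap_ne_id: "transpose 0 (1::nat) \<noteq> id"
  by (metis id_apply transpose_apply_first zero_neq_one)

lemma diag_tuple_one: "diag_tuple h 1 = (\<lambda>_. 1)"
  by (simp add: diag_tuple_def)

text \<open>G(2,1,2) is dihedral of order 8, and the images are its two Klein
  four-subgroups.\<close>

lemma orbit_212:
  assumes "r = 2" "p = 1" "n = 2" shows "card ((\<lambda>\<alpha>. \<alpha> ` NG) ` auto WG) = 2"
proof -
  have m: "m = 2" using assms by simp
  obtain \<tau> where \<tau>: "\<tau> \<in> auto WG" "(\<lambda>_. 1, transpose 0 1) \<in> \<tau> ` NG"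
    by (rule hadamard_auto[OF assms(3) m]) (use assms in auto)
  have "card ((\<lambda>\<alpha>. \<alpha> ` NG) ` auto WG) = Suc (card {1 :: complex})"
  proof (rule orbit_card[OF \<tau> swap_ne_id])
    fix \<alpha> assume \<alpha>: "\<alpha> \<in> auto WG" and ne: "\<alpha> ` NG \<noteq> NG"
    interpret L: rpn_other r p n "\<alpha> ` NG" by (rule other_of_auto[OF \<alpha> ne])
    show "{x \<in> N. (x, id) \<in> \<alpha> ` NG} = {x \<in> N. \<exists>c. x = const_tuple n c}"
      by (rule L.L0_eq_consts) (use card_torus m assms in simp)
    obtain a where a: "(a, transpose 0 1) \<in> \<alpha> ` NG" "a \<in> N" using L.swap_over[OF assms(3)] .
    have "a 0 * a 1 = 1" using other_square[OF \<alpha> assms(1) a(1), of 0] by simp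
    moreover have "a 0 * a 0 = 1" using torus_pow[OF a(2), of 0] assms(1) by (simp add: power2_eq_square)
    ultimately have "a 0 = a 1" by (metis mult_cancel_left mult_zero_left zero_neq_one)
    then have q: "a i / diag_tuple (transpose 0 1) 1 i = a 0" if "i < n" for i
      using that assms(3) by (auto simp: diag_tuple_one less_2_cases_iff)
    have "(\<lambda>i. a i / diag_tuple (transpose 0 1) 1 i) \<in> {x \<in> N. \<exists>c. x = const_tuple n c}"
      by (rule const_quotient[OF a(2) q])
         (use torus_pow[OF a(2), of 0] power_mult[of "a 0" 2 2] assms in \<open>simp_all add: diag_tuple_one\<close>)
    then show "\<exists>a z. (a, transpose 0 1) \<in> \<alpha> ` NG \<and> z \<in> {1} \<and>
        (\<lambda>i. a i / diag_tuple (transpose 0 1) z i) \<in> {x \<in> N. \<exists>c. x = const_tuple n c}"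
      using a(1) by blast
  qed auto
  then show ?thesis by simp
qed

text \<open>Modulo its centre of order 4 this group of order 16 is a Klein four-group; the images
  are the three intermediate subgroups of order 8.\<close>

lemma orbit_422:
  assumes "r = 4" "p = 2" "n = 2" shows "card ((\<lambda>\<alpha>. \<alpha> ` NG) ` auto WG) = 3"
proof -
  have m: "m = 2" using assms by simp
  have z2: "zeta r * zeta r = -1" using zeta_half[of 2] assms by (simp add: power2_eq_square)
  have z1: "zeta r \<noteq> 1" using z2 by auto
  let ?s = "transpose 0 (1::nat)"
  have sP: "?s permutes {..<n}" using n_gt by (intro permutes_swap_id) auto
  obtain \<tau> where \<tau>: "\<tau> \<in> auto WG" "(\<lambda>_. 1, ?s) \<in> \<tau> ` NG"
    by (rule hadamard_auto[OF assms(3) m]) (use assms in auto)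
  have "card ((\<lambda>\<alpha>. \<alpha> ` NG) ` auto WG) = Suc (card {1, zeta r})"
  proof (rule orbit_card[OF \<tau> swap_ne_id])
    show "z ^ r = 1" if "z \<in> {1, zeta r}" for z using that zeta_r by auto
    fix \<alpha> assume \<alpha>: "\<alpha> \<in> auto WG" and ne: "\<alpha> ` NG \<noteq> NG"
    interpret L: rpn_other r p n "\<alpha> ` NG" by (rule other_of_auto[OF \<alpha> ne])
    show "{x \<in> N. (x, id) \<in> \<alpha> ` NG} = {x \<in> N. \<exists>c. x = const_tuple n c}"
      by (rule L.L0_eq_consts) (use card_torus m assms in simp)
    obtain a where a: "(a, ?s) \<in> \<alpha> ` NG" "a \<in> N" using L.swap_over[OF assms(3)] .
    have a4: "a 0 ^ 4 = 1" using torus_pow[OF a(2), of 0] assms(1) by simp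
    have "(a 0 * a 1) ^ 2 = 1" using torus_prod[OF a(2)] m by (simp add: assms(3) prod_less_two)
    then have "(a 0)\<^sup>2 * (a 1)\<^sup>2 = (a 0)\<^sup>2 * (a 0)\<^sup>2"
      using a4 by (simp add: power_mult_distrib power_add[symmetric])
    then have "(a 1)\<^sup>2 = (a 0)\<^sup>2"
      by (rule mult_left_cancel[THEN iffD1, rotated]) (use torus_nz[OF a(2), of 0] in simp)
    then have "a 1 = a 0 \<or> a 1 = - a 0" by (simp add: power2_eq_iff)
    \<comment> \<open>If the two entries are opposite, dividing by (i, -i), the tuple of z = i =
      \<open>zeta r\<close>, leaves a scalar.\<close>
    then have "\<exists>z\<in>{1, zeta r}. (\<lambda>i. a i / diag_tuple ?s z i) \<in> {x \<in> N. \<exists>c. x = const_tuple n c}"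
    proof
      assume "a 1 = a 0"
      then have q: "a i / diag_tuple ?s 1 i = a 0" if "i < n" for i
        using that assms(3) by (auto simp: diag_tuple_one less_2_cases_iff)
      have "(\<lambda>i. a i / diag_tuple ?s 1 i) \<in> {x \<in> N. \<exists>c. x = const_tuple n c}"
        by (rule const_quotient[OF a(2) q]) (use a4 assms m in \<open>simp_all add: diag_tuple_one\<close>)
      then show ?thesis by blast
    next
      assume a1: "a 1 = - a 0"
      have i: "1 / zeta r = - zeta r" using z2 by (simp add: divide_eq_eq)
      have q: "a i / diag_tuple ?s (zeta r) i = - a 0 * zeta r" if "i < n" for i
      proof -
        have "a 0 / zeta r = a 0 * (1 / zeta r)" by simp
        then have "a 0 / zeta r = - a 0 * zeta r" unfolding i by simp
        then show ?thesis using that assms(3) a1 by (auto simp: diag_tuple_def less_2_cases_iff)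
      qed
      have c4: "(- a 0 * zeta r) ^ 4 = 1"
        using a4 zeta_r assms(1) by (simp add: power_mult_distrib)
      have "(\<lambda>i. a i / diag_tuple ?s (zeta r) i) \<in> {x \<in> N. \<exists>c. x = const_tuple n c}"
        by (rule const_quotient[OF a(2) q diag_tuple_out[OF _ sP]]) (use c4 assms m in simp_all)
      then show ?thesis by blast
    qed
    then show "\<exists>a z. (a, ?s) \<in> \<alpha> ` NG \<and> z \<in> {1, zeta r} \<and>
        (\<lambda>i. a i / diag_tuple ?s z i) \<in> {x \<in> N. \<exists>c. x = const_tuple n c}"
      using a(1) by blast
  next
    fix z z' assume z: "z \<in> {1, zeta r}" "z' \<in> {1, zeta r}"
      and "(\<lambda>i. diag_tuple ?s z i / diag_tuple ?s z' i) \<in> {x \<in> N. \<exists>c. x = const_tuple n c}"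
    then obtain c where c: "(\<lambda>i. diag_tuple ?s z i / diag_tuple ?s z' i) = const_tuple n c" by blast
    have "z / z' = z' / z"
      using fun_cong[OF c, of 0] fun_cong[OF c, of 1] n_gt by (simp add: diag_tuple_def const_tuple_def)
    moreover have "z \<noteq> 0" "z' \<noteq> 0" using z by auto
    ultimately have "z * z = z' * z'" by (simp add: field_simps)
    then show "z = z'" using z z2 by auto
  qed auto
  then show ?thesis using z1 by simp
qed

text \<open>G(2,2,2) is a Klein four-group, and the images are its three subgroups of order 2. The
  diagonal subgroup consists of the scalars 1, -1, which no matrix conjugation can move, so an
  automorphism is written down directly.\<close>

lemma orbit_222:
  assumes "r = 2" "p = 2" "n = 2" shows "card ((\<lambda>\<alpha>. \<alpha> ` NG) ` auto WG) = 3"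
proof -
  have m: "m = 1" using assms by simp
  let ?s = "transpose 0 (1::nat)"
  have sP: "?s permutes {..<n}" using n_gt by (intro permutes_swap_id) auto
  have sq: "x 0 * x 0 = 1" "x 1 = x 0" if "x \<in> N" for x
  proof -
    show 0: "x 0 * x 0 = 1" using torus_pow[OF that, of 0] assms(1) by (simp add: power2_eq_square)
    have "x 0 * x 1 = 1" using torus_prod[OF that] m by (simp add: assms(3) prod_less_two)
    then show "x 1 = x 0" using 0 by (metis mult_cancel_left mult_zero_left zero_neq_one)
  qed
  have pm: "x 0 = 1 \<or> x 0 = -1" if "x \<in> N" for x
    using sq[OF that] by (simp add: square_eq_1_iff)
  have two: "w = id \<or> w = ?s" if "w permutes {..<n}" for w
    using that permutes_two_cases assms(3) by blast
  have sgn: "sign ?s = -1" "sign (id :: nat \<Rightarrow> nat) = 1" by (simp_all add: sign_swap_id)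
  \<comment> \<open>Exchanges the scalar -1 with the swap.\<close>
  define \<tau> where "\<tau> = (\<lambda>(x :: nat \<Rightarrow> complex, w :: nat \<Rightarrow> nat).
    (const_tuple n (of_int (sign w)), if x 0 = 1 then id else ?s))"
  have cN: "const_tuple n (of_int (sign w)) \<in> N" for w :: "nat \<Rightarrow> nat"
    unfolding const_tuple_in_torus using assms m sign_even_pow[of 2 w] by simp
  have \<tau>: "restrict \<tau> (carrier WG) \<in> auto WG"
  proof (rule restrict_autoI[OF finite_wreath])
    show "\<tau> g \<in> carrier WG" for g
      using cN sP permutes_id by (cases g) (simp add: \<tau>_def wreath_carrier)
    show "inj_on \<tau> (carrier WG)"
    proof (rule inj_onI)
      fix g h assume gh: "g \<in> carrier WG" "h \<in> carrier WG" and eq: "\<tau> g = \<tau> h"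
      obtain x w y v where xw: "g = (x, w)" "h = (y, v)" by (cases g; cases h)
      with gh have x: "x \<in> N" "y \<in> N" and w: "w permutes {..<n}" "v permutes {..<n}"
        by (auto simp: wreath_carrier)
      have "(of_int (sign w) :: complex) = of_int (sign v)"
        using arg_cong[OF eq, of "\<lambda>g. fst g 0"] n_gt by (simp add: \<tau>_def xw const_tuple_def)
      then have "w = v" using two[OF w(1)] two[OF w(2)] sgn by auto
      have "x 0 = y 0" using eq pm[OF x(1)] pm[OF x(2)] swap_ne_id by (auto simp: \<tau>_def xw split: if_splits)
      have "x i = y i" for i
        using sq[OF x(1)] sq[OF x(2)] \<open>x 0 = y 0\<close> torus_out[OF x(1), of i] torus_out[OF x(2), of i] assms(3)
        by (cases "i < 2") (auto simp: less_2_cases_iff)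
      then show "g = h" using \<open>w = v\<close> by (auto simp: xw)
    qed
    fix g h assume gh: "g \<in> carrier WG" "h \<in> carrier WG"
    obtain x w y v where xw: "g = (x, w)" "h = (y, v)" by (cases g; cases h)
    with gh have x: "x \<in> N" "y \<in> N" and w: "w permutes {..<n}" "v permutes {..<n}"
      by (auto simp: wreath_carrier)
    have "sign (v \<circ> w) = sign w * sign v"
      using w by (simp add: sign_compose permutes_imp_permutation[of "{..<n}"])
    moreover have "y (w 0) = y 0" using two[OF w(1)] sq(2)[OF x(2)] by auto
    moreover have "u i < n \<longleftrightarrow> i < n" if "u = id \<or> u = ?s" for u i
      using that permutes_in_image[OF sP, of i] by auto
    ultimately show "\<tau> (g \<otimes>\<^bsub>WG\<^esub> h) = \<tau> g \<otimes>\<^bsub>WG\<^esub> \<tau> h"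
      using pm[OF x(1)] pm[OF x(2)] by (auto simp: xw \<tau>_def wreath_mult const_tuple_def fun_eq_iff)
  qed simp
  have neg: "const_tuple n (-1) \<in> N" using cN[of ?s] sgn by simp
  have "restrict \<tau> (carrier WG) (const_tuple n (-1), id) = (\<lambda>_. 1, ?s)"
    using torus_mem[OF neg] n_gt by (auto simp: \<tau>_def const_tuple_def sgn)
  then have mem: "(\<lambda>_. 1, ?s) \<in> restrict \<tau> (carrier WG) ` NG"
    using neg by (intro image_eqI[of _ _ "(const_tuple n (-1), id)"]) auto
  have "card ((\<lambda>\<alpha>. \<alpha> ` NG) ` auto WG) = Suc (card {1, -1 :: complex})"
  proof (rule orbit_card[OF \<tau> mem swap_ne_id])
    show "z ^ r = 1" if "z \<in> {1, -1}" for z :: complex using that assms by auto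
    fix \<alpha> assume \<alpha>: "\<alpha> \<in> auto WG" and ne: "\<alpha> ` NG \<noteq> NG"
    interpret L: rpn_other r p n "\<alpha> ` NG" by (rule other_of_auto[OF \<alpha> ne])
    show "{x \<in> N. (x, id) \<in> \<alpha> ` NG} = {\<lambda>_. 1}"
      by (rule L.L0_eq_one) (use card_torus m assms in simp)
    obtain a where a: "(a, ?s) \<in> \<alpha> ` NG" "a \<in> N" using L.swap_over[OF assms(3)] .
    have "(\<lambda>i. a i / diag_tuple ?s (a 0) i) = (\<lambda>_. 1)"
    proof
      fix i
      show "a i / diag_tuple ?s (a 0) i = 1"
        using sq[OF a(2)] torus_nz[OF a(2), of 0] torus_out[OF a(2), of i] assms(3) diag_tuple_out[OF _ sP, of i "a 0"]
        by (cases "i < 2") (auto simp: less_2_cases_iff diag_tuple_def)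
    qed
    then show "\<exists>a z. (a, ?s) \<in> \<alpha> ` NG \<and> z \<in> {1, -1} \<and> (\<lambda>i. a i / diag_tuple ?s z i) \<in> {\<lambda>_. 1}"
      using a(1) pm[OF a(2)] by auto
  next
    fix z z' :: complex assume z: "z \<in> {1, -1}" "z' \<in> {1, -1}"
      and "(\<lambda>i. diag_tuple ?s z i / diag_tuple ?s z' i) \<in> {\<lambda>_. 1}"
    then have "(\<lambda>i. diag_tuple ?s z i / diag_tuple ?s z' i) = (\<lambda>_. 1)" by blast
    from fun_cong[OF this, of 0] show "z = z'" using z by (auto simp: diag_tuple_def)
  qed auto
  then show ?thesis by simp
qed

end

context rpn
begin

text \<open>The matrix \<open>U\<close> is the Fourier matrix of order 3, which takes diagonal
  matrices to cyclic shifts. The images are the four subgroups of order 9 containing the scalars in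
  the Heisenberg group of order 27 generated by the diagonal matrices and the shift.\<close>

lemma orbit_333:
  assumes "r = 3" "p = 3" "n = 3" shows "card ((\<lambda>\<alpha>. \<alpha> ` NG) ` auto WG) = 4"
proof -
  have m: "m = 1" using assms by simp
  let ?h = "transpose 0 1 \<circ> transpose 1 (2::nat)"
  define z where "z = zeta r"
  have z3: "z * (z * z) = 1" using zeta_r assms by (simp add: z_def power3_eq_cube mult.assoc)
  have zi: "inverse z = z * z" using z3 by (metis inverse_unique)
  have z_nz: "z \<noteq> 0" by (simp add: z_def)
  have z4: "z * (z * (z * c)) = c" for c using z3 by (metis mult.assoc mult_1)
  have P: "transpose a b permutes {..<n}" if "a < 3" "b < 3" for a b
    using that assms(3) by (intro permutes_swap_id) auto
  have hP: "?h permutes {..<n}" by (intro permutes_compose P) auto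
  have h_ne: "?h \<noteq> id"
  proof
    assume "?h = id"
    from fun_cong[OF this, of 0] show False by (simp add: transpose_def)
  qed
  have hv: "?h 0 = 1" "?h 1 = 2" "?h 2 = 0" by (simp_all add: transpose_def)
  have idP: "id permutes {..<n}" by (rule permutes_id)
  define U :: "nat \<Rightarrow> nat \<Rightarrow> complex" where "U = (\<lambda>i k. z ^ (i * k))"
  have cN: "const_tuple n (z * z) \<in> N"
    unfolding const_tuple_in_torus using assms m z3 z4 by (simp add: power3_eq_cube mult.assoc)
  define y :: "nat \<Rightarrow> nat \<Rightarrow> complex" where "y = (\<lambda>j i. if i < 3 then z ^ (i * j) else 1)"
  have yN: "y j \<in> N" for j
  proof (rule torusI)
    have "(z ^ k) ^ 3 = 1" for k
      using z3 by (metis power3_eq_cube mult.assoc power_mult power_one mult.commute)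
    then show "y j i ^ r = 1" for i using assms(1) by (simp add: y_def)
    have "y j 0 * y j 1 * y j 2 = (z * (z * z)) ^ j"
      by (simp add: y_def power_mult_distrib power2_eq_square power_mult mult.assoc)
    then show "(\<Prod>i<n. y j i) ^ m = 1" using z3 by (simp add: assms(3) prod_less_three)
  qed (simp add: y_def assms)
  obtain \<tau> where \<tau>: "\<tau> \<in> auto WG"
    "\<And>g g'. g \<in> carrier WG \<Longrightarrow> g' \<in> carrier WG \<Longrightarrow> intertwines U g g' \<Longrightarrow> \<tau> g = g'"
  proof (rule intertwiner_auto[of U])
    show "U i k \<noteq> 0" for i k using z_nz by (simp add: U_def)
    have ij: "i = j" if "i < n" "j < n" "z ^ i = z ^ j" for i j
      using zeta_pow_inj[of i j] that assms unfolding z_def by simp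
    show "i = j" if "i < n" "j < n" and e: "\<And>k. k < n \<Longrightarrow> U i k = c * U j k" for i j c
      using ij[OF that(1,2)] e[of 0] e[of 1] n_gt by (simp add: U_def)
    show "i = j" if "i < n" "j < n" and e: "\<And>k. k < n \<Longrightarrow> U k i = c * U k j" for i j c
      using ij[OF that(1,2)] e[of 0] e[of 1] n_gt by (simp add: U_def)
    have "zeta r ^ p = 1" using zeta_r assms(1,2) by metis
    then have "first_tuple = (\<lambda>_. 1)" by (auto simp: first_tuple_def)
    then have "intertwines U (first_tuple, id) (\<lambda>_. 1, id)" by (simp add: intertwines_def)
    then show "\<exists>g'\<in>carrier WG. intertwines U (first_tuple, id) g'"
      using W.one_closed unfolding wreath_one by blast
    fix j assume "0 < j" "j < n"
    then consider (one) "j = 1" | (two) "j = 2" using assms(3) by linarith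
    note j = this
    have star: "intertwines U (\<lambda>_. 1, transpose 0 j) (y j, transpose 1 2)"
      unfolding intertwines_iff[OF assms(3)] all_less_three
      by (cases rule: j)
         (simp_all add: U_def y_def transpose_def numeral_eq_Suc z3 z4 mult.assoc)
    show "\<exists>g'\<in>carrier WG. intertwines U (\<lambda>_. 1, transpose 0 j) g'"
      using star yN P[of 1 2] by (auto simp: wreath_carrier)
    have "intertwines U (root_tuple r j 0, id)
      (const_tuple n (z * z), if j = 1 then ?h \<circ> ?h else ?h)"
      unfolding intertwines_iff[OF assms(3)] all_less_three
      by (cases rule: j)
         (simp_all add: U_def root_tuple_def const_tuple_def transpose_def numeral_eq_Suc z3 z4
            mult.assoc assms(3) zi z_def[symmetric])
    then show "\<exists>g'\<in>carrier WG. intertwines U (root_tuple r j 0, id) g'"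
      using cN hP permutes_compose[OF hP hP]
      by (intro bexI[of _ "(const_tuple n (z * z), if j = 1 then ?h \<circ> ?h else ?h)"])
         (simp_all add: wreath_carrier)
  qed (rule that)
  have "intertwines U (y 1, id) (\<lambda>_. 1, ?h)"
    unfolding intertwines_iff[OF assms(3)] all_less_three
    by (simp add: U_def y_def transpose_def numeral_eq_Suc z3 z4 mult.assoc)
  then have "\<tau> (y 1, id) = (\<lambda>_. 1, ?h)"
    using \<tau>(2)[OF torus_mem[OF yN] perm_mem[OF hP]] by blast
  then have mem: "(\<lambda>_. 1, ?h) \<in> \<tau> ` NG"
    using yN[of 1] by (intro image_eqI[of _ _ "(y 1, id)"]) auto
  have "card ((\<lambda>\<alpha>. \<alpha> ` NG) ` auto WG) = Suc (card {z :: complex. z ^ 3 = 1})"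
  proof (rule orbit_card[OF \<tau>(1) mem h_ne])
    show "finite {z :: complex. z ^ 3 = 1}" by (rule finite_roots_unity) simp
    show "z ^ r = 1" if "z \<in> {z. z ^ 3 = 1}" for z :: complex using that assms by simp
    fix \<alpha> assume \<alpha>: "\<alpha> \<in> auto WG" and ne: "\<alpha> ` NG \<noteq> NG"
    interpret L: rpn_other r p n "\<alpha> ` NG" by (rule other_of_auto[OF \<alpha> ne])
    show "{x \<in> N. (x, id) \<in> \<alpha> ` NG} = {x \<in> N. \<exists>c. x = const_tuple n c}"
      by (rule L.L0_eq_consts) (use card_torus m assms in simp)
    obtain a where a: "(a, ?h) \<in> \<alpha> ` NG" "a \<in> N" using L.shift_over[OF assms(3)] .
    have a3: "a i ^ 3 = 1" for i using torus_pow[OF a(2), of i] assms(1) by simp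
    have nz: "a i \<noteq> 0" for i by (rule torus_nz[OF a(2)])
    have pr: "a 0 * a 1 * a 2 = 1" using torus_prod[OF a(2)] m by (simp add: assms(3) prod_less_three)
    \<comment> \<open>The tuple belonging to z = a 0 / a 1 is (z, 1, 1/z); dividing by it leaves the
      scalar a 1, at position 2 because a 0 a 1 a 2 = 1 and a 1 is a cube root of unity.\<close>
    have "a 2 / (1 / (a 0 / a 1)) = a 1"
    proof -
      have "a 0 * a 2 * a 1 = a 1 * a 1 * a 1"
        using pr a3[of 1] by (simp add: power3_eq_cube ac_simps)
      then have "a 0 * a 2 = a 1 * a 1" using nz[of 1] by simp
      then show ?thesis using nz[of 1] by (simp add: field_simps)
    qed
    then have q: "a i / diag_tuple ?h (a 0 / a 1) i = a 1" if "i < n" for i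
    proof -
      consider "i = 0" | "i = 1" | "i = 2" using \<open>i < n\<close> assms(3) by linarith
      then show ?thesis
        using hv nz \<open>a 2 / (1 / (a 0 / a 1)) = a 1\<close> by cases (simp_all add: diag_tuple_def del: comp_apply)
    qed
    have "(\<lambda>i. a i / diag_tuple ?h (a 0 / a 1) i) \<in> {x \<in> N. \<exists>c. x = const_tuple n c}"
      by (rule const_quotient[OF a(2) q diag_tuple_out[OF _ hP]]) (use a3[of 1] assms m in simp_all)
    moreover have "a 0 / a 1 \<in> {z. z ^ 3 = 1}" using a3 by (simp add: power_divide)
    ultimately show "\<exists>a z. (a, ?h) \<in> \<alpha> ` NG \<and> z \<in> {z. z ^ 3 = 1} \<and>
        (\<lambda>i. a i / diag_tuple ?h z i) \<in> {x \<in> N. \<exists>c. x = const_tuple n c}"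
      using a(1) by blast
  next
    fix z z' :: complex assume z: "z \<in> {z. z ^ 3 = 1}" "z' \<in> {z. z ^ 3 = 1}"
      and "(\<lambda>i. diag_tuple ?h z i / diag_tuple ?h z' i) \<in> {x \<in> N. \<exists>c. x = const_tuple n c}"
    then obtain c where c: "(\<lambda>i. diag_tuple ?h z i / diag_tuple ?h z' i) = const_tuple n c" by blast
    have "z / z' = 1"
      using fun_cong[OF c, of 0] fun_cong[OF c, of 1] hv assms(3)
      by (simp add: diag_tuple_def const_tuple_def del: comp_apply)
    then show "z = z'" by (metis div_0 divide_eq_1_iff)
  qed
  then show ?thesis using card_roots_unity_eq[of 3] by simp
qed

text \<open>G(2,2,4) is the Weyl group of type D_4, and the three images reflect triality.
  \<open>U\<close> is the character table of the Klein four-group.\<close>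

lemma orbit_224:
  assumes "r = 2" "p = 2" "n = 4" shows "card ((\<lambda>\<alpha>. \<alpha> ` NG) ` auto WG) = 3"
proof -
  have m: "m = 1" using assms by simp
  let ?h = "transpose 0 1 \<circ> transpose 2 (3::nat)"
  have P: "transpose a b permutes {..<n}" if "a < 4" "b < 4" for a b
    using that assms(3) by (intro permutes_swap_id) auto
  have hP: "?h permutes {..<n}" by (intro permutes_compose P) auto
  have h_ne: "?h \<noteq> id"
  proof
    assume "?h = id"
    from fun_cong[OF this, of 0] show False by (simp add: transpose_def)
  qed
  have hv: "?h 0 = 1" "?h 1 = 0" "?h 2 = 3" "?h 3 = 2" by (simp_all add: transpose_def)
  define U :: "nat \<Rightarrow> nat \<Rightarrow> complex" where "U = (\<lambda>i k. if i \<noteq> 0 \<and> k \<noteq> 0 \<and> i \<noteq> k then -1 else 1)"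
  have cN: "const_tuple n (-1) \<in> N"
    unfolding const_tuple_in_torus using assms m by simp
  define y :: "nat \<Rightarrow> nat \<Rightarrow> nat \<Rightarrow> complex" where "y = (\<lambda>a b i. if i = a \<or> i = b then -1 else 1)"
  have yN: "y a b \<in> N" if "a < 4" "b < 4" "a \<noteq> b" for a b
  proof (rule torusI)
    have "(\<Prod>i<n. y a b i) = (\<Prod>i\<in>{a, b}. y a b i)"
      using that assms(3) by (intro prod.mono_neutral_right) (auto simp: y_def)
    then show "(\<Prod>i<n. y a b i) ^ m = 1" using that by (simp add: y_def)
  qed (use that assms in \<open>auto simp: y_def\<close>)
  have z1: "zeta r = -1" using zeta_half[of 1] assms by simp
  obtain \<tau> where \<tau>: "\<tau> \<in> auto WG"
    "\<And>g g'. g \<in> carrier WG \<Longrightarrow> g' \<in> carrier WG \<Longrightarrow> intertwines U g g' \<Longrightarrow> \<tau> g = g'"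
  proof (rule intertwiner_auto[of U])
    show "U i k \<noteq> 0" for i k by (simp add: U_def)
    show "i = j" if "i < n" "j < n" and e: "\<And>k. k < n \<Longrightarrow> U i k = c * U j k" for i j c
    proof -
      have "c = 1" "U i 1 = U j 1" "U i 2 = U j 2" "U i 3 = U j 3"
        using e[of 0] e[of 1] e[of 2] e[of 3] assms(3) by (auto simp: U_def)
      moreover have "i \<in> {0, 1, 2, 3}" "j \<in> {0, 1, 2, 3}" using that assms(3) by auto
      ultimately show ?thesis by (auto simp: U_def)
    qed
    show "i = j" if "i < n" "j < n" and e: "\<And>k. k < n \<Longrightarrow> U k i = c * U k j" for i j c
    proof -
      have "c = 1" "U 1 i = U 1 j" "U 2 i = U 2 j" "U 3 i = U 3 j"
        using e[of 0] e[of 1] e[of 2] e[of 3] assms(3) by (auto simp: U_def)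
      moreover have "i \<in> {0, 1, 2, 3}" "j \<in> {0, 1, 2, 3}" using that assms(3) by auto
      ultimately show ?thesis by (auto simp: U_def)
    qed
    have "zeta r ^ p = 1" using zeta_r assms(1,2) by metis
    then have "first_tuple = (\<lambda>_. 1)" by (auto simp: first_tuple_def)
    then have "intertwines U (first_tuple, id) (\<lambda>_. 1, id)" by (simp add: intertwines_def)
    then show "\<exists>g'\<in>carrier WG. intertwines U (first_tuple, id) g'"
      using W.one_closed unfolding wreath_one by blast
    fix j assume "0 < j" "j < n"
    \<comment> \<open>The indices j, a, b exhaust {1, 2, 3}: \<open>U\<close> takes (0 j) to (a b)
      with entries -1 at a and b.\<close>
    then consider (one) "j = 1" | (two) "j = 2" | (three) "j = 3" using assms(3) by linarith
    then obtain a b :: nat where j: "(j, a, b) \<in> {(1, 2, 3), (2, 1, 3), (3, 1, 2 :: nat)}"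
      by cases auto
    then have ab: "a < 4" "b < 4" "a \<noteq> b" and jlt: "j < 4" by auto
    have star: "intertwines U (\<lambda>_. 1, transpose 0 j) (y a b, transpose a b)"
      unfolding intertwines_iff[OF assms(3)] all_less_four
      using j by (elim insertE emptyE) (simp_all add: U_def y_def transpose_def)
    show "\<exists>g'\<in>carrier WG. intertwines U (\<lambda>_. 1, transpose 0 j) g'"
      using star yN[OF ab] P[OF ab(1,2)] by (auto simp: wreath_carrier)
    have root: "intertwines U (root_tuple r j 0, id) (const_tuple n (-1), transpose 0 j \<circ> transpose a b)"
      unfolding intertwines_iff[OF assms(3)] all_less_four
      using j by (elim insertE emptyE)
        (simp_all add: U_def root_tuple_def const_tuple_def transpose_def assms(3) z1)
    show "\<exists>g'\<in>carrier WG. intertwines U (root_tuple r j 0, id) g'"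
      using root cN permutes_compose[OF P[OF ab(1,2)] P[of 0 j]] jlt by (auto simp: wreath_carrier)
  qed (rule that)
  have "intertwines U (y 2 3, id) (\<lambda>_. 1, ?h)"
    unfolding intertwines_iff[OF assms(3)] all_less_four
    by (simp add: U_def y_def transpose_def)
  then have "\<tau> (y 2 3, id) = (\<lambda>_. 1, ?h)"
    using \<tau>(2)[OF torus_mem[OF yN] perm_mem[OF hP]] by simp
  then have mem: "(\<lambda>_. 1, ?h) \<in> \<tau> ` NG"
    using yN[of 2 3] by (intro image_eqI[of _ _ "(y 2 3, id)"]) auto
  have "card ((\<lambda>\<alpha>. \<alpha> ` NG) ` auto WG) = Suc (card {1, -1 :: complex})"
  proof (rule orbit_card[OF \<tau>(1) mem h_ne])
    show "z ^ r = 1" if "z \<in> {1, -1}" for z :: complex using that assms by auto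
    fix \<alpha> assume \<alpha>: "\<alpha> \<in> auto WG" and ne: "\<alpha> ` NG \<noteq> NG"
    interpret L: rpn_other r p n "\<alpha> ` NG" by (rule other_of_auto[OF \<alpha> ne])
    have Z: "{x \<in> N. (x, id) \<in> \<alpha> ` NG} = {x \<in> N. \<exists>c. x = const_tuple n c}"
      by (rule L.L0_eq_consts) (use card_torus m assms in simp)
    then show "{x \<in> N. (x, id) \<in> \<alpha> ` NG} = {x \<in> N. \<exists>c. x = const_tuple n c}" .
    obtain a where a: "(a, ?h) \<in> \<alpha> ` NG" "a \<in> N" using L.double_over[OF assms(3)] .
    have a2: "a i * a i = 1" for i using torus_pow[OF a(2), of i] assms(1) by (simp add: power2_eq_square)
    have nz: "a i \<noteq> 0" for i by (rule torus_nz[OF a(2)])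
    \<comment> \<open>Conjugation by an involution \<open>u\<close> commuting with \<open>?h\<close>
      gives another element of the image over \<open>?h\<close>, so a / (a o u) is constant. The
      second disjunct is refuted by taking for l a fixed point of \<open>u\<close>, which makes the
      constant 1.\<close>
    have sym: "a i = a (u i) \<or> a l \<noteq> a (u l)"
      if u: "u permutes {..<n}" "u \<circ> ?h \<circ> u = ?h" "u \<circ> u = id" and il: "i < n" "l < n" for u i l
    proof -
      have "inv_into UNIV u = u" by (rule inv_unique_comp[OF u(3) u(3)])
      then have pc: "perm_conj u (a, ?h) = (\<lambda>i. a (u i), ?h)"
        unfolding perm_conj_def prod.case by (simp only: u(2))
      then have m2: "(\<lambda>i. a (u i), ?h) \<in> \<alpha> ` NG" using L.L_conj[OF u(1) a(1)] by simp
      have "(a, ?h) \<otimes>\<^bsub>WG\<^esub> inv\<^bsub>WG\<^esub> (\<lambda>i. a (u i), ?h) \<in> \<alpha> ` NG"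
        using subgroup.m_closed[OF L.L_sub a(1) subgroup.m_inv_closed[OF L.L_sub m2]] .
      then have q: "(\<lambda>i. a i / a (u i), id) \<in> \<alpha> ` NG"
        using mult_inv_same_perm[OF L.L_mem[OF a(1)] L.L_mem[OF m2]] by simp
      then have "(\<lambda>i. a i / a (u i)) \<in> N" using L.L_mem[OF q] by (simp add: wreath_carrier)
      then obtain c where c: "(\<lambda>i. a i / a (u i)) = const_tuple n c" using Z q by blast
      have "a i / a (u i) = a l / a (u l)"
        using fun_cong[OF c, of i] fun_cong[OF c, of l] il by (simp add: const_tuple_def)
      then show ?thesis using nz[of "u i"] nz[of "u l"] by (auto simp: field_simps)
    qed
    have a01: "a 0 = a 1"
    proof -
      have "transpose 0 1 \<circ> ?h \<circ> transpose 0 1 = ?h" by (auto simp: fun_eq_iff transpose_def)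
      from sym[OF P[of 0 1] this _, of 0 2] show ?thesis using assms(3) by (simp add: transpose_def)
    qed
    have a23: "a 2 = a 3"
    proof -
      have "transpose 2 3 \<circ> ?h \<circ> transpose 2 3 = ?h" by (auto simp: fun_eq_iff transpose_def)
      from sym[OF P[of 2 3] this _, of 2 0] show ?thesis using assms(3) by (simp add: transpose_def)
    qed
    \<comment> \<open>The tuple \<open>a\<close> is now (a 0, a 0, a 2, a 2) with entries 1 or -1,
      and z is the ratio of its two halves; dividing out the tuple of z leaves the scalar a
      2.\<close>
    define z where "z = a 0 * a 2"
    have "z * z = (a 0 * a 0) * (a 2 * a 2)" by (simp add: z_def ac_simps)
    then have zz: "z * z = 1" using a2 by simp
    then have z: "z \<in> {1, -1}" by (simp add: square_eq_1_iff)
    have inv: "1 / z = z" using zz by (metis divide_eq_eq mult_zero_left zero_neq_one)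
    have q0: "a 0 / z = a 2"
    proof -
      have "a 0 / z = a 0 * (1 / z)" by simp
      also have "\<dots> = (a 0 * a 0) * a 2" unfolding inv by (simp add: z_def ac_simps)
      finally show ?thesis using a2 by simp
    qed
    have q: "a i / diag_tuple ?h z i = a 2" if "i < n" for i
    proof -
      consider "i = 0" | "i = 1" | "i = 2" | "i = 3" using \<open>i < n\<close> assms(3) by linarith
      then show ?thesis
        using hv q0 inv a01 a23 by cases (simp_all add: diag_tuple_def del: comp_apply)
    qed
    have "(\<lambda>i. a i / diag_tuple ?h z i) \<in> {x \<in> N. \<exists>c. x = const_tuple n c}"
      by (rule const_quotient[OF a(2) q diag_tuple_out[OF _ hP]])
         (use a2[of 2] power_mult[of "a 2" 2 2] assms m in \<open>simp_all add: power2_eq_square\<close>)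
    then show "\<exists>a z. (a, ?h) \<in> \<alpha> ` NG \<and> z \<in> {1, -1} \<and>
        (\<lambda>i. a i / diag_tuple ?h z i) \<in> {x \<in> N. \<exists>c. x = const_tuple n c}"
      using a(1) z by blast
  next
    fix z z' :: complex assume z: "z \<in> {1, -1}" "z' \<in> {1, -1}"
      and "(\<lambda>i. diag_tuple ?h z i / diag_tuple ?h z' i) \<in> {x \<in> N. \<exists>c. x = const_tuple n c}"
    then obtain c where c: "(\<lambda>i. diag_tuple ?h z i / diag_tuple ?h z' i) = const_tuple n c" by blast
    have "z / z' = 1"
      using fun_cong[OF c, of 0] fun_cong[OF c, of 2] hv assms(3)
      by (simp add: diag_tuple_def const_tuple_def del: comp_apply)
    then show "z = z'" by (metis div_0 divide_eq_1_iff)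
  qed auto
  then show ?thesis by simp
qed

lemma orbit_generic:
  assumes "(r, p, n) \<notin> {(2, 1, 2), (2, 2, 2), (4, 2, 2), (3, 3, 3), (2, 2, 4)}"
  shows "card ((\<lambda>\<alpha>. \<alpha> ` NG) ` auto WG) = 1"
proof -
  have "\<alpha> ` NG = NG" if \<alpha>: "\<alpha> \<in> auto WG" for \<alpha>
  proof (rule ccontr)
    assume ne: "\<alpha> ` NG \<noteq> NG"
    interpret L: rpn_other r p n "\<alpha> ` NG" by (rule other_of_auto[OF \<alpha> ne])
    show False using L.params assms torus_char_442[OF \<alpha>] ne by auto
  qed
  then have "(\<lambda>\<alpha>. \<alpha> ` NG) ` auto WG = {NG}"
    using W.id_in_auto by blast
  then show ?thesis by simp
qed

end

section \<open>The outer automorphism of the symmetric group on six letters\<close>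

text \<open>Entry \<open>syntheme_table ! i ! j\<close> lists the fixed-point-free involution (syntheme) of
  \<open>{0..5}\<close> shared by the \<open>i\<close>th and the \<open>j\<close>th of the six synthematic totals; the symmetric group
  permutes the totals, which is the outer automorphism. \<open>star_table ! k\<close> is the permutation of
  the totals induced by the transposition \<open>(0 k)\<close>.\<close>

definition syntheme_table :: "nat list list list" where
  "syntheme_table =
    [[[0, 1, 2, 3, 4, 5], [1, 0, 3, 2, 5, 4], [5, 2, 1, 4, 3, 0], [4, 3, 5, 1, 0, 2], [3, 5, 4, 0, 2, 1], [2, 4, 0, 5, 1, 3]],
     [[1, 0, 3, 2, 5, 4], [0, 1, 2, 3, 4, 5], [3, 4, 5, 0, 1, 2], [2, 5, 0, 4, 3, 1], [4, 2, 1, 5, 0, 3], [5, 3, 4, 1, 2, 0]],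
     [[5, 2, 1, 4, 3, 0], [3, 4, 5, 0, 1, 2], [0, 1, 2, 3, 4, 5], [1, 0, 4, 5, 2, 3], [2, 3, 0, 1, 5, 4], [4, 5, 3, 2, 0, 1]],
     [[4, 3, 5, 1, 0, 2], [2, 5, 0, 4, 3, 1], [1, 0, 4, 5, 2, 3], [0, 1, 2, 3, 4, 5], [5, 4, 3, 2, 1, 0], [3, 2, 1, 0, 5, 4]],
     [[3, 5, 4, 0, 2, 1], [4, 2, 1, 5, 0, 3], [2, 3, 0, 1, 5, 4], [5, 4, 3, 2, 1, 0], [0, 1, 2, 3, 4, 5], [1, 0, 5, 4, 3, 2]],
     [[2, 4, 0, 5, 1, 3], [5, 3, 4, 1, 2, 0], [4, 5, 3, 2, 0, 1], [3, 2, 1, 0, 5, 4], [1, 0, 5, 4, 3, 2], [0, 1, 2, 3, 4, 5]]]"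

definition star_table :: "nat list list" where
  "star_table = [[], [1, 0, 3, 2, 5, 4], [5, 3, 4, 1, 2, 0], [4, 2, 1, 5, 0, 3], [3, 4, 5, 0, 1, 2], [2, 5, 0, 4, 3, 1]]"

definition list_perm :: "nat list \<Rightarrow> nat \<Rightarrow> nat" where
  "list_perm xs x = (if x < 6 then xs ! x else x)"

definition syntheme :: "nat \<Rightarrow> nat \<Rightarrow> nat \<Rightarrow> nat" where
  "syntheme i j = list_perm (syntheme_table ! i ! j)"

text \<open>Conjugation by \<open>w\<close> carries the syntheme shared by the totals i and j to the
  one shared by u i and u j: \<open>u\<close> is the action of \<open>w\<close> on the
  totals.\<close>

definition totals_action :: "(nat \<Rightarrow> nat) \<Rightarrow> (nat \<Rightarrow> nat) \<Rightarrow> bool" where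
  "totals_action w u \<longleftrightarrow> (\<forall>i<6. \<forall>j<6. \<forall>x<6. i \<noteq> j \<longrightarrow>
     w (syntheme i j x) = syntheme (u i) (u j) (w x))"

text \<open>The 15 pairs of totals share 15 distinct synthemes, so the action on totals is well
  determined. The bounded list quantifiers make this a finite evaluation.\<close>

lemma syntheme_inj:
  "list_all (\<lambda>i. list_all (\<lambda>j. list_all (\<lambda>k. list_all (\<lambda>l. i = j \<or> k = l \<or>
     syntheme_table ! i ! j \<noteq> syntheme_table ! k ! l \<or> i = k \<and> j = l \<or> i = l \<and> j = k)
     [0..<6]) [0..<6]) [0..<6]) [0..<6]"
  by code_simp

lemma syntheme_star:
  "list_all (\<lambda>k. list_all (\<lambda>i. list_all (\<lambda>j. list_all (\<lambda>x. k = 0 \<or> i = j \<or>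
     transpose 0 k (syntheme i j x) =
       syntheme (list_perm (star_table ! k) i) (list_perm (star_table ! k) j) (transpose 0 k x))
     [0..<6]) [0..<6]) [0..<6]) [0..<6]"
  by code_simp

text \<open>Gives faithfulness: a permutation acting trivially on the totals commutes with all
  synthemes, so it cannot take x to a y at which two synthemes differ that agree at x.\<close>

lemma syntheme_separates:
  "list_all (\<lambda>x. list_all (\<lambda>y. x = y \<or> list_ex (\<lambda>i. list_ex (\<lambda>j. list_ex (\<lambda>k. list_ex (\<lambda>l.
     i \<noteq> j \<and> k \<noteq> l \<and> syntheme i j x = syntheme k l x \<and> syntheme i j y \<noteq> syntheme k l y)
     [0..<6]) [0..<6]) [0..<6]) [0..<6]) [0..<6]) [0..<6]"
  by code_simp

lemma star_table_perm:
  "list_all (\<lambda>k. k = 0 \<or> distinct (star_table ! k) \<and> length (star_table ! k) = 6 \<and>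
     list_all (\<lambda>x. x < 6) (star_table ! k)) [0..<6]"
  by code_simp

lemma star_table_one: "list_all (\<lambda>x. list_perm (star_table ! 1) x \<noteq> x) [0..<6]"
  by code_simp

lemma syntheme_table_length:
  "list_all (\<lambda>i. list_all (\<lambda>j. length (syntheme_table ! i ! j) = 6) [0..<6]) [0..<6]"
  by code_simp

lemma list_perm_permutes:
  assumes "distinct xs" "length xs = 6" "\<And>x. x \<in> set xs \<Longrightarrow> x < 6"
  shows "list_perm xs permutes {..<6}"
proof -
  have "inj_on (list_perm xs) {..<6}"
    using assms(1,2) by (auto simp: inj_on_def list_perm_def nth_eq_iff_index_eq)
  moreover have "list_perm xs ` {..<6} \<subseteq> {..<6}"
    using assms(2,3) by (auto simp: list_perm_def)
  ultimately have "bij_betw (list_perm xs) {..<6} {..<6}"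
    by (simp add: bij_betw_def endo_inj_surj)
  then show ?thesis by (rule bij_imp_permutes) (simp add: list_perm_def)
qed

lemma syntheme_eqD:
  assumes lt: "i < 6" "j < 6" "k < 6" "l < 6" and ne: "i \<noteq> j" "k \<noteq> l"
    and eq: "\<And>x. x < 6 \<Longrightarrow> syntheme i j x = syntheme k l x"
  shows "i = k \<and> j = l \<or> i = l \<and> j = k"
proof -
  have "length (syntheme_table ! a ! b) = 6" if "a < 6" "b < 6" for a b
    using syntheme_table_length that by (simp only: list_all_iff set_upt) auto
  then have "syntheme_table ! i ! j = syntheme_table ! k ! l"
    using eq lt by (intro nth_equalityI) (auto simp: syntheme_def list_perm_def)
  moreover have "\<forall>i\<in>{0..<6}. \<forall>j\<in>{0..<6}. \<forall>k\<in>{0..<6}. \<forall>l\<in>{0..<6}. i = j \<or> k = l \<or>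
     syntheme_table ! i ! j \<noteq> syntheme_table ! k ! l \<or> i = k \<and> j = l \<or> i = l \<and> j = k"
    using syntheme_inj by (simp only: list_all_iff set_upt)
  moreover have "i \<in> {0..<6}" "j \<in> {0..<6}" "k \<in> {0..<6}" "l \<in> {0..<6}" using lt by auto
  ultimately have "i = j \<or> k = l \<or> i = k \<and> j = l \<or> i = l \<and> j = k" by blast
  then show ?thesis using ne by blast
qed

lemma totals_action_comp:
  assumes "totals_action w u" "totals_action v t" "v permutes {..<6}" "t permutes {..<6}"
  shows "totals_action (w \<circ> v) (u \<circ> t)"
  unfolding totals_action_def
proof (intro allI impI)
  fix i j x :: nat assume ij: "i < 6" "j < 6" "x < 6" "i \<noteq> j"
  have lt: "t i < 6" "t j < 6" "v x < 6"
    using permutes_in_image[OF assms(4), of i] permutes_in_image[OF assms(4), of j]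
      permutes_in_image[OF assms(3), of x] ij by simp_all
  have "t i \<noteq> t j" using permutes_inj[OF assms(4)] ij(4) by (auto dest: injD)
  have "v (syntheme i j x) = syntheme (t i) (t j) (v x)"
    using assms(2) ij by (simp add: totals_action_def)
  moreover have "w (syntheme (t i) (t j) (v x)) = syntheme (u (t i)) (u (t j)) (w (v x))"
    using assms(1) lt \<open>t i \<noteq> t j\<close> by (simp add: totals_action_def)
  ultimately show "(w \<circ> v) (syntheme i j x) = syntheme ((u \<circ> t) i) ((u \<circ> t) j) ((w \<circ> v) x)" by simp
qed

lemma star_table_permutes:
  assumes "0 < k" "k < 6" shows "list_perm (star_table ! k) permutes {..<6}"
proof -
  have k: "k \<in> {0..<6}" using assms by simp
  have "\<forall>k\<in>{0..<6}. k = 0 \<or> distinct (star_table ! k) \<and> length (star_table ! k) = 6 \<and>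
      (\<forall>x\<in>set (star_table ! k). x < 6)"
    using star_table_perm by (simp only: list_all_iff set_upt)
  from bspec[OF this k] assms(1) show ?thesis by (intro list_perm_permutes) auto
qed

lemma totals_action_star:
  assumes "0 < k" "k < 6" shows "totals_action (transpose 0 k) (list_perm (star_table ! k))"
  unfolding totals_action_def
proof (intro allI impI)
  fix i j x :: nat assume "i < 6" "j < 6" "x < 6" and ij: "i \<noteq> j"
  then have mem: "k \<in> {0..<6}" "i \<in> {0..<6}" "j \<in> {0..<6}" "x \<in> {0..<6}" using assms by auto
  have "\<forall>k\<in>{0..<6}. \<forall>i\<in>{0..<6}. \<forall>j\<in>{0..<6}. \<forall>x\<in>{0..<6}. k = 0 \<or> i = j \<or>
    transpose 0 k (syntheme i j x) =
      syntheme (list_perm (star_table ! k) i) (list_perm (star_table ! k) j) (transpose 0 k x)"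
    using syntheme_star by (simp only: list_all_iff set_upt)
  from bspec[OF bspec[OF bspec[OF bspec[OF this mem(1)] mem(2)] mem(3)] mem(4)] assms(1) ij
  show "transpose 0 k (syntheme i j x) =
      syntheme (list_perm (star_table ! k) i) (list_perm (star_table ! k) j) (transpose 0 k x)"
    by simp
qed

lemma totals_action_ex:
  assumes "w permutes {..<6}" shows "\<exists>u. u permutes {..<6} \<and> totals_action w u"
proof -
  have "w \<in> {w. w permutes {..<6} \<and> (\<exists>u. u permutes {..<6} \<and> totals_action w u)}"
  proof (rule permutes_star_induct[OF assms])
    show "id \<in> {w. w permutes {..<6} \<and> (\<exists>u. u permutes {..<6} \<and> totals_action w u)}"
      using permutes_id by (auto simp: totals_action_def intro!: exI[of _ id])
    fix v w assume "v \<in> {w. w permutes {..<6} \<and> (\<exists>u. u permutes {..<6} \<and> totals_action w u)}"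
      "w \<in> {w. w permutes {..<6} \<and> (\<exists>u. u permutes {..<6} \<and> totals_action w u)}"
    then show "v \<circ> w \<in> {w. w permutes {..<6} \<and> (\<exists>u. u permutes {..<6} \<and> totals_action w u)}"
      using totals_action_comp permutes_compose by blast
  next
    fix k :: nat assume k: "0 < k" "k < 6"
    show "transpose 0 k \<in> {w. w permutes {..<6} \<and> (\<exists>u. u permutes {..<6} \<and> totals_action w u)}"
      using star_table_permutes[OF k] totals_action_star[OF k] k by (auto intro: permutes_swap_id)
  qed
  then show ?thesis by simp
qed

text \<open>The permutation \<open>w\<close> determines the unordered pair {u i, u j} for every pair
  of totals; two pairs through i then determine u i.\<close>

lemma totals_action_unique:
  assumes w: "w permutes {..<6}" and u: "u permutes {..<6}" "totals_action w u"
    and t: "t permutes {..<6}" "totals_action w t"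
  shows "u = t"
proof
  fix i
  have pair: "u i = t i \<or> u i = t j" if ij: "i < 6" "j < 6" "i \<noteq> j" for i j
  proof -
    have lt: "u i < 6" "u j < 6" "t i < 6" "t j < 6"
      using permutes_in_image[OF u(1)] permutes_in_image[OF t(1)] ij by simp_all
    have ne: "u i \<noteq> u j" "t i \<noteq> t j"
      using permutes_inj[OF u(1)] permutes_inj[OF t(1)] ij(3) by (auto dest: injD)
    have "syntheme (u i) (u j) y = syntheme (t i) (t j) y" if y: "y < 6" for y
    proof -
      obtain x where x: "w x = y" using permutes_surj[OF w] by (metis surjD)
      then have "x < 6" using permutes_in_image[OF w, of x] y by simp
      then have "w (syntheme i j x) = syntheme (u i) (u j) y" "w (syntheme i j x) = syntheme (t i) (t j) y"
        using u(2) t(2) ij x by (auto simp: totals_action_def)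
      then show ?thesis by simp
    qed
    from syntheme_eqD[OF lt ne this] show ?thesis by blast
  qed
  show "u i = t i"
  proof (cases "i < 6")
    case True
    \<comment> \<open>Any two indices distinct from i and from each other would do.\<close>
    define j where "j = (if i = 0 then 1 else 0 :: nat)"
    define k where "k = (if i = 2 then 1 else if i = 0 then 2 else if i = 1 then 2 else 1 :: nat)"
    have jk: "j < 6" "k < 6" "i \<noteq> j" "i \<noteq> k" "j \<noteq> k" by (auto simp: j_def k_def)
    have "t j \<noteq> t k" using permutes_inj[OF t(1)] jk(5) by (auto dest: injD)
    then show ?thesis using pair[OF True jk(1,3)] pair[OF True jk(2,4)] by auto
  qed (use permutes_not_in[OF u(1), of i] permutes_not_in[OF t(1), of i] in auto)
qed

definition outer_perm :: "(nat \<Rightarrow> nat) \<Rightarrow> nat \<Rightarrow> nat" where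
  "outer_perm w = (SOME u. u permutes {..<6} \<and> totals_action w u)"

lemma outer_perm:
  assumes "w permutes {..<6}"
  shows "outer_perm w permutes {..<6}" "totals_action w (outer_perm w)"
  using someI_ex[OF totals_action_ex[OF assms]] unfolding outer_perm_def by blast+

lemma outer_perm_comp:
  assumes "v permutes {..<6}" "w permutes {..<6}"
  shows "outer_perm (v \<circ> w) = outer_perm v \<circ> outer_perm w"
proof (rule totals_action_unique)
  show vw: "v \<circ> w permutes {..<6}" using assms by (intro permutes_compose)
  show "outer_perm (v \<circ> w) permutes {..<6}" "totals_action (v \<circ> w) (outer_perm (v \<circ> w))"
    using outer_perm[OF vw] .
  show "outer_perm v \<circ> outer_perm w permutes {..<6}"
    using outer_perm assms by (intro permutes_compose)
  show "totals_action (v \<circ> w) (outer_perm v \<circ> outer_perm w)"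
    using outer_perm assms by (intro totals_action_comp) auto
qed

lemma outer_perm_eqI:
  "w permutes {..<6} \<Longrightarrow> u permutes {..<6} \<Longrightarrow> totals_action w u \<Longrightarrow> outer_perm w = u"
  using totals_action_unique outer_perm by blast

lemma outer_perm_kernel:
  assumes w: "w permutes {..<6}" and "outer_perm w = id" shows "w = id"
proof (rule ccontr)
  assume "w \<noteq> id"
  then obtain x where x: "w x \<noteq> x" by (metis eq_id_iff)
  then have x6: "x < 6" "w x < 6"
    using permutes_not_in[OF w, of x] permutes_in_image[OF w, of x] by auto
  have sep: "\<forall>x\<in>{0..<6}. \<forall>y\<in>{0..<6}. x = y \<or> (\<exists>i\<in>{0..<6}. \<exists>j\<in>{0..<6}. \<exists>k\<in>{0..<6}. \<exists>l\<in>{0..<6}.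
     i \<noteq> j \<and> k \<noteq> l \<and> syntheme i j x = syntheme k l x \<and> syntheme i j y \<noteq> syntheme k l y)"
    using syntheme_separates by (simp only: list_all_iff list_ex_iff set_upt)
  obtain i j k l where ijkl: "i < 6" "j < 6" "k < 6" "l < 6" "i \<noteq> j" "k \<noteq> l"
    "syntheme i j x = syntheme k l x" "syntheme i j (w x) \<noteq> syntheme k l (w x)"
  proof -
    assume that: "\<And>i j k l. i < 6 \<Longrightarrow> j < 6 \<Longrightarrow> k < 6 \<Longrightarrow> l < 6 \<Longrightarrow> i \<noteq> j \<Longrightarrow> k \<noteq> l \<Longrightarrow>
      syntheme i j x = syntheme k l x \<Longrightarrow> syntheme i j (w x) \<noteq> syntheme k l (w x) \<Longrightarrow> thesis"
    have mem: "x \<in> {0..<6}" "w x \<in> {0..<6}" using x6 by auto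
    from bspec[OF bspec[OF sep mem(1)] mem(2)] x that show thesis by auto
  qed
  have T: "totals_action w id" using outer_perm(2)[OF w] assms(2) by simp
  have "w (syntheme i j x) = syntheme i j (w x)" "w (syntheme k l x) = syntheme k l (w x)"
    using T ijkl(1-6) x6(1) unfolding totals_action_def by simp_all
  then show False using ijkl(7,8) by metis
qed

lemma outer_perm_inj: "inj_on outer_perm {w. w permutes {..<6}}"
proof (rule inj_onI; clarsimp)
  fix v w :: "nat \<Rightarrow> nat" assume v: "v permutes {..<6}" and w: "w permutes {..<6}" and eq: "outer_perm v = outer_perm w"
  let ?i = "inv_into UNIV w"
  have i: "?i permutes {..<6}" using w by (rule permutes_inv)
  have "outer_perm (?i \<circ> v) = outer_perm (?i \<circ> w)"
    using outer_perm_comp[OF i v] outer_perm_comp[OF i w] eq by simp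
  also have "\<dots> = id"
    using permutes_inv_o(2)[OF w] by (intro outer_perm_eqI) (auto simp: totals_action_def permutes_id)
  finally have "?i \<circ> v = id" using outer_perm_kernel permutes_compose[OF v i] by blast
  then show "v = w" using permutes_inverses(1)[OF w] by (metis comp_apply ext id_apply)
qed

lemma outer_perm_transpose: "x < 6 \<Longrightarrow> outer_perm (transpose 0 1) x \<noteq> x"
proof -
  assume x: "x < 6"
  have P: "transpose 0 1 permutes {..<6::nat}" by (intro permutes_swap_id) auto
  have "outer_perm (transpose 0 1) = list_perm (star_table ! 1)"
    by (rule outer_perm_eqI[OF P star_table_permutes totals_action_star]) auto
  then show ?thesis using star_table_one x by (simp only: list_all_iff set_upt) auto
qed

text \<open>Listing the 2-cycles in the order 0, t 0, c, t c, e, t e gives the relabelling to (0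
  1)(2 3)(4 5). Hence all fixed-point-free involutions of six points are conjugate.\<close>

lemma involution_normal_form:
  assumes t: "t permutes {..<6::nat}" "t \<circ> t = id" and ff: "\<And>i. i < 6 \<Longrightarrow> t i \<noteq> i"
  obtains u where "u permutes {..<6}" "t \<circ> u = u \<circ> list_perm [1, 0, 3, 2, 5, 4]"
proof -
  have tt: "t (t x) = x" for x using t(2) by (metis comp_apply id_apply)
  have tn: "t x < 6" if "x < 6" for x using permutes_in_image[OF t(1), of x] that by simp
  have "card {0, t 0} \<le> 2" using card_length[of "[0, t 0]"] by simp
  then have "\<not> {..<6} \<subseteq> {0, t 0}" using card_mono[of "{0, t 0}" "{..<6}"] by auto
  then obtain c where c: "c < 6" "c \<noteq> 0" "c \<noteq> t 0" by auto
  have "card {0, t 0, c, t c} \<le> 4" using card_length[of "[0, t 0, c, t c]"] by simp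
  then have "\<not> {..<6} \<subseteq> {0, t 0, c, t c}" using card_mono[of "{0, t 0, c, t c}" "{..<6}"] by auto
  then obtain e where e: "e < 6" "e \<noteq> 0" "e \<noteq> t 0" "e \<noteq> c" "e \<noteq> t c" by auto
  let ?xs = "[0, t 0, c, t c, e, t e]"
  have inj: "t x = t y \<longleftrightarrow> x = y" "t x = y \<longleftrightarrow> t y = x" for x y using tt by metis+
  have d: "distinct ?xs"
    using c e ff[of 0] ff[of c] ff[of e] inj(2)[of c 0] inj(2)[of e 0] inj(2)[of e c] by (auto simp: inj(1))
  have P: "list_perm ?xs permutes {..<6}"
    by (rule list_perm_permutes[OF d])
       (use tn[of 0] tn[OF c(1)] tn[OF e(1)] c(1) e(1) in \<open>simp_all, elim disjE, simp_all\<close>)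
  have "(t \<circ> list_perm ?xs) x = (list_perm ?xs \<circ> list_perm [1, 0, 3, 2, 5, 4]) x" for x
  proof (cases "x < 6")
    case True
    then consider "x = 0" | "x = 1" | "x = 2" | "x = 3" | "x = 4" | "x = 5" by linarith
    then show ?thesis by cases (simp_all add: list_perm_def tt)
  next
    case False
    then show ?thesis using permutes_not_in[OF t(1), of x] by (simp add: list_perm_def)
  qed
  then show thesis using that[OF P] by blast
qed

lemma involution_conj:
  assumes t: "t permutes {..<6::nat}" "t \<circ> t = id" "\<And>i. i < 6 \<Longrightarrow> t i \<noteq> i"
    and s: "s permutes {..<6::nat}" "s \<circ> s = id" "\<And>i. i < 6 \<Longrightarrow> s i \<noteq> i"
  obtains v where "v permutes {..<6}" "s = v \<circ> t \<circ> inv_into UNIV v"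
proof -
  let ?l = "list_perm [1, 0, 3, 2, 5, 4]"
  obtain u where u: "u permutes {..<6}" "t \<circ> u = u \<circ> ?l"
    using involution_normal_form[OF t] .
  obtain w where w: "w permutes {..<6}" "s \<circ> w = w \<circ> ?l"
    using involution_normal_form[OF s] .
  let ?v = "w \<circ> inv_into UNIV u"
  have v: "?v permutes {..<6}" using u w by (intro permutes_compose permutes_inv)
  have "s (?v x) = ?v (t x)" for x
  proof -
    have "t x = t (u (inv_into UNIV u x))" using permutes_inverses(1)[OF u(1)] by simp
    also have "\<dots> = u (?l (inv_into UNIV u x))" using fun_cong[OF u(2), of "inv_into UNIV u x"] by simp
    finally have "?v (t x) = w (?l (inv_into UNIV u x))" using permutes_inverses(2)[OF u(1)] by simp
    then show ?thesis using fun_cong[OF w(2), of "inv_into UNIV u x"] by simp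
  qed
  then have "s y = ?v (t (inv_into UNIV ?v y))" for y
    using permutes_inverses(1)[OF v, of y] by metis
  then have "s = ?v \<circ> t \<circ> inv_into UNIV ?v" by (auto simp: fun_eq_iff)
  then show thesis using that[OF v] by blast
qed

section \<open>The automorphisms of G(1,1,6)\<close>

context rpn
begin

definition transp_elems :: "((nat \<Rightarrow> complex) \<times> (nat \<Rightarrow> nat)) set" where
  "transp_elems = {(\<lambda>_. 1, transpose a b) | a b. a < n \<and> b < n \<and> a \<noteq> b}"

definition ffree_elems :: "((nat \<Rightarrow> complex) \<times> (nat \<Rightarrow> nat)) set" where
  "ffree_elems = {(\<lambda>_. 1, t) | t. t permutes {..<n} \<and> t \<circ> t = id \<and> (\<forall>i<n. t i \<noteq> i)}"

text \<open>The diagonal subgroup is trivial here and its orbit carries no information, so the set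
  of transpositions takes its place. It goes either to itself, exactly under the members of
  \<open>inner_auts\<close>, or to the set of fixed-point-free involutions, and both happen.\<close>

lemma card_auto_116:
  assumes r1: "r = 1" and n6: "n = 6"
  shows "card (auto WG) = 2 * (fact n * card kernel_auts)"
proof -
  have "p = 1" using p_dvd r1 by simp
  then have "card N = 1" using card_torus r1 by simp
  then obtain x0 where "N = {x0}" by (rule card_1_singletonE)
  then have N: "N = {\<lambda>_. 1}" using torus_one by simp
  have fst_one: "g = (\<lambda>_. 1, snd g)" if "g \<in> carrier WG" for g
    using that N by (cases g) (simp add: wreath_carrier)
  have NG: "NG = {\<one>\<^bsub>WG\<^esub>}" unfolding N by (simp add: wreath_one)
  let ?T = transp_elems and ?F = ffree_elems
  have P: "transpose a b permutes {..<n}" if "a < n" "b < n" for a b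
    using that by (intro permutes_swap_id) auto
  have T_sub: "?T \<subseteq> carrier WG" using P perm_mem by (auto simp: transp_elems_def)
  have T_ne_F: "(\<lambda>_. 1, t) \<notin> ?T" if "\<And>i. i < n \<Longrightarrow> t i \<noteq> i" for t :: "nat \<Rightarrow> nat"
  proof
    assume "(\<lambda>_. 1, t) \<in> ?T"
    then obtain a b where "t = transpose a b" by (auto simp: transp_elems_def)
    moreover have "card {a, b} \<le> 2" using card_length[of "[a, b]"] by simp
    then have "\<not> {..<n} \<subseteq> {a, b}" using card_mono[of "{a, b}" "{..<n}"] n6 by auto
    then obtain c where "c < n" "c \<noteq> a" "c \<noteq> b" by auto
    ultimately show False using that[of c] by simp
  qed
  have inner: "\<alpha> ` ?T = ?T" if \<alpha>: "\<alpha> \<in> inner_auts" for \<alpha>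
  proof -
    have au: "\<alpha> \<in> auto WG" using inner_auts_stab(1)[OF \<alpha>] .
    obtain u where u: "u permutes {..<n}"
      and s: "\<And>g. g \<in> carrier WG \<Longrightarrow> snd (\<alpha> g) = u \<circ> snd g \<circ> inv_into UNIV u"
      using \<alpha> unfolding inner_auts_def by blast
    have "\<alpha> ` ?T \<subseteq> ?T"
    proof (rule image_subsetI)
      fix g assume "g \<in> ?T"
      then obtain a b where ab: "a < n" "b < n" "a \<noteq> b" and g: "g = (\<lambda>_. 1, transpose a b)"
        by (auto simp: transp_elems_def)
      have gc: "g \<in> carrier WG" using perm_mem[OF P[OF ab(1,2)]] g by simp
      have "snd (\<alpha> g) = transpose (u a) (u b)"
        using s[OF gc] conj_transpose[OF u, of a b] unfolding g snd_conv by simp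
      moreover have "u a < n" "u b < n" using permutes_in_image[OF u] ab by simp_all
      moreover have "u a \<noteq> u b" using permutes_inj[OF u] ab(3) by (auto dest: injD)
      moreover have "\<alpha> g = (\<lambda>_. 1, snd (\<alpha> g))" using fst_one[OF auto_closed[OF au gc]] .
      ultimately show "\<alpha> g \<in> ?T" unfolding transp_elems_def by auto
    qed
    moreover have "finite ?T" using T_sub finite_wreath by (rule finite_subset)
    ultimately show ?thesis
      using inj_on_subset[OF auto_inj[OF au] T_sub] by (intro endo_inj_surj)
  qed
  \<comment> \<open>If one transposition has a fixed-point-free image, then all have, being
    conjugate; and every fixed-point-free involution is attained, since these are conjugate as
    well.\<close>
  have dich: "\<alpha> \<in> inner_auts \<or> \<alpha> ` ?T = ?F" if \<alpha>: "\<alpha> \<in> auto WG" for \<alpha>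
  proof -
    have "\<alpha> ` NG = NG" unfolding NG using auto_one[OF group_wreath \<alpha>] by simp
    then interpret rpn_stab r p n \<alpha> using \<alpha> by unfold_locales
    interpret sym_endo n h
      using n6 h_permutes h_comp h_inj by unfold_locales auto
    have ev: "\<alpha> (\<lambda>_. 1, w) = (\<lambda>_. 1, h w)" if "w permutes {..<n}" for w
      using fst_one[OF auto_closed[OF \<alpha> perm_mem[OF that]]] by (simp add: h_def)
    show ?thesis
    proof (cases "\<exists>a b. a < n \<and> b < n \<and> a \<noteq> b \<and> (\<forall>i<n. h (transpose a b) i \<noteq> i)")
      case False
      have "\<alpha> \<in> inner_auts" by (rule in_inner_auts) (use False n6 in auto)
      then show ?thesis ..
    next
      case True
      then obtain a b where ab: "a < n" "b < n" "a \<noteq> b"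
        and ff: "\<And>i. i < n \<Longrightarrow> h (transpose a b) i \<noteq> i" by blast
      let ?t = "h (transpose a b)"
      have tP: "?t permutes {..<n}" using h_permutes[OF P[OF ab(1,2)]] .
      have t2: "?t \<circ> ?t = id" using comp[OF P[OF ab(1,2)] P[OF ab(1,2)]] h_id by simp
      have cj: "h (w \<circ> transpose a b \<circ> inv_into UNIV w) = h w \<circ> ?t \<circ> inv_into UNIV (h w)"
        if w: "w permutes {..<n}" for w
        using w P[OF ab(1,2)] h_inv[OF w] by (simp add: comp inv_perm permutes_compose)
      have "\<alpha> ` ?T \<subseteq> ?F"
      proof (rule image_subsetI)
        fix g assume "g \<in> ?T"
        then obtain c d where cd: "c < n" "d < n" "c \<noteq> d" and g: "g = (\<lambda>_. 1, transpose c d)"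
          by (auto simp: transp_elems_def)
        obtain w where w: "w permutes {..<n}" "w a = c" "w b = d"
          using permutes_two_points[OF ab(1,2) cd(1,2) ab(3) cd(3)] .
        let ?s = "h (transpose c d)"
        have s: "?s = h w \<circ> ?t \<circ> inv_into UNIV (h w)"
          using cj[OF w(1)] conj_transpose[OF w(1), of a b] w(2,3) by simp
        have hw: "h w permutes {..<n}" using h_permutes[OF w(1)] .
        have "?s i \<noteq> i" if i: "i < n" for i
        proof
          assume "?s i = i"
          then have "h w (?t (inv_into UNIV (h w) i)) = h w (inv_into UNIV (h w) i)"
            using permutes_inverses(1)[OF hw, of i] unfolding s by simp
          then have "?t (inv_into UNIV (h w) i) = inv_into UNIV (h w) i"
            using permutes_inj[OF hw] by (auto dest: injD)
          moreover have "inv_into UNIV (h w) i < n"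
            using permutes_in_image[OF inv_perm[OF hw], of i] i by simp
          ultimately show False using ff by blast
        qed
        moreover have "?s \<circ> ?s = id"
          using comp[OF P[OF cd(1,2)] P[OF cd(1,2)]] h_id by simp
        ultimately show "\<alpha> g \<in> ?F"
          using ev[OF P[OF cd(1,2)]] h_permutes[OF P[OF cd(1,2)]] unfolding g ffree_elems_def by auto
      qed
      moreover have "?F \<subseteq> \<alpha> ` ?T"
      proof
        fix g assume "g \<in> ?F"
        then obtain s where s: "s permutes {..<n}" "s \<circ> s = id" "\<forall>i<n. s i \<noteq> i" and g: "g = (\<lambda>_. 1, s)"
          by (auto simp: ffree_elems_def)
        have tP6: "?t permutes {..<6}" and sP6: "s permutes {..<6}" using tP s(1) n6 by simp_all
        have ff6: "\<And>i. i < 6 \<Longrightarrow> ?t i \<noteq> i" and sf6: "\<And>i. i < 6 \<Longrightarrow> s i \<noteq> i"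
          using ff s(3) n6 by simp_all
        obtain v where v: "v permutes {..<6}" "s = v \<circ> ?t \<circ> inv_into UNIV v"
          using involution_conj[OF tP6 t2 ff6 sP6 s(2) sf6] by metis
        have vn: "v permutes {..<n}" using v(1) n6 by simp
        obtain w where w: "w permutes {..<n}" "h w = v" using surj[OF vn] .
        have "s = h (transpose (w a) (w b))"
          using cj[OF w(1)] conj_transpose[OF w(1), of a b] v(2) w(2) by simp
        moreover have lt: "w a < n" "w b < n" using permutes_in_image[OF w(1)] ab by simp_all
        moreover have "w a \<noteq> w b" using permutes_inj[OF w(1)] ab(3) by (auto dest: injD)
        ultimately show "g \<in> \<alpha> ` ?T"
          using ev[OF P[OF lt]] g
          by (intro image_eqI[of _ _ "(\<lambda>_. 1, transpose (w a) (w b))"]) (auto simp: transp_elems_def)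
      qed
      ultimately show ?thesis by blast
    qed
  qed
  define \<omega> where "\<omega> = restrict (\<lambda>g. (\<lambda>_ :: nat. 1 :: complex, outer_perm (snd g))) (carrier WG)"
  have \<omega>: "\<omega> \<in> auto WG"
    unfolding \<omega>_def
  proof (rule restrict_autoI[OF finite_wreath])
    show "(\<lambda>_. 1, outer_perm (snd g)) \<in> carrier WG" if "g \<in> carrier WG" for g
      using outer_perm(1)[of "snd g"] snd_permutes[OF that] n6 by (intro perm_mem) simp
    show "inj_on (\<lambda>g. (\<lambda>_ :: nat. 1 :: complex, outer_perm (snd g))) (carrier WG)"
    proof (rule inj_onI)
      fix g g' assume g: "g \<in> carrier WG" "g' \<in> carrier WG"
        and eq: "(\<lambda>_ :: nat. 1 :: complex, outer_perm (snd g)) = (\<lambda>_. 1, outer_perm (snd g'))"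
      have "snd g = snd g'"
        using inj_onD[OF outer_perm_inj, of "snd g" "snd g'"] eq snd_permutes[OF g(1)] snd_permutes[OF g(2)] n6
        by simp
      then show "g = g'" using fst_one[OF g(1)] fst_one[OF g(2)] by simp
    qed
    show "(\<lambda>_. 1, outer_perm (snd (g \<otimes>\<^bsub>WG\<^esub> g'))) =
        (\<lambda>_. 1, outer_perm (snd g)) \<otimes>\<^bsub>WG\<^esub> (\<lambda>_. 1, outer_perm (snd g'))"
      if "g \<in> carrier WG" "g' \<in> carrier WG" for g g'
      using outer_perm_comp[of "snd g'" "snd g"] snd_permutes[OF that(1)] snd_permutes[OF that(2)] n6
      by (simp add: snd_wreath_mult wreath_mult)
  qed simp
  let ?g = "(\<lambda>_. 1, transpose 0 1) :: (nat \<Rightarrow> complex) \<times> (nat \<Rightarrow> nat)"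
  have g: "?g \<in> ?T" unfolding transp_elems_def mem_Collect_eq
    by (rule exI[of _ 0], rule exI[of _ 1]) (use n_gt in simp)
  have "\<omega> ?g = (\<lambda>_. 1, outer_perm (transpose 0 1))"
    using g T_sub by (auto simp: \<omega>_def)
  then have "\<omega> ?g \<notin> ?T" using T_ne_F outer_perm_transpose n6 by simp
  then have \<omega>T: "\<omega> ` ?T \<noteq> ?T" using g by blast
  then have \<omega>F: "\<omega> ` ?T = ?F" using dich[OF \<omega>] inner by blast
  have "(\<lambda>\<alpha>. \<alpha> ` ?T) ` auto WG = {?T, ?F}"
  proof (intro equalityI subsetI)
    fix L assume "L \<in> (\<lambda>\<alpha>. \<alpha> ` ?T) ` auto WG"
    then obtain \<alpha> where "\<alpha> \<in> auto WG" "L = \<alpha> ` ?T" by (elim imageE)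
    then show "L \<in> {?T, ?F}" using dich[of \<alpha>] inner[of \<alpha>] by auto
  next
    fix L assume L: "L \<in> {?T, ?F}"
    have "(\<lambda>x\<in>carrier WG. x) ` ?T = (\<lambda>x. x) ` ?T"
      using T_sub by (intro image_cong) auto
    then have "?T = (\<lambda>x\<in>carrier WG. x) ` ?T" by simp
    then have "?T \<in> (\<lambda>\<alpha>. \<alpha> ` ?T) ` auto WG" using W.id_in_auto by (rule image_eqI)
    moreover have "?F \<in> (\<lambda>\<alpha>. \<alpha> ` ?T) ` auto WG" using \<omega>F[symmetric] \<omega> by (rule image_eqI)
    ultimately show "L \<in> (\<lambda>\<alpha>. \<alpha> ` ?T) ` auto WG" using L by auto
  qed
  then have O: "card ((\<lambda>\<alpha>. \<alpha> ` ?T) ` auto WG) = 2" using \<omega>T \<omega>F by (simp add: card_insert_if)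
  have "{\<alpha> \<in> auto WG. \<alpha> ` ?T = ?T} = inner_auts"
  proof (intro equalityI subsetI)
    fix \<alpha> assume "\<alpha> \<in> {\<alpha> \<in> auto WG. \<alpha> ` ?T = ?T}"
    then show "\<alpha> \<in> inner_auts" using dich[of \<alpha>] \<omega>T \<omega>F by auto
  qed (use inner inner_auts_stab(1) in auto)
  then show ?thesis
    using card_auto_eq_card_orbit_mult[OF group_wreath finite_wreath T_sub] O card_inner_auts n6 by simp
qed

section \<open>Assembling the orders\<close>

lemma real_pow_div: "real r ^ n / real p = real r ^ (n - 1) * real m"
proof -
  have "real r ^ n = real r ^ (n - 1) * real r" using n_gt by (simp flip: power_Suc2)
  then show ?thesis by (simp add: real_of_nat_div[OF p_dvd])
qed

lemma card_auto_wreath: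
  assumes e: "e = (GREATEST d. d dvd m \<and> coprime d n)"
  shows "real (card (auto WG)) =
    c_aut r p n / c_center r p n * real (totient r) * (real (totient e) / real e)
      * fact n * (real r ^ n / real p)"
proof -
  define k where "k = (if 3 \<le> n \<and> even r \<and> even (n * m) then 2 else 1 :: nat)"
  define f where "f = (if n = 2 then 1 else fact n :: nat)"
  have e0: "e > 0" using greatest_coprime_divisor(1)[OF m_pos e] m_pos by (auto intro: Nat.gr0I)
  have K: "e * card kernel_auts = totient r * (m * totient e) * r ^ (n - 1) * k"
    using card_kernel_params[OF e] unfolding card_kernel_auts k_def .
  \<comment> \<open>Here \<open>a\<close> is the size of the orbit of the diagonal subgroup (of the
    set of transpositions for S_6), \<open>f\<close> the number of distinct permutation conjugations
    on S_n, and \<open>k\<close> the number of sign twists. The tabulated c/c' equals a f k /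
    n!.\<close>
  have "\<exists>a. card (auto WG) = a * (f * card kernel_auts) \<and>
    real a * real f * real k = c_aut r p n / c_center r p n * fact n"
  proof (cases "n = 6 \<and> r = 1")
    case True
    then have "p = 1" using p_dvd by simp
    then show ?thesis
      using card_auto_116 True by (intro exI[of _ 2]) (simp add: f_def k_def c_aut_def c_center_def)
  next
    case False
    let ?O = "card ((\<lambda>\<alpha>. \<alpha> ` NG) ` auto WG)"
    have "card (auto WG) = ?O * (f * card kernel_auts)"
      using card_auto_eq_card_orbit_mult[OF group_wreath finite_wreath NG_sub] card_stab[OF False]
      by (simp add: f_def)
    moreover have "real ?O * real f * real k = c_aut r p n / c_center r p n * fact n"
    proof (cases "(r, p, n) \<in> {(2, 1, 2), (2, 2, 2), (4, 2, 2), (3, 3, 3), (2, 2, 4)}")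
      case True
      then consider (a) "r = 2" "p = 1" "n = 2" | (b) "r = 2" "p = 2" "n = 2" | (c) "r = 4" "p = 2" "n = 2"
        | (d) "r = 3" "p = 3" "n = 3" | (e) "r = 2" "p = 2" "n = 4" by auto
      then show ?thesis
      proof cases
        case a
        then show ?thesis unfolding orbit_212[OF a] by (simp add: f_def k_def c_aut_def c_center_def)
      next
        case b
        then show ?thesis unfolding orbit_222[OF b] by (simp add: f_def k_def c_aut_def c_center_def)
      next
        case c
        then show ?thesis unfolding orbit_422[OF c] by (simp add: f_def k_def c_aut_def c_center_def)
      next
        case d
        then show ?thesis unfolding orbit_333[OF d] by (simp add: f_def k_def c_aut_def c_center_def)
      next
        case e
        then show ?thesis unfolding orbit_224[OF e] by (simp add: f_def k_def c_aut_def c_center_def)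
      qed
    next
      case gen: False
      have O: "?O = 1" by (rule orbit_generic[OF gen])
      show ?thesis
      proof (cases "n = 2")
        case True
        have ex: "(r, p, n) \<noteq> (2, 2, 2)" "(r, p, n) \<noteq> (2, 1, 2)" "(r, p, n) \<noteq> (4, 2, 2)"
          "(r, p, n) \<noteq> (3, 3, 3)" "(r, p, n) \<noteq> (2, 2, 4)" "(r, p, n) \<noteq> (1, 1, 6)"
          using gen True by auto
        show ?thesis
          unfolding O using True ex
          by (cases "(r, p, n) = (1, 1, 2)") (simp_all add: f_def k_def c_aut_def c_center_def)
      next
        case n3: False
        \<comment> \<open>If r is even and n m is odd, there is no sign twist; then m is odd, so p
          is even, and this is the case of the general formula with c = 1 for even r.\<close>
        have "even p" if "even r" "odd (n * m)" using that r_eq by (metis even_mult_iff)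
        then have "real k = c_aut r p n"
          using n3 n_gt gen False p_dvd by (auto simp: k_def c_aut_def)
        moreover have "c_center r p n = 1" using n3 by (simp add: c_center_def)
        ultimately show ?thesis using n3 by (simp add: O f_def)
      qed
    qed
    ultimately show ?thesis by blast
  qed
  then obtain a where a: "card (auto WG) = a * (f * card kernel_auts)"
    "real a * real f * real k = c_aut r p n / c_center r p n * fact n" by blast
  have "real e * real (card (auto WG)) = real a * real f * real (e * card kernel_auts)"
    using a(1) by simp
  also have "\<dots> = (real a * real f * real k) * (real (totient r) * real (totient e)) * (real r ^ (n - 1) * real m)"
    unfolding K by simp
  finally have E: "real e * real (card (auto WG)) =
      (c_aut r p n / c_center r p n * fact n) * (real (totient r) * real (totient e)) * (real r ^ (n - 1) * real m)"
    unfolding a(2) .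
  have "real (card (auto WG)) = real e * real (card (auto WG)) / real e" using e0 by simp
  then show ?thesis unfolding real_pow_div E by simp
qed

end

theorem corollary4p1:
  fixes r p n e :: nat
  assumes "r > 0" and "p > 0" and "p dvd r" and "n > 1"
    and "e = (GREATEST d. d dvd r div p \<and> coprime d n)"
  shows
    "real (card (carrier (AutoGroup (Grpn r p n)))) =
       c_aut r p n / c_center r p n * real (totient r) * (real (totient e) / real e)
         * fact n * (real r ^ n / real p)
     \<and> real (card (carrier (Out (Grpn r p n)))) =
       c_aut r p n * real (totient r) * (real (totient e) / real e)
         * (real r / real p) * real (gcd p n)
     \<and> real (card (center (Grpn r p n))) =
       c_center r p n * (real r / real p) * real (gcd p n)"
proof -
  interpret rpn r p n using assms(1-4) by unfold_locales
  interpret G: group "Grpn r p n" by (rule group_Grpn)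
  have aut: "real (card (auto (Grpn r p n))) =
      c_aut r p n / c_center r p n * real (totient r) * (real (totient e) / real e)
        * fact n * (real r ^ n / real p)"
    unfolding card_auto_Grpn by (rule card_auto_wreath[OF assms(5)])
  have inn: "card (carrier (Grpn r p n)) = card (Inn (Grpn r p n)) * card (center (Grpn r p n))"
    by (rule G.order_eq_card_Inn_mult[OF finite_Grpn])
  have out: "card (carrier (Out (Grpn r p n))) * card (Inn (Grpn r p n)) = card (auto (Grpn r p n))"
    by (rule G.card_Out[OF finite_Grpn])
  have ord: "real (card (carrier (Grpn r p n))) = fact n * (real r ^ n / real p)"
    unfolding real_pow_div by (simp add: card_Grpn)
  have pos: "fact n * (real r ^ n / real p) > 0" using r_pos p_pos by simp
  have c0: "c_center r p n \<noteq> 0" by (simp add: c_center_def)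
  let ?o = "real (card (carrier (Out (Grpn r p n))))" and ?i = "real (card (Inn (Grpn r p n)))"
    and ?z = "real (card (center (Grpn r p n)))"
  have "?o * (fact n * (real r ^ n / real p)) = ?o * ?i * ?z"
    unfolding ord[symmetric] inn by simp
  also have "?o * ?i = real (card (auto (Grpn r p n)))"
    unfolding out[symmetric] by simp
  \<comment> \<open>The factor c' of the centre cancels the denominator in the order of the
    automorphism group, so only c survives for the outer one.\<close>
  also have "\<dots> * ?z = (c_aut r p n * real (totient r) * (real (totient e) / real e)
         * (real r / real p) * real (gcd p n)) * (fact n * (real r ^ n / real p))"
    unfolding aut card_center_Grpn using c0 by simp
  finally have "?o = c_aut r p n * real (totient r) * (real (totient e) / real e)
         * (real r / real p) * real (gcd p n)"
    by (rule mult_right_cancel[THEN iffD1, rotated]) (use pos in linarith)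
  then show ?thesis using aut card_center_Grpn by simp
qed

end
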